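(* Let $A$ be a positive compact operator on a Banach lattice $E$, and let $\mathcal A_1$ and $\mathcal A_2$ be the Banach algebras generated by $\langle A]$ and $[A\rangle$, respectively. Then: (a) the operator $AB-BA$ is in the radical of the Banach algebra $\mathcal A_1$ for every $B\in\mathcal A_1$; (b) the operator $AB-BA$ is in the radical of the Banach algebra $\mathcal A_2$ for every $B\in\mathcal A_2$.
   Context: An operator on a Banach lattice $E$ is positive if it maps the positive cone $E^+$ into itself (positive operators are automatically bounded); $S\ge T$ means that $S-T$ is positive. $\mathcal L_+(E)$ denotes the set of all positive operators on $E$. For a positive operator $A$ on $E$, the super right-commutant and the super left-commutant are $$[A\rangle=\{B\in\mathcal L_+(E): BA\ge AB\},\qquad \langle A]=\{B\in\mathcal L_+(E): AB\ge BA\}.$$ The Banach algebra generated by a set of bounded operators is the norm closure in $\mathcal L(E)$ (the bounded operators on $E$) of the algebra generated by that set. The radical of a Banach algebra $\mathcal A$ is the intersection of all maximal modular left ideals of $\mathcal A$ (equivalently, of all maximal modular right ideals); if $\mathcal A$ is unital it equals $\{a\in\mathcal A: r(ba)=0 \text{ for all } b\in\mathcal A\}=\{a\in\mathcal A: r(ab)=0 \text{ for all } b\in\mathcal A\}$, where $r$ is the spectral radius. For a non-unital algebra, spectra are computed in the standard unitization. *)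

theory Defs
  imports "HOL-Analysis.Analysis" "HOL-Library.Lattice_Algebras"
begin

text \<open>The modulus of a Banach lattice is \<open>\<bar>x\<bar> = sup x (- x)\<close>; this is the axiom of the
  parent class \<^class>\<open>lattice_ab_group_add_abs\<close>.\<close>

class banach_lattice = banach + ordered_real_vector + lattice_ab_group_add_abs +
  assumes norm_mono_abs: "\<bar>x\<bar> \<le> \<bar>y\<bar> \<Longrightarrow> norm x \<le> norm y"

text \<open>Positive operators are taken as elements of the space of bounded operators. This loses
  nothing, since every positive linear operator on a Banach lattice is bounded.\<close>

definition positive_op :: "('a::banach_lattice \<Rightarrow>\<^sub>L 'a) \<Rightarrow> bool" where
  "positive_op T \<longleftrightarrow> (\<forall>x\<ge>0. 0 \<le> blinfun_apply T x)"

definition op_ge :: "('a::banach_lattice \<Rightarrow>\<^sub>L 'a) \<Rightarrow> ('a \<Rightarrow>\<^sub>L 'a) \<Rightarrow> bool" where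
  "op_ge S T \<longleftrightarrow> positive_op (S - T)"

definition compact_op :: "('a::real_normed_vector \<Rightarrow>\<^sub>L 'b::real_normed_vector) \<Rightarrow> bool" where
  "compact_op T \<longleftrightarrow> (\<forall>S. bounded S \<longrightarrow> compact (closure (blinfun_apply T ` S)))"

definition super_right_commutant ::
    "('a::banach_lattice \<Rightarrow>\<^sub>L 'a) \<Rightarrow> ('a \<Rightarrow>\<^sub>L 'a) set" where
  "super_right_commutant A = {B. positive_op B \<and> op_ge (B o\<^sub>L A) (A o\<^sub>L B)}"

definition super_left_commutant ::
    "('a::banach_lattice \<Rightarrow>\<^sub>L 'a) \<Rightarrow> ('a \<Rightarrow>\<^sub>L 'a) set" where
  "super_left_commutant A = {B. positive_op B \<and> op_ge (A o\<^sub>L B) (B o\<^sub>L A)}"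

text \<open>Algebras of operators are real and not required to contain the identity.\<close>

definition operator_algebra :: "('a::real_normed_vector \<Rightarrow>\<^sub>L 'a) set \<Rightarrow> bool" where
  "operator_algebra \<A> \<longleftrightarrow> subspace \<A> \<and> (\<forall>S\<in>\<A>. \<forall>T\<in>\<A>. S o\<^sub>L T \<in> \<A>)"

definition banach_algebra_generated ::
    "('a::real_normed_vector \<Rightarrow>\<^sub>L 'a) set \<Rightarrow> ('a \<Rightarrow>\<^sub>L 'a) set" where
  "banach_algebra_generated S = closure (operator_algebra hull S)"

definition left_ideal_of ::
    "('a::real_normed_vector \<Rightarrow>\<^sub>L 'a) set \<Rightarrow> ('a \<Rightarrow>\<^sub>L 'a) set \<Rightarrow> bool" where
  "left_ideal_of \<A> J \<longleftrightarrow> J \<subseteq> \<A> \<and> subspace J \<and> (\<forall>S\<in>\<A>. \<forall>T\<in>J. S o\<^sub>L T \<in> J)"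

definition modular_left_ideal_of ::
    "('a::real_normed_vector \<Rightarrow>\<^sub>L 'a) set \<Rightarrow> ('a \<Rightarrow>\<^sub>L 'a) set \<Rightarrow> bool" where
  "modular_left_ideal_of \<A> J \<longleftrightarrow>
     left_ideal_of \<A> J \<and> (\<exists>U\<in>\<A>. \<forall>T\<in>\<A>. T - (T o\<^sub>L U) \<in> J)"

text \<open>Every left ideal containing a modular one is modular, so maximality among all proper left
  ideals and maximality among the proper modular ones coincide for modular ideals.\<close>

definition maximal_modular_left_ideal_of ::
    "('a::real_normed_vector \<Rightarrow>\<^sub>L 'a) set \<Rightarrow> ('a \<Rightarrow>\<^sub>L 'a) set \<Rightarrow> bool" where
  "maximal_modular_left_ideal_of \<A> J \<longleftrightarrow>
     modular_left_ideal_of \<A> J \<and> J \<noteq> \<A> \<and>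
     (\<forall>K. left_ideal_of \<A> K \<longrightarrow> J \<subseteq> K \<longrightarrow> K = J \<or> K = \<A>)"

text \<open>The intersection is taken inside \<open>\<A>\<close>: if there are no maximal modular left ideals,
  the radical is all of \<open>\<A>\<close>.\<close>

definition operator_radical :: "('a::real_normed_vector \<Rightarrow>\<^sub>L 'a) set \<Rightarrow> ('a \<Rightarrow>\<^sub>L 'a) set" where
  "operator_radical \<A> = \<A> \<inter> \<Inter> {J. maximal_modular_left_ideal_of \<A> J}"

end

theory Submission
  imports Defs
begin

text \<open>
  Write \<open>\<delta> M\<close> for \<open>A M - M A\<close> on the left super commutant \<open>S\<close> and for \<open>M A - A M\<close> on the right one.
  In both cases \<open>S\<close> is a convex cone of positive operators, closed under products and containing
  \<open>1\<close> and \<open>A\<close>, and \<open>\<delta>\<close> is a derivation with \<open>\<delta> M \<ge> 0\<close> for \<open>M\<close> in \<open>S\<close>. The proof has two parts.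

  The compact positive operator \<open>K = C (\<delta> B)\<close> is quasinilpotent for all \<open>B\<close> and \<open>C\<close> in \<open>S\<close>
  (\<open>spec_rad_commutator_zero\<close>). If its spectral radius \<open>\<lambda>\<close> were positive, there would be closed
  \<open>S\<close>-invariant ideals \<open>J0 \<subset> J\<close> with no further invariant ideal in between such that \<open>K\<close> still has
  an eigenvector at \<open>\<lambda>\<close> in \<open>J / J0\<close>. There the spectral radius \<open>\<rho>\<close> of \<open>A\<close> is positive, because \<open>K\<^sup>n\<close> is
  at most \<open>A\<^sup>n (C B)\<^sup>n\<close> or \<open>(C B)\<^sup>n A\<^sup>n\<close>. But on an irreducible quotient with \<open>\<rho> > 0\<close> all commutators
  vanish (\<open>commutator_zero_on_irreducible\<close>). The reason is the identity
  \<open>R (A M - M A) R = R M - M R\<close> for \<open>R = (t - A)\<^sup>-\<^sup>1\<close>, whose left-hand side is quadratic in \<open>R\<close> and, up to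
  sign, positive, while the right-hand side is only linear. As \<open>t\<close> decreases to \<open>\<rho>\<close>, the norm of \<open>R\<close>
  tends to infinity, and \<open>R\<close>, normalized, produces a positive eigenvector \<open>z\<close> of \<open>A\<close>. So \<open>R\<close> is of
  smaller order than its norm on \<open>\<delta> M z\<close>, and the vectors with this property make up a proper closed
  ideal, which irreducibility forces to be zero. All of this is done in the quotient seminorm with
  partial sums of the Neumann series, without complex spectral theory and without duality.

  An element of the Banach algebra generated by \<open>S\<close> need not be dominated by an element of \<open>S\<close>, so
  quasinilpotence of the products \<open>C (\<delta> B)\<close> does not carry over to it by domination. Instead, for a
  maximal left ideal \<open>J\<close> the assumption \<open>\<delta> B \<notin> J\<close> is refuted by Hilden's argument for Lomonosov's
  theorem (\<open>commutator_in_maximal_left_ideal\<close>). Compactness of \<open>\<delta> B\<close> makes it possible to move \<open>1 + J\<close>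
  around inside a small ball by arbitrarily long products \<open>Z\<^sub>n (\<delta> B) \<dots> Z\<^sub>1 (\<delta> B)\<close> with factors \<open>Z\<^sub>i\<close>
  from a finite subset of the dense subalgebra, all dominated by a single \<open>W\<close> in \<open>S\<close>; but some power
  of \<open>W (\<delta> B)\<close> is small.
\<close>

section \<open>Banach lattices and their closed ideals\<close>

lemma abs_scaleR_nonneg:
  fixes x :: "'a::banach_lattice"
  assumes "0 \<le> c"
  shows "\<bar>c *\<^sub>R x\<bar> = c *\<^sub>R \<bar>x\<bar>"
proof (cases "c = 0")
  case False
  have le: "\<bar>c *\<^sub>R y\<bar> \<le> c *\<^sub>R \<bar>y\<bar>" if "0 \<le> c" for c and y :: 'a
  proof (rule abs_leI)
    show "c *\<^sub>R y \<le> c *\<^sub>R \<bar>y\<bar>"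
      using that by (intro scaleR_left_mono abs_ge_self) auto
    have "c *\<^sub>R (- y) \<le> c *\<^sub>R \<bar>y\<bar>"
      using that by (intro scaleR_left_mono abs_ge_minus_self) auto
    then show "- (c *\<^sub>R y) \<le> c *\<^sub>R \<bar>y\<bar>" by simp
  qed
  have "\<bar>x\<bar> \<le> inverse c *\<^sub>R \<bar>c *\<^sub>R x\<bar>"
    using le[of "inverse c" "c *\<^sub>R x"] assms False by simp
  then have "c *\<^sub>R \<bar>x\<bar> \<le> c *\<^sub>R (inverse c *\<^sub>R \<bar>c *\<^sub>R x\<bar>)"
    using assms by (intro scaleR_left_mono) auto
  then have "c *\<^sub>R \<bar>x\<bar> \<le> \<bar>c *\<^sub>R x\<bar>"
    using False by simp
  then show ?thesis
    using le[OF assms, of x] by (rule antisym[rotated])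
qed simp

lemma norm_abs [simp]: "norm \<bar>x\<bar> = norm (x :: 'a::banach_lattice)"
  by (intro antisym norm_mono_abs) simp_all

lemma norm_abs_diff_le: "norm (\<bar>x\<bar> - \<bar>y\<bar>) \<le> norm (x - y :: 'a::banach_lattice)"
  by (intro norm_mono_abs abs_triangle_ineq3)

lemma tendsto_abs_lattice:
  fixes f :: "'b \<Rightarrow> 'a::banach_lattice"
  assumes "(f \<longlongrightarrow> l) F"
  shows "((\<lambda>x. \<bar>f x\<bar>) \<longlongrightarrow> \<bar>l\<bar>) F"
proof (rule Lim_transform_bound[where g = "\<lambda>x. f x - l", THEN LIM_zero_cancel])
  show "\<forall>\<^sub>F x in F. norm (\<bar>f x\<bar> - \<bar>l\<bar>) \<le> norm (f x - l)"
    by (simp add: norm_abs_diff_le)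
  show "((\<lambda>x. f x - l) \<longlongrightarrow> 0) F"
    using assms by (rule LIM_zero)
qed

lemma nonneg_iff_abs: "0 \<le> x \<longleftrightarrow> \<bar>x\<bar> = (x :: 'a::banach_lattice)"
  by (metis abs_ge_zero abs_of_nonneg)

lemma LIMSEQ_nonneg:
  fixes f :: "nat \<Rightarrow> 'a::banach_lattice"
  assumes "f \<longlonglongrightarrow> l" "\<And>n. 0 \<le> f n"
  shows "0 \<le> l"
proof -
  have "(\<lambda>n. \<bar>f n\<bar>) \<longlonglongrightarrow> \<bar>l\<bar>"
    by (rule tendsto_abs_lattice[OF assms(1)])
  then have "f \<longlonglongrightarrow> \<bar>l\<bar>"
    using assms(2) by simp
  then show ?thesis
    using assms(1) LIMSEQ_unique nonneg_iff_abs by metis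
qed

lemma closed_nonneg: "closed {x :: 'a::banach_lattice. 0 \<le> x}"
  unfolding closed_sequential_limits
proof (intro allI impI)
  fix f and l :: 'a assume "(\<forall>n. f n \<in> {x. 0 \<le> x}) \<and> f \<longlonglongrightarrow> l"
  then show "l \<in> {x. 0 \<le> x}"
    using LIMSEQ_nonneg[of f l] by simp
qed

lemma positive_opD: "positive_op T \<Longrightarrow> 0 \<le> x \<Longrightarrow> 0 \<le> blinfun_apply T x"
  by (simp add: positive_op_def)

lemma positive_op_mono: "positive_op T \<Longrightarrow> x \<le> y \<Longrightarrow> blinfun_apply T x \<le> blinfun_apply T y"
  using positive_opD[of T "y - x"] by (simp add: blinfun.diff_right)

lemma positive_op_abs:
  assumes "positive_op T"
  shows "\<bar>blinfun_apply T x\<bar> \<le> blinfun_apply T \<bar>x\<bar>"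
proof (rule abs_leI)
  show "blinfun_apply T x \<le> blinfun_apply T \<bar>x\<bar>"
    by (intro positive_op_mono[OF assms] abs_ge_self)
  have "blinfun_apply T (- x) \<le> blinfun_apply T \<bar>x\<bar>"
    by (intro positive_op_mono[OF assms] abs_ge_minus_self)
  then show "- blinfun_apply T x \<le> blinfun_apply T \<bar>x\<bar>"
    by (simp add: blinfun.minus_right)
qed

lemma positive_op_compose: "positive_op S \<Longrightarrow> positive_op T \<Longrightarrow> positive_op (S o\<^sub>L T)"
  by (simp add: positive_op_def)

lemma positive_op_add: "positive_op S \<Longrightarrow> positive_op T \<Longrightarrow> positive_op (S + T)"
  by (simp add: positive_op_def blinfun.add_left)

lemma positive_op_scaleR: "positive_op T \<Longrightarrow> 0 \<le> c \<Longrightarrow> positive_op (c *\<^sub>R T)"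
  by (simp add: positive_op_def blinfun.scaleR_left scaleR_nonneg_nonneg)

lemma positive_op_id: "positive_op id_blinfun"
  by (simp add: positive_op_def)

definition closed_ideal :: "'a::banach_lattice set \<Rightarrow> bool" where
  "closed_ideal J \<longleftrightarrow> closed J \<and> subspace J \<and> (\<forall>x\<in>J. \<forall>y. \<bar>y\<bar> \<le> \<bar>x\<bar> \<longrightarrow> y \<in> J)"

definition leaves_invariant :: "('a::banach_lattice \<Rightarrow>\<^sub>L 'a) \<Rightarrow> 'a set \<Rightarrow> bool" where
  "leaves_invariant T J \<longleftrightarrow> (\<forall>x\<in>J. blinfun_apply T x \<in> J)"

lemma closed_idealD:
  assumes "closed_ideal J"
  shows "closed J" "subspace J" "\<And>x y. x \<in> J \<Longrightarrow> \<bar>y\<bar> \<le> \<bar>x\<bar> \<Longrightarrow> y \<in> J"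
    "\<And>x. x \<in> J \<Longrightarrow> \<bar>x\<bar> \<in> J" "\<And>x. \<bar>x\<bar> \<in> J \<Longrightarrow> x \<in> J" "0 \<in> J" "J \<noteq> {}"
    "\<And>x y. x \<in> J \<Longrightarrow> 0 \<le> y \<Longrightarrow> y \<le> x \<Longrightarrow> y \<in> J"
proof -
  show "closed J" "subspace J" and solid: "\<And>x y. x \<in> J \<Longrightarrow> \<bar>y\<bar> \<le> \<bar>x\<bar> \<Longrightarrow> y \<in> J"
    using assms by (auto simp: closed_ideal_def)
  show "\<bar>x\<bar> \<in> J" if "x \<in> J" for x
    using solid[OF that, of "\<bar>x\<bar>"] by simp
  show "x \<in> J" if "\<bar>x\<bar> \<in> J" for x
    using solid[OF that, of x] by simp
  show "0 \<in> J" "J \<noteq> {}"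
    using subspace_0[OF \<open>subspace J\<close>] by auto
  show "y \<in> J" if "x \<in> J" "0 \<le> y" "y \<le> x" for x y
    using solid[OF that(1), of y] that by (metis abs_of_nonneg order_trans)
qed

lemma closed_ideal_UNIV: "closed_ideal UNIV"
  by (simp add: closed_ideal_def)

lemma closed_ideal_zero: "closed_ideal {0}"
  by (auto simp: closed_ideal_def)

lemma closed_ideal_Inter: "(\<And>J. J \<in> \<F> \<Longrightarrow> closed_ideal J) \<Longrightarrow> closed_ideal (\<Inter>\<F>)"
  by (auto simp: closed_ideal_def intro!: subspace_Inter closed_Inter)

lemma leaves_invariant_compose:
  "leaves_invariant S J \<Longrightarrow> leaves_invariant T J \<Longrightarrow> leaves_invariant (S o\<^sub>L T) J"
  by (simp add: leaves_invariant_def)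

text \<open>Cutting \<open>y\<close> off at height \<open>\<bar>j\<bar>\<close> produces an element of the ideal, and what is cut off is
  dominated by \<open>(\<bar>y\<bar> - \<bar>j\<bar>)\<^sup>+\<close>. This makes the quotient norm a lattice seminorm.\<close>

lemma infdist_ideal_mono:
  fixes y w :: "'a::banach_lattice"
  assumes J: "closed_ideal J" and le: "\<bar>y\<bar> \<le> \<bar>w\<bar>"
  shows "infdist y J \<le> infdist w J"
proof -
  have "infdist y J \<le> dist w j" if j: "j \<in> J" for j
  proof -
    define c where "c = sup (inf y \<bar>j\<bar>) (- \<bar>j\<bar>)"
    have "c \<le> \<bar>j\<bar>"
      using order_trans[of "- \<bar>j\<bar>" 0 "\<bar>j\<bar>"] by (simp add: c_def)
    moreover have "- c \<le> \<bar>j\<bar>"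
      using minus_le_iff[of c "\<bar>j\<bar>"] by (simp add: c_def)
    ultimately have "c \<in> J"
      using closed_idealD(3)[OF J j] by (simp add: abs_leI)
    have 1: "y - c \<le> sup 0 (\<bar>y\<bar> - \<bar>j\<bar>)"
    proof -
      have "y - c \<le> y - inf y \<bar>j\<bar>" by (simp add: c_def)
      also have "\<dots> = sup 0 (y - \<bar>j\<bar>)"
        by (simp add: diff_inf_eq_sup add_sup_distrib_left)
      also have "\<dots> \<le> sup 0 (\<bar>y\<bar> - \<bar>j\<bar>)"
        by (intro sup_mono diff_right_mono abs_ge_self) simp
      finally show ?thesis .
    qed
    have 2: "- (y - c) \<le> sup 0 (\<bar>y\<bar> - \<bar>j\<bar>)"
    proof -
      have "inf y \<bar>j\<bar> \<le> y" by simp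
      also have "y \<le> y + sup 0 (\<bar>y\<bar> - \<bar>j\<bar>)" by simp
      finally have a: "inf y \<bar>j\<bar> \<le> y + sup 0 (\<bar>y\<bar> - \<bar>j\<bar>)" .
      have "- y \<le> \<bar>y\<bar>" by (rule abs_ge_minus_self)
      then have "- \<bar>j\<bar> \<le> y + (\<bar>y\<bar> - \<bar>j\<bar>)"
        by (metis add.commute add_diff_eq diff_conv_add_uminus diff_right_mono neg_le_iff_le
            diff_ge_0_iff_ge diff_minus_eq_add uminus_add_conv_diff diff_add_cancel add_le_cancel_right add_0)
      also have "\<dots> \<le> y + sup 0 (\<bar>y\<bar> - \<bar>j\<bar>)" by simp
      finally have "c \<le> y + sup 0 (\<bar>y\<bar> - \<bar>j\<bar>)"
        using a by (simp add: c_def)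
      then show ?thesis by (simp add: algebra_simps)
    qed
    have "\<bar>w\<bar> \<le> \<bar>w - j\<bar> + \<bar>j\<bar>"
      using abs_triangle_ineq[of "w - j" j] by simp
    then have "\<bar>y\<bar> \<le> \<bar>w - j\<bar> + \<bar>j\<bar>"
      using le by (rule order_trans[rotated])
    then have "sup 0 (\<bar>y\<bar> - \<bar>j\<bar>) \<le> \<bar>w - j\<bar>"
      by (simp add: diff_le_eq)
    then have "\<bar>y - c\<bar> \<le> \<bar>w - j\<bar>"
      by (intro abs_leI order_trans[OF 1] order_trans[OF 2])
    then have "dist y c \<le> dist w j"
      by (simp add: dist_norm norm_mono_abs)
    then show ?thesis
      using \<open>c \<in> J\<close> by (meson infdist_le2)
  qed
  then show ?thesis
    using closed_idealD(7)[OF J] by (auto simp: infdist_notempty[of J w] intro: cINF_greatest)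
qed

context
  fixes J :: "'a::real_normed_vector set"
  assumes J: "subspace J"
begin

lemma infdist_subspace_le_norm: "infdist y J \<le> norm y"
  using infdist_le[of 0 J y] subspace_0[OF J] by simp

lemma infdist_subspace_add_mem:
  assumes "j \<in> J"
  shows "infdist (y + j) J = infdist y J"
proof -
  have le: "infdist (y + j) J \<le> infdist y J" if "j \<in> J" for y j
  proof -
    have "infdist (y + j) J \<le> dist y a" if "a \<in> J" for a
      using infdist_le[of "a + j" J "y + j"] subspace_add[OF J that \<open>j \<in> J\<close>]
      by (simp add: dist_norm)
    then show ?thesis
      using subspace_0[OF J] by (subst (2) infdist_notempty) (auto intro!: cINF_greatest)
  qed
  show ?thesis
    using le[OF assms, of y] le[of "- j" "y + j"] subspace_neg[OF J assms] by simp
qed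

lemma infdist_subspace_approx:
  assumes "0 < e"
  obtains j where "j \<in> J" "norm (y - j) < infdist y J + e"
proof -
  have "\<exists>j\<in>J. dist y j < infdist y J + e"
  proof (rule ccontr)
    assume "\<not> ?thesis"
    then have "infdist y J + e \<le> infdist y J"
      using subspace_0[OF J] by (subst (2) infdist_notempty) (auto intro!: cINF_greatest simp: not_less)
    then show False using assms by simp
  qed
  then show ?thesis
    using that by (auto simp: dist_norm)
qed

lemma infdist_subspace_add: "infdist (x + y) J \<le> infdist x J + infdist y J"
proof (rule field_le_epsilon)
  fix e :: real assume "0 < e"
  then obtain j where j: "j \<in> J" "norm (y - j) < infdist y J + e"
    using infdist_subspace_approx by blast
  have "infdist (x + y) J = infdist (x + y + - j) J"
    using infdist_subspace_add_mem[of "-j"] subspace_neg[OF J j(1)] by simp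
  also have "\<dots> \<le> infdist x J + dist (x + y + - j) x"
    by (rule infdist_triangle)
  also have "\<dots> \<le> infdist x J + infdist y J + e"
    using j(2) by (simp add: dist_norm algebra_simps)
  finally show "infdist (x + y) J \<le> infdist x J + infdist y J + e" .
qed

lemma infdist_subspace_scaleR: "infdist (c *\<^sub>R x) J = \<bar>c\<bar> * infdist x J"
proof (cases "c = 0")
  case True
  then show ?thesis using subspace_0[OF J] by simp
next
  case False
  have le: "infdist (c *\<^sub>R x) J \<le> \<bar>c\<bar> * infdist x J" if "c \<noteq> 0" for c x
  proof -
    have "infdist (c *\<^sub>R x) J / \<bar>c\<bar> \<le> dist x a" if "a \<in> J" for a
      using infdist_le[of "c *\<^sub>R a" J "c *\<^sub>R x"] subspace_scale[OF J that] \<open>c \<noteq> 0\<close>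
      by (simp add: dist_norm divide_le_eq mult.commute flip: scaleR_diff_right)
    then have "infdist (c *\<^sub>R x) J / \<bar>c\<bar> \<le> infdist x J"
      using subspace_0[OF J] by (subst (2) infdist_notempty) (auto intro!: cINF_greatest)
    then show ?thesis using that by (simp add: divide_le_eq mult.commute)
  qed
  have "\<bar>c\<bar> * infdist x J \<le> \<bar>c\<bar> * (\<bar>inverse c\<bar> * infdist (c *\<^sub>R x) J)"
    using le[of "inverse c" "c *\<^sub>R x"] False by (intro mult_left_mono) auto
  then show ?thesis
    using le[OF False, of x] False by (simp add: abs_inverse field_simps)
qed

lemma infdist_subspace_minus: "infdist (- x) J = infdist x J"
  using infdist_subspace_scaleR[of "- 1" x] by simp

lemma infdist_subspace_diff: "infdist (x - y) J \<le> infdist x J + infdist y J"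
  using infdist_subspace_add[of x "- y"] infdist_subspace_minus[of y] by simp

end

section \<open>Operator powers and truncated resolvents\<close>

primrec op_power :: "('a::real_normed_vector \<Rightarrow>\<^sub>L 'a) \<Rightarrow> nat \<Rightarrow> 'a \<Rightarrow>\<^sub>L 'a" where
  "op_power T 0 = id_blinfun"
| "op_power T (Suc n) = T o\<^sub>L op_power T n"

lemma op_power_add_apply:
  "blinfun_apply (op_power T (m + n)) x = blinfun_apply (op_power T m) (blinfun_apply (op_power T n) x)"
  by (induction m) auto

lemma op_power_commute_apply:
  "blinfun_apply (op_power T n) (blinfun_apply T x) = blinfun_apply T (blinfun_apply (op_power T n) x)"
  by (induction n) auto

lemma positive_op_power: "positive_op T \<Longrightarrow> positive_op (op_power T n)"
  by (induction n) (auto intro: positive_op_id positive_op_compose)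

lemma leaves_invariant_op_power: "leaves_invariant T J \<Longrightarrow> leaves_invariant (op_power T n) J"
  by (induction n) (auto intro: leaves_invariant_compose simp: leaves_invariant_def)

lemma norm_op_power_le: "norm (op_power T n) \<le> norm T ^ n"
proof (induction n)
  case 0
  then show ?case by (simp add: norm_blinfun_id_le)
next
  case (Suc n)
  have "norm (op_power T (Suc n)) \<le> norm T * norm (op_power T n)"
    by (simp add: norm_blinfun_compose)
  also have "\<dots> \<le> norm T * norm T ^ n"
    by (intro mult_left_mono Suc.IH) simp
  finally show ?case by simp
qed

text \<open>These partial sums of the Neumann series of \<open>(t - T)\<^sup>-\<^sup>1\<close> replace the resolvent. Being
  polynomials in \<open>T\<close> with nonnegative coefficients, they exist for every \<open>t > 0\<close>, are positive
  with \<open>T\<close>, and act on each quotient on which \<open>T\<close> acts, even where \<open>t - T\<close> is not invertible on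
  the whole space.\<close>

definition neumann_sum :: "('a::real_normed_vector \<Rightarrow>\<^sub>L 'a) \<Rightarrow> real \<Rightarrow> nat \<Rightarrow> 'a \<Rightarrow>\<^sub>L 'a" where
  "neumann_sum T t n = (\<Sum>i<n. (1 / t ^ Suc i) *\<^sub>R op_power T i)"

lemma neumann_sum_apply:
  "blinfun_apply (neumann_sum T t n) x = (\<Sum>i<n. (1 / t ^ Suc i) *\<^sub>R blinfun_apply (op_power T i) x)"
  by (simp add: neumann_sum_def blinfun.sum_left blinfun.scaleR_left)

lemma neumann_sum_resolvent:
  assumes "t \<noteq> 0"
  shows "t *\<^sub>R blinfun_apply (neumann_sum T t n) x - blinfun_apply T (blinfun_apply (neumann_sum T t n) x)
    = x - (1 / t ^ n) *\<^sub>R blinfun_apply (op_power T n) x"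
proof (induction n)
  case 0
  then show ?case by (simp add: neumann_sum_apply)
next
  case (Suc n)
  have "t *\<^sub>R blinfun_apply (neumann_sum T t (Suc n)) x - blinfun_apply T (blinfun_apply (neumann_sum T t (Suc n)) x)
    = (t *\<^sub>R blinfun_apply (neumann_sum T t n) x - blinfun_apply T (blinfun_apply (neumann_sum T t n) x))
      + (t *\<^sub>R ((1 / t ^ Suc n) *\<^sub>R blinfun_apply (op_power T n) x)
        - blinfun_apply T ((1 / t ^ Suc n) *\<^sub>R blinfun_apply (op_power T n) x))"
    by (simp add: neumann_sum_apply blinfun.add_right scaleR_add_right)
  also have "\<dots> = x - (1 / t ^ n) *\<^sub>R blinfun_apply (op_power T n) x
      + (t *\<^sub>R ((1 / t ^ Suc n) *\<^sub>R blinfun_apply (op_power T n) x)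
        - blinfun_apply T ((1 / t ^ Suc n) *\<^sub>R blinfun_apply (op_power T n) x))"
    by (simp only: Suc.IH)
  also have "\<dots> = x - (1 / t ^ Suc n) *\<^sub>R blinfun_apply (op_power T (Suc n)) x"
    using assms by (simp add: blinfun.scaleR_right)
  finally show ?case .
qed

lemma neumann_sum_commute_apply:
  "blinfun_apply (neumann_sum T t n) (blinfun_apply T x) = blinfun_apply T (blinfun_apply (neumann_sum T t n) x)"
  by (simp add: neumann_sum_apply op_power_commute_apply blinfun.sum_right blinfun.scaleR_right)

lemma leaves_invariant_neumann_sum:
  assumes "subspace J" "leaves_invariant T J"
  shows "leaves_invariant (neumann_sum T t n) J"
  using leaves_invariant_op_power[OF assms(2)]
  by (auto simp: leaves_invariant_def neumann_sum_apply intro!: subspace_sum subspace_scale assms(1))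

lemma neumann_sum_mono:
  assumes "positive_op T" "0 < t" "0 \<le> x" "m \<le> n"
  shows "blinfun_apply (neumann_sum T t m) x \<le> blinfun_apply (neumann_sum T t n) x"
  unfolding neumann_sum_apply using assms
  by (intro sum_mono2) (auto intro!: scaleR_nonneg_nonneg positive_opD[OF positive_op_power])

lemma positive_op_neumann_sum: "positive_op T \<Longrightarrow> 0 < t \<Longrightarrow> positive_op (neumann_sum T t n)"
  unfolding positive_op_def[of "neumann_sum T t n"] neumann_sum_apply
  by (auto intro!: sum_nonneg scaleR_nonneg_nonneg positive_opD[OF positive_op_power])

lemma neumann_sum_ge_term:
  assumes "positive_op T" "0 < t" "0 \<le> x" "i < n"
  shows "(1 / t ^ Suc i) *\<^sub>R blinfun_apply (op_power T i) x \<le> blinfun_apply (neumann_sum T t n) x"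
proof -
  have "(\<Sum>j\<in>{i}. (1 / t ^ Suc j) *\<^sub>R blinfun_apply (op_power T j) x)
      \<le> (\<Sum>j<n. (1 / t ^ Suc j) *\<^sub>R blinfun_apply (op_power T j) x)"
    using assms
    by (intro sum_mono2) (auto intro!: scaleR_nonneg_nonneg positive_opD[OF positive_op_power])
  then show ?thesis by (simp add: neumann_sum_apply)
qed

lemma neumann_sum_square:
  assumes T: "positive_op T" and t: "0 < t" and x: "0 \<le> x"
  shows "(real (Suc k) / t ^ (k + 2)) *\<^sub>R blinfun_apply (op_power T k) x
    \<le> blinfun_apply (neumann_sum T t (Suc k)) (blinfun_apply (neumann_sum T t (Suc k)) x)"
proof -
  let ?G = "neumann_sum T t (Suc k)"
  have "(1 / t ^ (k + 2)) *\<^sub>R blinfun_apply (op_power T k) x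
      \<le> (1 / t ^ Suc i) *\<^sub>R blinfun_apply (op_power T i) (blinfun_apply ?G x)" if "i < Suc k" for i
  proof -
    have k: "k = i + (k - i)" "k + 2 = Suc i + Suc (k - i)"
      using that by auto
    have "(1 / t ^ (k + 2)) *\<^sub>R blinfun_apply (op_power T k) x = (1 / t ^ Suc i) *\<^sub>R
        blinfun_apply (op_power T i) ((1 / t ^ Suc (k - i)) *\<^sub>R blinfun_apply (op_power T (k - i)) x)"
      unfolding k(2) power_add using op_power_add_apply[of T i "k - i" x] k(1)
      by (simp add: blinfun.scaleR_right)
    also have "\<dots> \<le> (1 / t ^ Suc i) *\<^sub>R blinfun_apply (op_power T i) (blinfun_apply ?G x)"
      using t x by (intro scaleR_left_mono positive_op_mono[OF positive_op_power[OF T]]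
          neumann_sum_ge_term[OF T]) auto
    finally show ?thesis .
  qed
  then have "(\<Sum>i<Suc k. (1 / t ^ (k + 2)) *\<^sub>R blinfun_apply (op_power T k) x)
      \<le> (\<Sum>i<Suc k. (1 / t ^ Suc i) *\<^sub>R blinfun_apply (op_power T i) (blinfun_apply ?G x))"
    by (intro sum_mono) auto
  then show ?thesis
    by (subst neumann_sum_apply) (simp only: sum_constant_scaleR scaleR_scaleR card_lessThan, simp)
qed

lemma neumann_sum_split:
  "blinfun_apply (neumann_sum T t (m + n)) x = blinfun_apply (neumann_sum T t m) x
    + (1 / t ^ m) *\<^sub>R blinfun_apply (op_power T m) (blinfun_apply (neumann_sum T t n) x)"
proof (induction n)
  case (Suc n)
  have "(1 / t ^ Suc (m + n)) *\<^sub>R blinfun_apply (op_power T (m + n)) x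
      = (1 / t ^ m) *\<^sub>R blinfun_apply (op_power T m) ((1 / t ^ Suc n) *\<^sub>R blinfun_apply (op_power T n) x)"
    by (simp add: op_power_add_apply blinfun.scaleR_right power_add)
  then show ?case
    using Suc.IH by (simp add: neumann_sum_apply blinfun.add_right scaleR_add_right add.assoc)
qed (simp add: neumann_sum_apply blinfun.zero_right)

section \<open>Operator norms on a quotient of closed ideals\<close>

text \<open>No quotient space is formed: elements of \<open>J / J0\<close> are represented in \<open>J\<close>, and the quotient
  norm is the distance to \<open>J0\<close>.\<close>

definition quot_norm :: "'a::banach_lattice set \<Rightarrow> 'a set \<Rightarrow> ('a \<Rightarrow>\<^sub>L 'a) \<Rightarrow> real" where
  "quot_norm J J0 T = (SUP y\<in>{y \<in> J. norm y \<le> 1}. infdist (blinfun_apply T y) J0)"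

text \<open>By submultiplicativity this is \<open>lim (quot_norm J J0 (T\<^sup>n))\<^sup>1\<^sup>/\<^sup>n\<close>, the spectral radius of \<open>T\<close>
  on \<open>J / J0\<close>. The supremum gives at once the two properties that matter: the powers
  of \<open>spec_rad\<close> are lower bounds for all the norms, and for \<open>t > spec_rad\<close> some \<open>T\<^sup>n\<close> has norm
  less than \<open>t\<^sup>n\<close>. Excluding \<open>n = 0\<close> makes it \<open>0\<close> when \<open>J = J0\<close>.\<close>

definition spec_rad :: "'a::banach_lattice set \<Rightarrow> 'a set \<Rightarrow> ('a \<Rightarrow>\<^sub>L 'a) \<Rightarrow> real" where
  "spec_rad J J0 T = Sup {s. 0 \<le> s \<and> (\<forall>n>0. s ^ n \<le> quot_norm J J0 (op_power T n))}"

locale quotient =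
  fixes J J0 :: "'a::banach_lattice set"
  assumes ideal: "closed_ideal J" and ideal0: "closed_ideal J0" and sub: "J0 \<subseteq> J"
begin

abbreviation qnorm :: "('a \<Rightarrow>\<^sub>L 'a) \<Rightarrow> real" where
  "qnorm \<equiv> quot_norm J J0"

lemmas sub0 = closed_idealD(2)[OF ideal0]

lemma infdist_le_qnorm:
  assumes "y \<in> J" "norm y \<le> 1"
  shows "infdist (blinfun_apply T y) J0 \<le> qnorm T"
  unfolding quot_norm_def
proof (rule cSUP_upper)
  have "infdist (blinfun_apply T y) J0 \<le> norm T" if "norm y \<le> 1" for y
    using infdist_subspace_le_norm[OF sub0, of "blinfun_apply T y"] norm_blinfun[of T y]
      mult_left_mono[OF that norm_ge_zero[of T]] by simp
  then show "bdd_above ((\<lambda>y. infdist (blinfun_apply T y) J0) ` {y \<in> J. norm y \<le> 1})"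
    by (auto intro!: bdd_aboveI[of _ "norm T"])
qed (use assms in auto)

lemma qnorm_leI:
  assumes "\<And>y. y \<in> J \<Longrightarrow> norm y \<le> 1 \<Longrightarrow> infdist (blinfun_apply T y) J0 \<le> c"
  shows "qnorm T \<le> c"
  unfolding quot_norm_def
  using assms closed_idealD(6)[OF ideal] by (intro cSUP_least) (auto intro: exI[of _ 0])

lemma qnorm_nonneg: "0 \<le> qnorm T"
proof -
  have "0 \<le> infdist (blinfun_apply T 0) J0"
    by (rule infdist_nonneg)
  also have "\<dots> \<le> qnorm T"
    using closed_idealD(6)[OF ideal] by (intro infdist_le_qnorm) auto
  finally show ?thesis .
qed

lemma qnorm_le_norm: "qnorm T \<le> norm T"
proof (rule qnorm_leI)
  fix y :: 'a assume "norm y \<le> 1"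
  then show "infdist (blinfun_apply T y) J0 \<le> norm T"
    using infdist_subspace_le_norm[OF sub0, of "blinfun_apply T y"] norm_blinfun[of T y]
      mult_left_mono[of "norm y" 1 "norm T"] by simp
qed

lemma infdist_le_qnorm_mult_norm:
  assumes "y \<in> J"
  shows "infdist (blinfun_apply T y) J0 \<le> qnorm T * norm y"
proof (cases "y = 0")
  case True
  then show ?thesis using closed_idealD(6)[OF ideal0] by simp
next
  case False
  have "infdist (blinfun_apply T ((1 / norm y) *\<^sub>R y)) J0 \<le> qnorm T"
    using False assms closed_idealD(2)[OF ideal]
    by (intro infdist_le_qnorm) (auto intro: subspace_scale)
  then show ?thesis
    using False by (simp add: blinfun.scaleR_right infdist_subspace_scaleR[OF sub0] divide_le_eq)
qed

lemma infdist_le_qnorm_mult: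
  assumes y: "y \<in> J" and T: "leaves_invariant T J0"
  shows "infdist (blinfun_apply T y) J0 \<le> qnorm T * infdist y J0"
proof (rule field_le_epsilon)
  fix e :: real assume e: "0 < e"
  define d where "d = e / (qnorm T + 1)"
  have d: "0 < d" "qnorm T * d \<le> e"
  proof -
    have "qnorm T * d \<le> (qnorm T + 1) * d"
      using e qnorm_nonneg[of T] by (intro mult_right_mono) (auto simp: d_def)
    then show "qnorm T * d \<le> e" "0 < d"
      using e qnorm_nonneg[of T] by (auto simp: d_def)
  qed
  obtain j where j: "j \<in> J0" "norm (y - j) < infdist y J0 + d"
    using infdist_subspace_approx[OF sub0 d(1)] by blast
  have "blinfun_apply T (- j) \<in> J0"
    using j(1) T subspace_neg[OF sub0] by (auto simp: leaves_invariant_def)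
  then have "infdist (blinfun_apply T y) J0 = infdist (blinfun_apply T y + blinfun_apply T (- j)) J0"
    by (simp add: infdist_subspace_add_mem[OF sub0])
  also have "\<dots> = infdist (blinfun_apply T (y - j)) J0"
    by (simp add: blinfun.diff_right blinfun.minus_right)
  also have "\<dots> \<le> qnorm T * norm (y - j)"
    using y j(1) sub closed_idealD(2)[OF ideal] by (intro infdist_le_qnorm_mult_norm subspace_diff) auto
  also have "\<dots> \<le> qnorm T * (infdist y J0 + d)"
    using j(2) qnorm_nonneg by (intro mult_left_mono) auto
  also have "\<dots> \<le> qnorm T * infdist y J0 + e"
    using d(2) by (simp add: algebra_simps)
  finally show "infdist (blinfun_apply T y) J0 \<le> qnorm T * infdist y J0 + e" .
qed

lemma qnorm_compose:
  assumes "leaves_invariant S J0" "leaves_invariant T J"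
  shows "qnorm (S o\<^sub>L T) \<le> qnorm S * qnorm T"
proof (rule qnorm_leI)
  fix y assume y: "y \<in> J" "norm y \<le> 1"
  have "infdist (blinfun_apply (S o\<^sub>L T) y) J0 \<le> qnorm S * infdist (blinfun_apply T y) J0"
    using assms y infdist_le_qnorm_mult[of "blinfun_apply T y" S] by (simp add: leaves_invariant_def)
  also have "\<dots> \<le> qnorm S * qnorm T"
    using y by (intro mult_left_mono infdist_le_qnorm qnorm_nonneg)
  finally show "infdist (blinfun_apply (S o\<^sub>L T) y) J0 \<le> qnorm S * qnorm T" .
qed

lemma qnorm_mono:
  assumes "positive_op S" "\<And>y. 0 \<le> y \<Longrightarrow> blinfun_apply S y \<le> blinfun_apply T y"
  shows "qnorm S \<le> qnorm T"
proof (rule qnorm_leI)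
  fix y assume y: "y \<in> J" "norm y \<le> 1"
  have "\<bar>blinfun_apply S y\<bar> \<le> blinfun_apply S \<bar>y\<bar>"
    by (rule positive_op_abs[OF assms(1)])
  also have "\<dots> \<le> blinfun_apply T \<bar>y\<bar>"
    by (rule assms(2)) simp
  also have "\<dots> \<le> \<bar>blinfun_apply T \<bar>y\<bar>\<bar>"
    by (rule abs_ge_self)
  finally have "infdist (blinfun_apply S y) J0 \<le> infdist (blinfun_apply T \<bar>y\<bar>) J0"
    by (rule infdist_ideal_mono[OF ideal0])
  also have "\<dots> \<le> qnorm T"
    using y closed_idealD(4)[OF ideal] by (intro infdist_le_qnorm) auto
  finally show "infdist (blinfun_apply S y) J0 \<le> qnorm T" .
qed

lemma qnorm_scaleR: "qnorm (c *\<^sub>R T) \<le> \<bar>c\<bar> * qnorm T"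
proof (rule qnorm_leI)
  fix y assume y: "y \<in> J" "norm y \<le> 1"
  show "infdist (blinfun_apply (c *\<^sub>R T) y) J0 \<le> \<bar>c\<bar> * qnorm T"
    using infdist_le_qnorm[OF y] by (simp add: blinfun.scaleR_left infdist_subspace_scaleR[OF sub0] mult_left_mono)
qed

lemma qnorm_add: "qnorm (S + T) \<le> qnorm S + qnorm T"
proof (rule qnorm_leI)
  fix y assume y: "y \<in> J" "norm y \<le> 1"
  show "infdist (blinfun_apply (S + T) y) J0 \<le> qnorm S + qnorm T"
    using infdist_le_qnorm[OF y, of S] infdist_le_qnorm[OF y, of T]
      infdist_subspace_add[OF sub0, of "blinfun_apply S y" "blinfun_apply T y"]
    by (simp add: blinfun.add_left)
qed

lemma spec_rad_bdd: "bdd_above {s. 0 \<le> s \<and> (\<forall>n>0. s ^ n \<le> qnorm (op_power T n))}"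
proof (rule bdd_aboveI[of _ "qnorm (op_power T 1)"])
  fix s assume "s \<in> {s. 0 \<le> s \<and> (\<forall>n>0. s ^ n \<le> qnorm (op_power T n))}"
  then have all: "\<forall>n>0. s ^ n \<le> qnorm (op_power T n)"
    by simp
  show "s \<le> qnorm (op_power T 1)"
    using all[rule_format, of 1, OF zero_less_one] by (simp only: power_one_right)
qed

lemma le_spec_radI: "0 \<le> s \<Longrightarrow> (\<And>n. 0 < n \<Longrightarrow> s ^ n \<le> qnorm (op_power T n)) \<Longrightarrow> s \<le> spec_rad J J0 T"
  unfolding spec_rad_def by (rule cSup_upper[OF _ spec_rad_bdd]) simp

lemma spec_rad_nonneg: "0 \<le> spec_rad J J0 T"
proof (rule le_spec_radI)
  show "0 ^ n \<le> qnorm (op_power T n)" if "0 < n" for n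
    using that qnorm_nonneg[of "op_power T n"] by (simp only: power_0_left) simp
qed simp

lemma spec_rad_power_le:
  assumes "0 < n"
  shows "spec_rad J J0 T ^ n \<le> qnorm (op_power T n)"
proof -
  have "spec_rad J J0 T \<le> root n (qnorm (op_power T n))"
    unfolding spec_rad_def
  proof (rule cSup_least)
    show "{s. 0 \<le> s \<and> (\<forall>n>0. s ^ n \<le> qnorm (op_power T n))} \<noteq> {}"
    proof -
      have "0 \<in> {s. 0 \<le> s \<and> (\<forall>n>0. s ^ n \<le> qnorm (op_power T n))}"
        by (simp add: power_0_left qnorm_nonneg)
      then show ?thesis by blast
    qed
    show "s \<le> root n (qnorm (op_power T n))"
      if "s \<in> {s. 0 \<le> s \<and> (\<forall>n>0. s ^ n \<le> qnorm (op_power T n))}" for s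
    proof -
      have s: "0 \<le> s" "s ^ n \<le> qnorm (op_power T n)"
        using that assms by auto
      have "root n (s ^ n) \<le> root n (qnorm (op_power T n))"
        using assms s(2) by (rule real_root_le_mono)
      then show ?thesis using real_root_power_cancel[OF assms s(1)] by simp
    qed
  qed
  then have "spec_rad J J0 T ^ n \<le> root n (qnorm (op_power T n)) ^ n"
    using spec_rad_nonneg by (rule power_mono)
  then show ?thesis using assms qnorm_nonneg by simp
qed

lemma spec_rad_lessD:
  assumes "spec_rad J J0 T < t"
  obtains n where "0 < n" "qnorm (op_power T n) < t ^ n"
proof -
  have "\<not> (\<forall>n>0. t ^ n \<le> qnorm (op_power T n))"
    using le_spec_radI[of t T] assms spec_rad_nonneg[of T] by auto
  then show ?thesis
    using that by (auto simp: not_le)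
qed

lemma qnorm_op_power_mult:
  assumes "leaves_invariant T J" "leaves_invariant T J0" "0 < m"
  shows "qnorm (op_power T (n * m)) \<le> qnorm (op_power T n) ^ m"
  using assms(3)
proof (induction m rule: nat_induct_non_zero)
  case (Suc m)
  have "op_power T (n * Suc m) = op_power T n o\<^sub>L op_power T (n * m)"
    by (rule blinfun_eqI) (simp add: op_power_add_apply)
  then have "qnorm (op_power T (n * Suc m)) \<le> qnorm (op_power T n) * qnorm (op_power T (n * m))"
    using assms by (simp add: qnorm_compose leaves_invariant_op_power)
  also have "\<dots> \<le> qnorm (op_power T n) * qnorm (op_power T n) ^ m"
    using Suc.IH by (intro mult_left_mono qnorm_nonneg)
  finally show ?case by simp
qed simp

end

lemma spec_rad_mono:
  assumes J: "closed_ideal J" and J': "closed_ideal J'" "J' \<subseteq> J" and J0: "closed_ideal J0" "J0 \<subseteq> J'"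
  shows "spec_rad J' J0 T \<le> spec_rad J J0 T"
proof -
  interpret a: quotient J' J0 using assms by unfold_locales
  interpret b: quotient J J0 using assms by unfold_locales auto
  show ?thesis
  proof (rule b.le_spec_radI)
    fix n :: nat assume "0 < n"
    then have "spec_rad J' J0 T ^ n \<le> quot_norm J' J0 (op_power T n)"
      by (rule a.spec_rad_power_le)
    also have "\<dots> \<le> quot_norm J J0 (op_power T n)"
      using J'(2) by (intro a.qnorm_leI b.infdist_le_qnorm) auto
    finally show "spec_rad J' J0 T ^ n \<le> quot_norm J J0 (op_power T n)" .
  qed (rule a.spec_rad_nonneg)
qed

section \<open>Compact operators\<close>

lemma compact_opI:
  fixes T :: "'a::real_normed_vector \<Rightarrow>\<^sub>L 'b::real_normed_vector"
  assumes "\<And>S. bounded S \<Longrightarrow> \<exists>C. compact C \<and> blinfun_apply T ` S \<subseteq> C"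
  shows "compact_op T"
  unfolding compact_op_def
proof (intro allI impI)
  fix S :: "'a set" assume "bounded S"
  then obtain C where C: "compact C" "blinfun_apply T ` S \<subseteq> C" using assms by blast
  then have "closure (blinfun_apply T ` S) \<subseteq> C"
    by (intro closure_minimal compact_imp_closed)
  then show "compact (closure (blinfun_apply T ` S))"
    using compact_Int_closed[OF C(1) closed_closure[of "blinfun_apply T ` S"]] by (simp add: inf.absorb2)
qed

lemma compact_op_compose_left:
  fixes T :: "'a::real_normed_vector \<Rightarrow>\<^sub>L 'b::real_normed_vector" and B :: "'b \<Rightarrow>\<^sub>L 'c::real_normed_vector"
  assumes "compact_op T" shows "compact_op (B o\<^sub>L T)"
proof (rule compact_opI)
  fix S :: "'a set" assume "bounded S"
  then have "compact (closure (blinfun_apply T ` S))" using assms by (simp add: compact_op_def)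
  then have "compact (blinfun_apply B ` closure (blinfun_apply T ` S))"
    by (rule compact_continuous_image[OF linear_continuous_on[OF blinfun.bounded_linear_right]])
  moreover have "blinfun_apply (B o\<^sub>L T) ` S \<subseteq> blinfun_apply B ` closure (blinfun_apply T ` S)"
    using image_mono[OF closure_subset[of "blinfun_apply T ` S"], of "blinfun_apply B"] by (simp add: image_image)
  ultimately show "\<exists>C. compact C \<and> blinfun_apply (B o\<^sub>L T) ` S \<subseteq> C" by blast
qed

lemma compact_op_compose_right:
  fixes T :: "'b::real_normed_vector \<Rightarrow>\<^sub>L 'c::real_normed_vector" and B :: "'a::real_normed_vector \<Rightarrow>\<^sub>L 'b"
  assumes "compact_op T" shows "compact_op (T o\<^sub>L B)"
proof (rule compact_opI)
  fix S :: "'a set" assume "bounded S"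
  then have "bounded (blinfun_apply B ` S)"
    by (rule bounded_linear_image[OF _ blinfun.bounded_linear_right])
  then have "compact (closure (blinfun_apply T ` blinfun_apply B ` S))" using assms by (simp add: compact_op_def)
  moreover have "blinfun_apply (T o\<^sub>L B) ` S \<subseteq> closure (blinfun_apply T ` blinfun_apply B ` S)"
    using closure_subset[of "blinfun_apply T ` blinfun_apply B ` S"] by (simp add: image_image)
  ultimately show "\<exists>C. compact C \<and> blinfun_apply (T o\<^sub>L B) ` S \<subseteq> C" by blast
qed

lemma compact_op_diff:
  fixes T1 T2 :: "'a::real_normed_vector \<Rightarrow>\<^sub>L 'b::real_normed_vector"
  assumes "compact_op T1" "compact_op T2" shows "compact_op (T1 - T2)"
proof (rule compact_opI)
  fix S :: "'a set" assume "bounded S"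
  then have "compact (closure (blinfun_apply T1 ` S))" "compact (closure (blinfun_apply T2 ` S))"
    using assms by (auto simp: compact_op_def)
  then have "compact {x - y | x y. x \<in> closure (blinfun_apply T1 ` S) \<and> y \<in> closure (blinfun_apply T2 ` S)}"
    by (rule compact_differences)
  moreover have "blinfun_apply (T1 - T2) ` S \<subseteq> {x - y | x y. x \<in> closure (blinfun_apply T1 ` S) \<and> y \<in> closure (blinfun_apply T2 ` S)}"
  proof
    fix z assume "z \<in> blinfun_apply (T1 - T2) ` S"
    then obtain x where "x \<in> S" "z = blinfun_apply T1 x - blinfun_apply T2 x"
      by (auto simp: blinfun.diff_left)
    then show "z \<in> {x - y | x y. x \<in> closure (blinfun_apply T1 ` S) \<and> y \<in> closure (blinfun_apply T2 ` S)}"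
      using closure_subset[of "blinfun_apply T1 ` S"] closure_subset[of "blinfun_apply T2 ` S"] by blast
  qed
  ultimately show "\<exists>C. compact C \<and> blinfun_apply (T1 - T2) ` S \<subseteq> C" by blast
qed

lemma compact_op_subseq:
  assumes T: "compact_op T" and v: "\<And>k. norm (v k) \<le> c"
  obtains l r where "strict_mono (r :: nat \<Rightarrow> nat)" "(\<lambda>k. blinfun_apply T (v (r k))) \<longlonglongrightarrow> l"
proof -
  have "compact (closure (blinfun_apply T ` cball 0 c))"
    using T by (simp add: compact_op_def)
  moreover have "\<forall>k. blinfun_apply T (v k) \<in> closure (blinfun_apply T ` cball 0 c)"
    using v by (auto intro!: closure_subset[THEN subsetD])
  ultimately obtain l r where "strict_mono (r :: nat \<Rightarrow> nat)" "((\<lambda>k. blinfun_apply T (v k)) \<circ> r) \<longlonglongrightarrow> l"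
    using compact_def by (metis (no_types, lifting))
  then show ?thesis using that by (simp add: o_def)
qed

section \<open>Peripheral vectors of a compact positive operator\<close>

context quotient
begin

text \<open>If the norms of the truncated resolvents with bounded remainder stayed below \<open>g\<close> as \<open>t\<close>
  decreases to \<open>\<rho> = spec_rad J J0 T\<close>, then their squares would be bounded too. Since such a
  square dominates \<open>(k + 1) T\<^sup>k / t\<^sup>k\<^sup>+\<^sup>2\<close> and \<open>T\<^sup>k\<close> has norm at least \<open>\<rho>\<^sup>k\<close>, this would bound
  \<open>k + 1\<close>.\<close>

lemma neumann_sum_blowup:
  assumes T: "positive_op T" and inv: "leaves_invariant T J" "leaves_invariant T J0"
    and pos: "0 < spec_rad J J0 T" and e: "0 < e"
  obtains t n where "spec_rad J J0 T < t" "t < spec_rad J J0 T + e" "0 < n"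
    "qnorm (op_power T n) \<le> t ^ n" "g \<le> qnorm (neumann_sum T t n)"
proof (rule ccontr)
  assume no: "\<not> thesis"
  note conclude = that
  have small: "qnorm (neumann_sum T t n) < g"
    if "spec_rad J J0 T < t" "t < spec_rad J J0 T + e" "0 < n" "qnorm (op_power T n) \<le> t ^ n" for t n
    using conclude[OF that] no by (meson not_le)
  define \<rho> where "\<rho> = spec_rad J J0 T"
  have bound: "real (Suc k) \<le> \<rho>\<^sup>2 * g\<^sup>2" if k: "0 < k" for k
  proof -
    have le: "real (Suc k) * \<rho> ^ k \<le> t ^ (k + 2) * g\<^sup>2" if t: "\<rho> < t" "t < \<rho> + e" for t
    proof -
      have t0: "0 < t" using pos t by (simp add: \<rho>_def)
      obtain n0 where n0: "0 < n0" "qnorm (op_power T n0) < t ^ n0"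
        using spec_rad_lessD t(1) unfolding \<rho>_def by blast
      \<comment> \<open>A multiple of \<open>n0\<close> keeps the remainder bounded; this one makes the sum long enough to contain its
        first \<open>k + 1\<close> terms.\<close>
      define n where "n = n0 * Suc k"
      have n: "0 < n" "Suc k \<le> n" using n0 mult_le_mono1[of 1 n0 "Suc k"] by (auto simp: n_def simp del: mult_Suc_right)
      have "qnorm (op_power T n) \<le> qnorm (op_power T n0) ^ Suc k"
        unfolding n_def by (rule qnorm_op_power_mult[OF inv]) simp
      also have "\<dots> \<le> (t ^ n0) ^ Suc k"
        using n0 qnorm_nonneg by (intro power_mono) auto
      finally have "qnorm (op_power T n) \<le> t ^ n"
        by (simp only: n_def power_mult)
      then have "qnorm (neumann_sum T t n) < g"
        using small t n unfolding \<rho>_def by blast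
      moreover have "qnorm (neumann_sum T t (Suc k)) \<le> qnorm (neumann_sum T t n)"
        by (intro qnorm_mono positive_op_neumann_sum neumann_sum_mono T t0 n)
      ultimately have G: "qnorm (neumann_sum T t (Suc k)) \<le> g" by simp
      let ?G = "neumann_sum T t (Suc k)"
      have "qnorm ((real (Suc k) / t ^ (k + 2)) *\<^sub>R op_power T k) \<le> qnorm (?G o\<^sub>L ?G)"
        using t0 neumann_sum_square[OF T t0, of _ k]
        by (intro qnorm_mono positive_op_scaleR positive_op_power T)
          (auto simp only: blinfun.scaleR_left blinfun_apply_blinfun_compose zero_le_divide_iff of_nat_0_le_iff zero_le_power less_imp_le)
      also have "\<dots> \<le> qnorm ?G * qnorm ?G"
        using inv by (intro qnorm_compose leaves_invariant_neumann_sum closed_idealD[OF ideal] sub0)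
      also have "\<dots> \<le> g\<^sup>2"
        unfolding power2_eq_square using G qnorm_nonneg by (intro mult_mono) (auto intro: order_trans)
      finally have 1: "qnorm ((real (Suc k) / t ^ (k + 2)) *\<^sub>R op_power T k) \<le> g\<^sup>2" .
      have "qnorm (op_power T k) \<le> (t ^ (k + 2) / real (Suc k)) * qnorm ((real (Suc k) / t ^ (k + 2)) *\<^sub>R op_power T k)"
        using qnorm_scaleR[of "t ^ (k + 2) / real (Suc k)" "(real (Suc k) / t ^ (k + 2)) *\<^sub>R op_power T k"] t0
        by (simp add: field_simps del: of_nat_Suc power_Suc)
      also have "\<dots> \<le> (t ^ (k + 2) / real (Suc k)) * g\<^sup>2"
        using 1 t0 by (intro mult_left_mono) auto
      finally have "\<rho> ^ k \<le> (t ^ (k + 2) / real (Suc k)) * g\<^sup>2"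
        using spec_rad_power_le[OF k, of T] by (simp add: \<rho>_def)
      then show ?thesis
        by (simp add: field_simps del: of_nat_Suc power_Suc)
    qed
    have "real (Suc k) * \<rho> ^ k \<le> \<rho> ^ (k + 2) * g\<^sup>2"
    proof (rule tendsto_lowerbound)
      show "((\<lambda>t. t ^ (k + 2) * g\<^sup>2) \<longlongrightarrow> \<rho> ^ (k + 2) * g\<^sup>2) (at_right \<rho>)"
        by (intro tendsto_intros)
      show "\<forall>\<^sub>F t in at_right \<rho>. real (Suc k) * \<rho> ^ k \<le> t ^ (k + 2) * g\<^sup>2"
        using le e by (auto simp: eventually_at_right_field intro!: exI[of _ "\<rho> + e"])
    qed simp
    then have "\<rho> ^ k * real (Suc k) \<le> \<rho> ^ k * (\<rho>\<^sup>2 * g\<^sup>2)"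
      by (simp add: power_add power2_eq_square mult.commute mult.assoc mult.left_commute del: of_nat_Suc)
    then show ?thesis
      using pos by (simp add: \<rho>_def del: of_nat_Suc)
  qed
  obtain k :: nat where "\<rho>\<^sup>2 * g\<^sup>2 < real k"
    using reals_Archimedean2 by blast
  then show False
    using bound[of "Suc k"] by simp
qed

end

text \<open>The operators \<open>R\<^sub>k = neumann_sum T (t k) (n k)\<close> play the role of resolvents on \<open>J / J0\<close> at
  points decreasing to the spectral radius: \<open>(t\<^sub>k - T) R\<^sub>k\<close> differs from \<open>1\<close> by an operator of
  norm at most \<open>1\<close>, while the norm of \<open>R\<^sub>k\<close> tends to infinity. The vectors \<open>y k\<close> of the unit
  ball attain this norm up to the factor \<open>2\<close>, and the normalized images \<open>R\<^sub>k (y k)\<close> converge to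
  \<open>z\<close>, which makes \<open>z\<close> an eigenvector modulo \<open>J0\<close>. The limit \<open>w\<close> of \<open>T (y k)\<close> witnesses that
  \<open>R\<^sub>k / qnorm R\<^sub>k\<close> does not converge strongly to \<open>0\<close>.\<close>

locale peripheral_sequence = quotient J J0
  for J J0 :: "'a::banach_lattice set" +
  fixes T :: "'a \<Rightarrow>\<^sub>L 'a" and t :: "nat \<Rightarrow> real" and n :: "nat \<Rightarrow> nat" and y :: "nat \<Rightarrow> 'a" and w z :: 'a
  assumes T_pos: "positive_op T"
    and T_inv: "leaves_invariant T J" "leaves_invariant T J0"
    and spec_rad_pos: "0 < spec_rad J J0 T"
    and t_gt: "\<And>k. spec_rad J J0 T < t k" and t_lim: "t \<longlonglongrightarrow> spec_rad J J0 T"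
    and remainder: "\<And>k. qnorm (op_power T (n k)) \<le> t k ^ n k"
    and norm_lim: "filterlim (\<lambda>k. qnorm (neumann_sum T (t k) (n k))) at_top sequentially"
    and norm_ge_1: "\<And>k. 1 \<le> qnorm (neumann_sum T (t k) (n k))"
    and y_mem: "\<And>k. y k \<in> J" and y_nonneg: "\<And>k. 0 \<le> y k" and y_norm: "\<And>k. norm (y k) \<le> 1"
    and y_attains: "\<And>k. qnorm (neumann_sum T (t k) (n k))
      \<le> 2 * infdist (blinfun_apply (neumann_sum T (t k) (n k)) (y k)) J0"
    and w_lim: "(\<lambda>k. blinfun_apply T (y k)) \<longlonglongrightarrow> w"
    and z_mem: "z \<in> J" and z_nonneg: "0 \<le> z" and z_infdist: "infdist z J0 = 1"
    and z_lim: "(\<lambda>k. infdist (z - (1 / infdist (blinfun_apply (neumann_sum T (t k) (n k)) (y k)) J0)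
      *\<^sub>R blinfun_apply (neumann_sum T (t k) (n k)) (y k)) J0) \<longlonglongrightarrow> 0"
begin

abbreviation R :: "nat \<Rightarrow> 'a \<Rightarrow>\<^sub>L 'a" where
  "R k \<equiv> neumann_sum T (t k) (n k)"

lemma t_pos: "0 < t k"
  using spec_rad_pos t_gt[of k] by simp

lemma R_pos: "positive_op (R k)"
  by (rule positive_op_neumann_sum[OF T_pos t_pos])

lemma R_inv: "leaves_invariant (R k) J" "leaves_invariant (R k) J0"
  using T_inv by (intro leaves_invariant_neumann_sum closed_idealD(2) ideal ideal0; simp)+

lemma w_mem: "w \<in> J"
  using y_mem T_inv(1)
  by (intro closed_sequentially[OF closed_idealD(1)[OF ideal] _ w_lim]) (auto simp: leaves_invariant_def)

lemma qnorm_power_term: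
  "qnorm ((1 / t k ^ n k) *\<^sub>R op_power T (n k)) \<le> 1"
proof -
  have "qnorm ((1 / t k ^ n k) *\<^sub>R op_power T (n k)) \<le> (1 / t k ^ n k) * qnorm (op_power T (n k))"
    using qnorm_scaleR[of "1 / t k ^ n k" "op_power T (n k)"] t_pos[of k] by (simp add: abs_of_pos)
  also have "\<dots> \<le> 1"
    using remainder[of k] t_pos[of k] by (simp add: field_simps)
  finally show ?thesis .
qed

text \<open>The set of all vectors on which \<open>R k\<close> is of smaller order than its norm is not all of \<open>J\<close>:
  otherwise it would contain \<open>w\<close>, and \<open>T R\<^sub>k (y k)\<close>, which is \<open>t\<^sub>k R\<^sub>k (y k)\<close> up to a
  bounded error, would be of smaller order than \<open>qnorm R\<^sub>k\<close>.\<close>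

lemma w_not_small: "\<not> (\<lambda>k. infdist (blinfun_apply (R k) w) J0 / qnorm (R k)) \<longlonglongrightarrow> 0"
proof
  assume lim: "(\<lambda>k. infdist (blinfun_apply (R k) w) J0 / qnorm (R k)) \<longlonglongrightarrow> 0"
  have inv_lim: "(\<lambda>k. 1 / qnorm (R k)) \<longlonglongrightarrow> 0"
    using tendsto_inverse_0_at_top[OF norm_lim] by (simp add: inverse_eq_divide)
  have "t k / 2 \<le> infdist (blinfun_apply (R k) w) J0 / qnorm (R k)
      + norm (blinfun_apply T (y k) - w) + 2 * (1 / qnorm (R k))" for k
  proof -
    let ?g = "qnorm (R k)"
    have g: "1 \<le> ?g" by (rule norm_ge_1)
    have *: "t k *\<^sub>R blinfun_apply (R k) (y k) = blinfun_apply (R k) (blinfun_apply T (y k))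
        + (y k - blinfun_apply ((1 / t k ^ n k) *\<^sub>R op_power T (n k)) (y k))"
      using neumann_sum_resolvent[of "t k" T "n k" "y k"] t_pos[of k]
      by (simp add: neumann_sum_commute_apply blinfun.scaleR_left algebra_simps)
    have "t k * infdist (blinfun_apply (R k) (y k)) J0 = infdist (t k *\<^sub>R blinfun_apply (R k) (y k)) J0"
      using t_pos[of k] by (simp add: infdist_subspace_scaleR[OF sub0])
    also have "\<dots> \<le> infdist (blinfun_apply (R k) (blinfun_apply T (y k))) J0
        + infdist (y k - blinfun_apply ((1 / t k ^ n k) *\<^sub>R op_power T (n k)) (y k)) J0"
      unfolding * by (rule infdist_subspace_add[OF sub0])
    also have "infdist (y k - blinfun_apply ((1 / t k ^ n k) *\<^sub>R op_power T (n k)) (y k)) J0 \<le> 1 + 1"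
      using infdist_subspace_diff[OF sub0, of "y k" "blinfun_apply ((1 / t k ^ n k) *\<^sub>R op_power T (n k)) (y k)"]
        infdist_subspace_le_norm[OF sub0, of "y k"] y_norm[of k]
        infdist_le_qnorm[OF y_mem y_norm, of "(1 / t k ^ n k) *\<^sub>R op_power T (n k)" k] qnorm_power_term[of k]
      by linarith
    also have "infdist (blinfun_apply (R k) (blinfun_apply T (y k))) J0
        = infdist (blinfun_apply (R k) w + blinfun_apply (R k) (blinfun_apply T (y k) - w)) J0"
      by (simp add: blinfun.diff_right)
    also have "\<dots> \<le> infdist (blinfun_apply (R k) w) J0 + infdist (blinfun_apply (R k) (blinfun_apply T (y k) - w)) J0"
      by (rule infdist_subspace_add[OF sub0])
    also have "infdist (blinfun_apply (R k) (blinfun_apply T (y k) - w)) J0 \<le> ?g * norm (blinfun_apply T (y k) - w)"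
      using y_mem w_mem T_inv(1) closed_idealD(2)[OF ideal]
      by (intro infdist_le_qnorm_mult_norm subspace_diff) (auto simp: leaves_invariant_def)
    finally have 1: "t k * infdist (blinfun_apply (R k) (y k)) J0
        \<le> infdist (blinfun_apply (R k) w) J0 + ?g * norm (blinfun_apply T (y k) - w) + 2" by simp
    have "t k * (?g / 2) \<le> t k * infdist (blinfun_apply (R k) (y k)) J0"
      using y_attains[of k] t_pos[of k] by (intro mult_left_mono) auto
    then have "t k * ?g / 2 \<le> infdist (blinfun_apply (R k) w) J0 + ?g * norm (blinfun_apply T (y k) - w) + 2"
      using 1 by simp
    then have "(t k * ?g / 2) / ?g \<le> (infdist (blinfun_apply (R k) w) J0 + ?g * norm (blinfun_apply T (y k) - w) + 2) / ?g"
      using g by (intro divide_right_mono) auto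
    then show ?thesis
      using g by (simp add: add_divide_distrib)
  qed
  moreover have "(\<lambda>k. infdist (blinfun_apply (R k) w) J0 / qnorm (R k)
      + norm (blinfun_apply T (y k) - w) + 2 * (1 / qnorm (R k))) \<longlonglongrightarrow> 0 + 0 + 2 * 0"
    by (intro tendsto_intros lim inv_lim tendsto_norm_zero LIM_zero w_lim)
  moreover have "(\<lambda>k. t k / 2) \<longlonglongrightarrow> spec_rad J J0 T / 2"
    by (intro tendsto_intros t_lim) simp
  ultimately have "spec_rad J J0 T / 2 \<le> 0 + 0 + 2 * 0"
    by (intro LIMSEQ_le) auto
  then show False using spec_rad_pos by simp
qed

end

lemma (in quotient) peripheral_sequence_exists:
  assumes T: "positive_op T" and compact: "compact_op T"
    and inv: "leaves_invariant T J" "leaves_invariant T J0"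
    and pos: "0 < spec_rad J J0 T"
  obtains t n y w z where "peripheral_sequence J J0 T t n y w z"
    "blinfun_apply T z - spec_rad J J0 T *\<^sub>R z \<in> J0"
proof -
  define \<rho> where "\<rho> = spec_rad J J0 T"
  have "\<exists>t n. \<rho> < t \<and> t < \<rho> + 1 / real (Suc k) \<and> qnorm (op_power T n) \<le> t ^ n
      \<and> real (Suc k) \<le> qnorm (neumann_sum T t n)" for k
    using neumann_sum_blowup[OF T inv pos, of "1 / real (Suc k)" "real (Suc k)"]
    unfolding \<rho>_def by (metis of_nat_0_less_iff zero_less_Suc zero_less_divide_1_iff)
  then obtain t n where t: "\<And>k. \<rho> < t k" "\<And>k. t k < \<rho> + 1 / real (Suc k)"
    and rem: "\<And>k. qnorm (op_power T (n k)) \<le> t k ^ n k"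
    and big: "\<And>k. real (Suc k) \<le> qnorm (neumann_sum T (t k) (n k))"
    by metis
  have tpos: "0 < t k" for k using t(1)[of k] pos by (simp add: \<rho>_def)
  define R where "R = (\<lambda>k. neumann_sum T (t k) (n k))"
  have R_pos: "positive_op (R k)" for k
    unfolding R_def by (rule positive_op_neumann_sum[OF T tpos])
  have big1: "1 \<le> qnorm (R k)" for k
    using big[of k] by (simp add: R_def)
  have t_lim: "t \<longlonglongrightarrow> \<rho>"
  proof (rule tendsto_sandwich[of "\<lambda>_. \<rho>" _ _ "\<lambda>k. \<rho> + 1 / real (Suc k)"])
    have "(\<lambda>k. \<rho> + 1 / real (Suc k)) \<longlonglongrightarrow> \<rho> + 0"
      using LIMSEQ_inverse_real_of_nat by (intro tendsto_intros) (simp add: inverse_eq_divide)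
    then show "(\<lambda>k. \<rho> + 1 / real (Suc k)) \<longlonglongrightarrow> \<rho>" by simp
  qed (use t in \<open>auto intro!: always_eventually less_imp_le simp del: of_nat_Suc\<close>)
  have big_lim: "filterlim (\<lambda>k. qnorm (R k)) at_top sequentially"
  proof (rule filterlim_at_top_mono)
    show "filterlim (\<lambda>k. real (Suc k)) at_top sequentially"
      by (rule filterlim_compose[OF filterlim_real_sequentially filterlim_Suc])
    show "\<forall>\<^sub>F k in sequentially. real (Suc k) \<le> qnorm (R k)"
      unfolding R_def by (intro always_eventually allI big)
  qed
  have "\<exists>y\<in>J. 0 \<le> y \<and> norm y \<le> 1 \<and> qnorm (R k) \<le> 2 * infdist (blinfun_apply (R k) y) J0" for k
  proof (rule ccontr)
    assume no: "\<not> ?thesis"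
    have "qnorm (R k) \<le> qnorm (R k) / 2"
    proof (rule qnorm_leI)
      fix y assume y: "y \<in> J" "norm y \<le> 1"
      have "infdist (blinfun_apply (R k) y) J0 \<le> infdist (blinfun_apply (R k) \<bar>y\<bar>) J0"
        by (rule infdist_ideal_mono[OF ideal0 order_trans[OF positive_op_abs[OF R_pos] abs_ge_self]])
      moreover have "\<not> qnorm (R k) \<le> 2 * infdist (blinfun_apply (R k) \<bar>y\<bar>) J0"
        using no y closed_idealD(4)[OF ideal] by auto
      ultimately show "infdist (blinfun_apply (R k) y) J0 \<le> qnorm (R k) / 2" by simp
    qed
    then show False using big1[of k] by simp
  qed
  then obtain y where y: "\<And>k. y k \<in> J" "\<And>k. 0 \<le> y k" "\<And>k. norm (y k) \<le> 1"
    and att: "\<And>k. qnorm (R k) \<le> 2 * infdist (blinfun_apply (R k) (y k)) J0"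
    by metis
  define d where "d = (\<lambda>k. infdist (blinfun_apply (R k) (y k)) J0)"
  have d: "1 / 2 \<le> d k" "qnorm (R k) \<le> 2 * d k" for k
    using att[of k] big1[of k] by (auto simp: d_def)
  define u where "u = (\<lambda>k. (1 / d k) *\<^sub>R blinfun_apply (R k) (y k))"
  have dpos: "0 < d k" for k using d(1)[of k] by linarith
  have R_inv: "leaves_invariant (R k) J" for k
    unfolding R_def by (rule leaves_invariant_neumann_sum[OF closed_idealD(2)[OF ideal] inv(1)])
  have u: "u k \<in> J" "0 \<le> u k" "infdist (u k) J0 = 1" for k
  proof -
    show "u k \<in> J"
      using R_inv[of k] y(1)[of k] subspace_scale[OF closed_idealD(2)[OF ideal]]
      by (simp add: u_def leaves_invariant_def)
    show "0 \<le> u k"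
      using dpos[of k] positive_opD[OF R_pos y(2)] by (simp add: u_def scaleR_nonneg_nonneg)
    show "infdist (u k) J0 = 1"
      using dpos[of k] by (simp add: u_def infdist_subspace_scaleR[OF sub0]) (simp add: d_def)
  qed
  \<comment> \<open>The \<open>u k\<close> need not be bounded in norm; compactness is applied to nonnegative representatives
    of norm less than \<open>2\<close>.\<close>
  have "\<exists>v\<in>J. 0 \<le> v \<and> norm v \<le> 2 \<and> v - u k \<in> J0" for k
  proof -
    obtain j where j: "j \<in> J0" "norm (u k - j) < infdist (u k) J0 + 1"
      using infdist_subspace_approx[OF sub0 zero_less_one] by blast
    have "\<bar>\<bar>u k - j\<bar> - u k\<bar> \<le> \<bar>j\<bar>"
      using abs_triangle_ineq3[of "u k - j" "u k"] u(2)[of k] by simp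
    then have "\<bar>u k - j\<bar> - u k \<in> J0"
      using closed_idealD(3)[OF ideal0 j(1)] by simp
    moreover have "\<bar>u k - j\<bar> \<in> J"
      using u(1)[of k] j(1) sub
      by (intro closed_idealD(4)[OF ideal] subspace_diff[OF closed_idealD(2)[OF ideal]]) auto
    moreover have "norm \<bar>u k - j\<bar> \<le> 2"
      using j(2) u(3)[of k] by simp
    ultimately show ?thesis
      by (intro bexI[of _ "\<bar>u k - j\<bar>"] conjI abs_ge_zero)
  qed
  then obtain v where v: "\<And>k. v k \<in> J" "\<And>k. 0 \<le> v k" "\<And>k. norm (v k) \<le> 2" "\<And>k. v k - u k \<in> J0"
    by metis
  obtain w r1 where r1: "strict_mono r1" "(\<lambda>k. blinfun_apply T (y (r1 k))) \<longlonglongrightarrow> w"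
    using compact_op_subseq[OF compact, of y 1] y(3) by blast
  obtain l r2 where r2: "strict_mono r2" "(\<lambda>k. blinfun_apply T (v (r1 (r2 k)))) \<longlonglongrightarrow> l"
    using compact_op_subseq[OF compact, of "\<lambda>k. v (r1 k)" 2] v(3) by blast
  define r where "r = r1 \<circ> r2"
  have r: "strict_mono r" using r1(1) r2(1) by (simp add: r_def strict_mono_o)
  have w_lim: "(\<lambda>k. blinfun_apply T (y (r k))) \<longlonglongrightarrow> w"
    using LIMSEQ_subseq_LIMSEQ[OF r1(2) r2(1)] by (simp add: r_def o_def)
  have l_lim: "(\<lambda>k. blinfun_apply T (v (r k))) \<longlonglongrightarrow> l"
    using r2(2) by (simp add: r_def)
  have \<rho>: "0 < \<rho>" using pos by (simp add: \<rho>_def)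
  define z where "z = (1 / \<rho>) *\<^sub>R l"
  have l: "l \<in> J" "0 \<le> l"
  proof -
    show "l \<in> J"
      using v(1) inv(1)
      by (intro closed_sequentially[OF closed_idealD(1)[OF ideal] _ l_lim]) (auto simp: leaves_invariant_def)
    show "0 \<le> l"
      by (rule LIMSEQ_nonneg[OF l_lim positive_opD[OF T v(2)]])
  qed
  have z: "z \<in> J" "0 \<le> z" "l = \<rho> *\<^sub>R z"
    using l \<rho> closed_idealD(2)[OF ideal]
    by (auto simp: z_def intro!: subspace_scale scaleR_nonneg_nonneg)
  have Tu: "infdist (t k *\<^sub>R u k - blinfun_apply T (u k)) J0 \<le> 4 / qnorm (R k)" for k
  proof -
    let ?x = "y k - (1 / t k ^ n k) *\<^sub>R blinfun_apply (op_power T (n k)) (y k)"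
    have "t k *\<^sub>R u k - blinfun_apply T (u k) = (1 / d k) *\<^sub>R (t k *\<^sub>R blinfun_apply (R k) (y k) - blinfun_apply T (blinfun_apply (R k) (y k)))"
      by (simp add: u_def blinfun.scaleR_right scaleR_diff_right)
    also have "\<dots> = (1 / d k) *\<^sub>R ?x"
      unfolding R_def using neumann_sum_resolvent[of "t k" T "n k" "y k"] tpos[of k] by simp
    finally have eq: "infdist (t k *\<^sub>R u k - blinfun_apply T (u k)) J0 = (1 / d k) * infdist ?x J0"
      using dpos[of k] by (simp add: infdist_subspace_scaleR[OF sub0])
    have "infdist ((1 / t k ^ n k) *\<^sub>R blinfun_apply (op_power T (n k)) (y k)) J0
        = (1 / t k ^ n k) * infdist (blinfun_apply (op_power T (n k)) (y k)) J0"
      using tpos[of k] by (simp add: infdist_subspace_scaleR[OF sub0])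
    also have "\<dots> \<le> (1 / t k ^ n k) * t k ^ n k"
      using infdist_le_qnorm[OF y(1) y(3), of "op_power T (n k)" k] rem[of k] tpos[of k]
      by (intro mult_left_mono) auto
    also have "\<dots> = 1" using tpos[of k] by simp
    finally have "infdist ?x J0 \<le> 2"
      using infdist_subspace_diff[OF sub0, of "y k" "(1 / t k ^ n k) *\<^sub>R blinfun_apply (op_power T (n k)) (y k)"]
        infdist_subspace_le_norm[OF sub0, of "y k"] y(3)[of k] by linarith
    then have "(1 / d k) * infdist ?x J0 \<le> (1 / d k) * 2"
      using dpos[of k] by (intro mult_left_mono) auto
    also have "\<dots> \<le> 4 / qnorm (R k)"
      using d(2)[of k] dpos[of k] big1[of k] by (simp add: field_simps)
    finally show ?thesis using eq by simp
  qed
  have bound: "infdist (z - u (r k)) J0 \<le> (1 / \<rho>) * (norm (l - blinfun_apply T (v (r k)))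
      + 4 * (1 / qnorm (R (r k))) + (t (r k) - \<rho>))" for k
  proof -
    let ?k = "r k"
    have 1: "infdist (blinfun_apply T (v ?k - u ?k)) J0 = 0"
      using v(4)[of ?k] inv(2) by (simp add: leaves_invariant_def)
    have split: "\<rho> *\<^sub>R (z - u ?k) = (l - blinfun_apply T (v ?k)) + (blinfun_apply T (v ?k - u ?k)
        + ((t ?k - \<rho>) *\<^sub>R u ?k - (t ?k *\<^sub>R u ?k - blinfun_apply T (u ?k))))"
      using z(3) by (simp add: blinfun.diff_right algebra_simps)
    have "infdist (\<rho> *\<^sub>R (z - u ?k)) J0 \<le> infdist (l - blinfun_apply T (v ?k)) J0
        + (infdist (blinfun_apply T (v ?k - u ?k)) J0
        + (infdist ((t ?k - \<rho>) *\<^sub>R u ?k) J0 + infdist (t ?k *\<^sub>R u ?k - blinfun_apply T (u ?k)) J0))"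
      unfolding split
      using infdist_subspace_add[OF sub0, of "l - blinfun_apply T (v ?k)" "blinfun_apply T (v ?k - u ?k)
          + ((t ?k - \<rho>) *\<^sub>R u ?k - (t ?k *\<^sub>R u ?k - blinfun_apply T (u ?k)))"]
        infdist_subspace_add[OF sub0, of "blinfun_apply T (v ?k - u ?k)"
          "(t ?k - \<rho>) *\<^sub>R u ?k - (t ?k *\<^sub>R u ?k - blinfun_apply T (u ?k))"]
        infdist_subspace_diff[OF sub0, of "(t ?k - \<rho>) *\<^sub>R u ?k" "t ?k *\<^sub>R u ?k - blinfun_apply T (u ?k)"]
      by linarith
    also have "\<dots> \<le> norm (l - blinfun_apply T (v ?k)) + (0 + ((t ?k - \<rho>) + 4 / qnorm (R ?k)))"
      using 1 t(1)[of ?k] u(3)[of ?k]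
      by (intro add_mono infdist_subspace_le_norm[OF sub0] Tu) (auto simp: infdist_subspace_scaleR[OF sub0])
    finally have "\<rho> * infdist (z - u ?k) J0 \<le> norm (l - blinfun_apply T (v ?k)) + 4 * (1 / qnorm (R ?k)) + (t ?k - \<rho>)"
      using \<rho> by (simp add: infdist_subspace_scaleR[OF sub0])
    then show ?thesis using \<rho> by (simp add: field_simps)
  qed
  have t_lim': "(\<lambda>k. t (r k)) \<longlonglongrightarrow> \<rho>"
    using LIMSEQ_subseq_LIMSEQ[OF t_lim r] by (simp add: o_def)
  have big_lim': "filterlim (\<lambda>k. qnorm (R (r k))) at_top sequentially"
    by (rule filterlim_compose[OF big_lim filterlim_subseq[OF r]])
  have z_lim: "(\<lambda>k. infdist (z - u (r k)) J0) \<longlonglongrightarrow> 0"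
  proof (rule tendsto_sandwich[of "\<lambda>_. 0"])
    have "(\<lambda>k. (1 / \<rho>) * (norm (l - blinfun_apply T (v (r k))) + 4 * (1 / qnorm (R (r k))) + (t (r k) - \<rho>)))
        \<longlonglongrightarrow> (1 / \<rho>) * (norm (l - l) + 4 * 0 + (\<rho> - \<rho>))"
      using tendsto_inverse_0_at_top[OF big_lim'] by (intro tendsto_intros l_lim t_lim') (simp add: inverse_eq_divide)
    then show "(\<lambda>k. (1 / \<rho>) * (norm (l - blinfun_apply T (v (r k))) + 4 * (1 / qnorm (R (r k))) + (t (r k) - \<rho>))) \<longlonglongrightarrow> 0"
      by simp
  qed (use bound in \<open>auto intro!: always_eventually infdist_nonneg\<close>)
  have z1: "infdist z J0 = 1"
  proof (rule LIMSEQ_unique)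
    show "(\<lambda>k. infdist (u (r k)) J0) \<longlonglongrightarrow> 1" by (simp add: u(3))
    have "\<bar>infdist (u (r k)) J0 - infdist z J0\<bar> \<le> infdist (z - u (r k)) J0" for k
      using infdist_subspace_diff[OF sub0, of z "z - u (r k)"]
        infdist_subspace_add[OF sub0, of "z - u (r k)" "u (r k)"] by simp
    then show "(\<lambda>k. infdist (u (r k)) J0) \<longlonglongrightarrow> infdist z J0"
      by (intro LIM_zero_cancel[OF Lim_null_comparison[OF _ z_lim]]) simp
  qed
  have eigen: "blinfun_apply T z - \<rho> *\<^sub>R z \<in> J0"
  proof -
    have "infdist (blinfun_apply T z - \<rho> *\<^sub>R z) J0
        \<le> qnorm T * infdist (z - u (r k)) J0 + norm (blinfun_apply T (v (r k)) - l)" for k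
    proof -
      have 1: "blinfun_apply T (v (r k) - u (r k)) \<in> J0"
        using v(4)[of "r k"] inv(2) by (simp add: leaves_invariant_def)
      have "blinfun_apply T z - \<rho> *\<^sub>R z = (blinfun_apply T (z - u (r k)) + (blinfun_apply T (v (r k)) - l))
          + - blinfun_apply T (v (r k) - u (r k))"
        using z(3) by (simp add: blinfun.diff_right algebra_simps)
      then have "infdist (blinfun_apply T z - \<rho> *\<^sub>R z) J0
          = infdist (blinfun_apply T (z - u (r k)) + (blinfun_apply T (v (r k)) - l)) J0"
        using infdist_subspace_add_mem[OF sub0 subspace_neg[OF sub0 1]] by simp
      also have "\<dots> \<le> qnorm T * infdist (z - u (r k)) J0 + norm (blinfun_apply T (v (r k)) - l)"
        using infdist_subspace_add[OF sub0, of "blinfun_apply T (z - u (r k))" "blinfun_apply T (v (r k)) - l"]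
          infdist_subspace_le_norm[OF sub0, of "blinfun_apply T (v (r k)) - l"]
          infdist_le_qnorm_mult[OF subspace_diff[OF closed_idealD(2)[OF ideal] z(1) u(1)[of "r k"]] inv(2)]
        by linarith
      finally show ?thesis .
    qed
    moreover have "(\<lambda>k. qnorm T * infdist (z - u (r k)) J0 + norm (blinfun_apply T (v (r k)) - l)) \<longlonglongrightarrow> qnorm T * 0 + norm (l - l)"
      by (intro tendsto_intros z_lim l_lim)
    ultimately have "infdist (blinfun_apply T z - \<rho> *\<^sub>R z) J0 \<le> qnorm T * 0 + norm (l - l)"
      by (metis (no_types, lifting) LIMSEQ_le_const)
    then have "infdist (blinfun_apply T z - \<rho> *\<^sub>R z) J0 = 0"
      using infdist_nonneg[of "blinfun_apply T z - \<rho> *\<^sub>R z" J0] by simp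
    then show ?thesis
      using in_closed_iff_infdist_zero[OF closed_idealD(1,7)[OF ideal0]] by simp
  qed
  have "peripheral_sequence J J0 T (\<lambda>k. t (r k)) (\<lambda>k. n (r k)) (\<lambda>k. y (r k)) w z"
  proof unfold_locales
    show "\<And>k. spec_rad J J0 T < t (r k)" "(\<lambda>k. t (r k)) \<longlonglongrightarrow> spec_rad J J0 T"
      using t(1) t_lim' by (simp_all only: \<rho>_def)
  qed (use T inv pos rem big_lim' big1 y att w_lim z z1 z_lim in \<open>simp_all only: R_def u_def d_def\<close>)
  then show ?thesis
    by (rule that[OF _ eigen[unfolded \<rho>_def]])
qed

text \<open>Some power \<open>T\<^sup>m\<close> has norm \<open>q l\<^sup>m\<close> with \<open>q < 1\<close>. Splitting off the first \<open>m\<close> terms bounds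
  the norm \<open>g\<close> of the sum by \<open>c + q g\<close>, where \<open>c\<close> does not depend on \<open>t\<close>.\<close>

lemma (in quotient) neumann_sum_bounded:
  assumes T: "positive_op T" and inv: "leaves_invariant T J" "leaves_invariant T J0"
    and l: "spec_rad J J0 T < l"
  obtains c where "\<And>t n. l \<le> t \<Longrightarrow> qnorm (neumann_sum T t n) \<le> c"
proof -
  have l0: "0 < l" using spec_rad_nonneg[of T] l by linarith
  obtain m where m: "0 < m" "qnorm (op_power T m) < l ^ m"
    using spec_rad_lessD[OF l] by blast
  define q where "q = qnorm (op_power T m) / l ^ m"
  have q: "0 \<le> q" "q < 1"
    using m(2) l0 qnorm_nonneg by (auto simp: q_def)
  define c where "c = (\<Sum>i<m. (1 / l ^ Suc i) * norm (op_power T i))"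
  have "qnorm (neumann_sum T t n) \<le> c / (1 - q)" if t: "l \<le> t" for t n
  proof -
    have t0: "0 < t" using l0 t by simp
    let ?G = "neumann_sum T t"
    have "qnorm (?G n) \<le> qnorm (?G m + (1 / t ^ m) *\<^sub>R (op_power T m o\<^sub>L ?G n))"
    proof (rule qnorm_mono[OF positive_op_neumann_sum[OF T t0]])
      fix y :: 'a assume "0 \<le> y"
      then have "blinfun_apply (?G n) y \<le> blinfun_apply (?G (m + n)) y"
        by (intro neumann_sum_mono T t0) auto
      then show "blinfun_apply (?G n) y \<le> blinfun_apply (?G m + (1 / t ^ m) *\<^sub>R (op_power T m o\<^sub>L ?G n)) y"
        by (simp add: neumann_sum_split blinfun.add_left blinfun.scaleR_left)
    qed
    also have "\<dots> \<le> qnorm (?G m) + qnorm ((1 / t ^ m) *\<^sub>R (op_power T m o\<^sub>L ?G n))"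
      by (rule qnorm_add)
    also have "qnorm (?G m) \<le> c"
    proof -
      have "norm (?G m) \<le> (\<Sum>i<m. norm ((1 / t ^ Suc i) *\<^sub>R op_power T i))"
        unfolding neumann_sum_def by (rule norm_sum)
      also have "\<dots> \<le> c"
        unfolding c_def
      proof (rule sum_mono)
        fix i
        have "1 / t ^ Suc i \<le> 1 / l ^ Suc i"
          using l0 t by (intro divide_left_mono power_mono mult_pos_pos zero_less_power) auto
        then show "norm ((1 / t ^ Suc i) *\<^sub>R op_power T i) \<le> (1 / l ^ Suc i) * norm (op_power T i)"
          using t0 mult_right_mono[of "1 / t ^ Suc i" "1 / l ^ Suc i" "norm (op_power T i)"]
          by (simp del: power_Suc)
      qed
      finally show ?thesis using qnorm_le_norm order_trans by blast
    qed
    also have "qnorm ((1 / t ^ m) *\<^sub>R (op_power T m o\<^sub>L ?G n)) \<le> (1 / t ^ m) * (qnorm (op_power T m) * qnorm (?G n))"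
    proof (rule order_trans[OF qnorm_scaleR])
      show "\<bar>1 / t ^ m\<bar> * qnorm (op_power T m o\<^sub>L ?G n) \<le> (1 / t ^ m) * (qnorm (op_power T m) * qnorm (?G n))"
        using t0 qnorm_compose[OF leaves_invariant_op_power[OF inv(2), of m]
            leaves_invariant_neumann_sum[OF closed_idealD(2)[OF ideal] inv(1), of t n]]
        by (simp add: divide_right_mono)
    qed
    also have "(1 / t ^ m) * (qnorm (op_power T m) * qnorm (?G n)) \<le> (1 / l ^ m) * (qnorm (op_power T m) * qnorm (?G n))"
      using l0 t by (intro mult_right_mono divide_left_mono power_mono mult_nonneg_nonneg qnorm_nonneg mult_pos_pos zero_less_power) auto
    finally have "qnorm (?G n) \<le> c + q * qnorm (?G n)"
      by (simp add: q_def)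
    then have "(1 - q) * qnorm (?G n) \<le> c" by (simp add: algebra_simps)
    then show ?thesis using q by (simp add: pos_le_divide_eq mult.commute)
  qed
  then show ?thesis using that by blast
qed

section \<open>Quasinilpotence of the commutators\<close>

text \<open>The locale covers both super commutants: \<open>s = 1\<close> is the left one and \<open>s = -1\<close> the right one,
  so that \<open>\<delta>\<close> is positive on \<open>S\<close> in both cases.\<close>

locale super_commutant =
  fixes A :: "'a::banach_lattice \<Rightarrow>\<^sub>L 'a" and S :: "('a \<Rightarrow>\<^sub>L 'a) set" and s :: real
  assumes s: "s = 1 \<or> s = - 1"
    and A_pos: "positive_op A" and A_compact: "compact_op A"
    and A_mem: "A \<in> S" and id_mem: "id_blinfun \<in> S"
    and compose_mem: "\<And>M N. M \<in> S \<Longrightarrow> N \<in> S \<Longrightarrow> M o\<^sub>L N \<in> S"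
    and add_mem: "\<And>M N. M \<in> S \<Longrightarrow> N \<in> S \<Longrightarrow> M + N \<in> S"
    and scale_mem: "\<And>M c. M \<in> S \<Longrightarrow> 0 \<le> c \<Longrightarrow> c *\<^sub>R M \<in> S"
    and S_pos: "\<And>M. M \<in> S \<Longrightarrow> positive_op M"
    and commutator_pos: "\<And>M. M \<in> S \<Longrightarrow> positive_op (s *\<^sub>R ((A o\<^sub>L M) - (M o\<^sub>L A)))"
begin

definition \<delta> :: "('a \<Rightarrow>\<^sub>L 'a) \<Rightarrow> 'a \<Rightarrow>\<^sub>L 'a" where
  "\<delta> M = s *\<^sub>R ((A o\<^sub>L M) - (M o\<^sub>L A))"

lemma \<delta>_apply: "blinfun_apply (\<delta> M) x
    = s *\<^sub>R (blinfun_apply A (blinfun_apply M x) - blinfun_apply M (blinfun_apply A x))"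
  by (simp add: \<delta>_def blinfun.scaleR_left blinfun.diff_left)

lemma \<delta>_pos: "M \<in> S \<Longrightarrow> positive_op (\<delta> M)"
  using commutator_pos by (simp add: \<delta>_def)

lemma \<delta>_compact: "compact_op (\<delta> M)"
proof -
  have "compact_op ((A o\<^sub>L M) - (M o\<^sub>L A))"
    by (intro compact_op_diff compact_op_compose_left compact_op_compose_right A_compact)
  then have "compact_op ((s *\<^sub>R id_blinfun) o\<^sub>L ((A o\<^sub>L M) - (M o\<^sub>L A)))"
    by (rule compact_op_compose_left)
  moreover have "(s *\<^sub>R id_blinfun) o\<^sub>L ((A o\<^sub>L M) - (M o\<^sub>L A)) = \<delta> M"
    by (rule blinfun_eqI) (simp add: \<delta>_apply blinfun.scaleR_left blinfun.diff_left)
  ultimately show ?thesis by simp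
qed

definition invariant_ideal :: "'a set \<Rightarrow> bool" where
  "invariant_ideal J \<longleftrightarrow> closed_ideal J \<and> (\<forall>M\<in>S. leaves_invariant M J)"

lemma invariant_idealD:
  assumes "invariant_ideal J"
  shows "closed_ideal J" "\<And>M. M \<in> S \<Longrightarrow> leaves_invariant M J"
  using assms by (auto simp: invariant_ideal_def)

lemma invariant_ideal_\<delta>:
  assumes J: "invariant_ideal J" and M: "M \<in> S"
  shows "leaves_invariant (\<delta> M) J"
  unfolding leaves_invariant_def
proof
  fix x assume "x \<in> J"
  then have "blinfun_apply A (blinfun_apply M x) \<in> J" "blinfun_apply M (blinfun_apply A x) \<in> J"
    using invariant_idealD(2)[OF J A_mem] invariant_idealD(2)[OF J M] by (auto simp: leaves_invariant_def)
  then show "blinfun_apply (\<delta> M) x \<in> J"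
    using closed_idealD(2)[OF invariant_idealD(1)[OF J]]
    by (simp add: \<delta>_apply subspace_scale subspace_diff)
qed

text \<open>The commutator is a derivation, so \<open>\<delta> (C B C')\<close> is the sum of three positive operators, one of
  which is \<open>C \<delta> B C'\<close>.\<close>

lemma \<delta>_sandwich_le:
  assumes "C \<in> S" "B \<in> S" "C' \<in> S" "0 \<le> x"
  shows "blinfun_apply C (blinfun_apply (\<delta> B) (blinfun_apply C' x)) \<le> blinfun_apply (\<delta> (C o\<^sub>L B o\<^sub>L C')) x"
proof -
  have eq: "blinfun_apply (\<delta> (C o\<^sub>L B o\<^sub>L C')) x = blinfun_apply C (blinfun_apply (\<delta> B) (blinfun_apply C' x))
      + (blinfun_apply (\<delta> C) (blinfun_apply B (blinfun_apply C' x))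
        + blinfun_apply C (blinfun_apply B (blinfun_apply (\<delta> C') x)))"
    by (simp add: \<delta>_apply blinfun.scaleR_right blinfun.diff_right flip: scaleR_add_right)
  have "0 \<le> blinfun_apply (\<delta> C) (blinfun_apply B (blinfun_apply C' x))
        + blinfun_apply C (blinfun_apply B (blinfun_apply (\<delta> C') x))"
    using assms by (intro add_nonneg_nonneg positive_opD \<delta>_pos S_pos) auto
  then show ?thesis unfolding eq by simp
qed

text \<open>When \<open>Q\<close> is a closed solid cone, this is the largest \<open>S\<close>-invariant ideal
  in \<open>J\<close> whose positive elements lie in \<open>Q\<close>.\<close>

definition invariant_core :: "'a set \<Rightarrow> 'a set \<Rightarrow> 'a set" where
  "invariant_core J Q = {x \<in> J. \<forall>C\<in>S. blinfun_apply C \<bar>x\<bar> \<in> Q}"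

lemma invariant_ideal_core:
  assumes J: "invariant_ideal J" and "closed Q" "0 \<in> Q"
    and add: "\<And>x y. x \<in> Q \<Longrightarrow> y \<in> Q \<Longrightarrow> x + y \<in> Q"
    and scale: "\<And>x c. x \<in> Q \<Longrightarrow> 0 \<le> c \<Longrightarrow> c *\<^sub>R x \<in> Q"
    and solid: "\<And>x y. x \<in> Q \<Longrightarrow> 0 \<le> y \<Longrightarrow> y \<le> x \<Longrightarrow> y \<in> Q"
  shows "invariant_ideal (invariant_core J Q)"
proof -
  note ideal = invariant_idealD(1)[OF J]
  have solid': "y \<in> invariant_core J Q" if x: "x \<in> J" "\<And>C. C \<in> S \<Longrightarrow> blinfun_apply C x \<in> Q" "\<bar>y\<bar> \<le> x" for x y
  proof -
    have "\<bar>y\<bar> \<le> \<bar>x\<bar>" by (rule order_trans[OF x(3) abs_ge_self])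
    then have "y \<in> J" by (rule closed_idealD(3)[OF ideal x(1)])
    moreover have "blinfun_apply C \<bar>y\<bar> \<in> Q" if "C \<in> S" for C
      by (rule solid[OF x(2)[OF that] positive_opD[OF S_pos[OF that] abs_ge_zero]
            positive_op_mono[OF S_pos[OF that] x(3)]])
    ultimately show ?thesis
      by (simp add: invariant_core_def)
  qed
  have mem: "\<bar>x\<bar> \<in> J" "\<And>C. C \<in> S \<Longrightarrow> blinfun_apply C \<bar>x\<bar> \<in> Q" if "x \<in> invariant_core J Q" for x
  proof -
    show "\<bar>x\<bar> \<in> J"
      using that by (intro closed_idealD(4)[OF ideal]) (simp add: invariant_core_def)
    show "\<And>C. C \<in> S \<Longrightarrow> blinfun_apply C \<bar>x\<bar> \<in> Q"
      using that by (simp add: invariant_core_def)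
  qed
  have "subspace (invariant_core J Q)"
  proof (rule subspaceI)
    show "0 \<in> invariant_core J Q"
      using \<open>0 \<in> Q\<close> closed_idealD(6)[OF ideal] by (simp add: invariant_core_def blinfun.zero_right)
    fix x y assume x: "x \<in> invariant_core J Q"
    show "c *\<^sub>R x \<in> invariant_core J Q" for c
    proof (rule solid'[of "\<bar>c\<bar> *\<^sub>R \<bar>x\<bar>"])
      show "\<bar>c\<bar> *\<^sub>R \<bar>x\<bar> \<in> J"
        by (rule subspace_scale[OF closed_idealD(2)[OF ideal] mem(1)[OF x]])
      show "blinfun_apply C (\<bar>c\<bar> *\<^sub>R \<bar>x\<bar>) \<in> Q" if "C \<in> S" for C
        unfolding blinfun.scaleR_right by (rule scale[OF mem(2)[OF x that] abs_ge_zero])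
      show "\<bar>c *\<^sub>R x\<bar> \<le> \<bar>c\<bar> *\<^sub>R \<bar>x\<bar>"
      proof (cases "0 \<le> c")
        case False
        have "\<bar>c *\<^sub>R x\<bar> = \<bar>(- c) *\<^sub>R x\<bar>" by simp
        also have "\<dots> = \<bar>c\<bar> *\<^sub>R \<bar>x\<bar>"
          using False by (subst abs_scaleR_nonneg) auto
        finally show ?thesis by simp
      qed (simp add: abs_scaleR_nonneg)
    qed
    assume y: "y \<in> invariant_core J Q"
    show "x + y \<in> invariant_core J Q"
    proof (rule solid'[of "\<bar>x\<bar> + \<bar>y\<bar>"])
      show "\<bar>x\<bar> + \<bar>y\<bar> \<in> J"
        by (rule subspace_add[OF closed_idealD(2)[OF ideal] mem(1)[OF x] mem(1)[OF y]])
      show "blinfun_apply C (\<bar>x\<bar> + \<bar>y\<bar>) \<in> Q" if "C \<in> S" for C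
        unfolding blinfun.add_right by (rule add[OF mem(2)[OF x that] mem(2)[OF y that]])
      show "\<bar>x + y\<bar> \<le> \<bar>x\<bar> + \<bar>y\<bar>" by (rule abs_triangle_ineq)
    qed
  qed
  moreover have "closed (invariant_core J Q)"
    unfolding closed_sequential_limits
  proof (intro allI impI)
    fix f l assume "(\<forall>n. f n \<in> invariant_core J Q) \<and> f \<longlonglongrightarrow> l"
    then have f: "\<And>n. f n \<in> invariant_core J Q" and lim: "f \<longlonglongrightarrow> l" by auto
    have "f n \<in> J" for n
      using f[of n] by (simp add: invariant_core_def)
    then have "l \<in> J"
      using closed_sequentially[of J f l] closed_idealD(1)[OF ideal] lim by blast
    moreover have "blinfun_apply C \<bar>l\<bar> \<in> Q" if "C \<in> S" for C
    proof (rule closed_sequentially[OF \<open>closed Q\<close>])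
      show "(\<lambda>n. blinfun_apply C \<bar>f n\<bar>) \<longlonglongrightarrow> blinfun_apply C \<bar>l\<bar>"
        by (intro blinfun.tendsto tendsto_const tendsto_abs_lattice lim)
      show "blinfun_apply C \<bar>f n\<bar> \<in> Q" for n
        by (rule mem(2)[OF f that])
    qed
    ultimately show "l \<in> invariant_core J Q" by (simp add: invariant_core_def)
  qed
  moreover have "y \<in> invariant_core J Q" if "x \<in> invariant_core J Q" "\<bar>y\<bar> \<le> \<bar>x\<bar>" for x y
    by (rule solid'[OF mem[OF that(1)] that(2)])
  moreover have "leaves_invariant M (invariant_core J Q)" if M: "M \<in> S" for M
    unfolding leaves_invariant_def
  proof
    fix x assume x: "x \<in> invariant_core J Q"
    show "blinfun_apply M x \<in> invariant_core J Q"
    proof (rule solid'[of "blinfun_apply M \<bar>x\<bar>"])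
      show "blinfun_apply M \<bar>x\<bar> \<in> J"
        using mem(1)[OF x] invariant_idealD(2)[OF J M] by (simp add: leaves_invariant_def)
      show "blinfun_apply C (blinfun_apply M \<bar>x\<bar>) \<in> Q" if "C \<in> S" for C
        using mem(2)[OF x compose_mem[OF that M]] by simp
    qed (rule positive_op_abs[OF S_pos[OF M]])
  qed
  ultimately show ?thesis
    by (auto simp: invariant_ideal_def closed_ideal_def)
qed

text \<open>If the \<open>R k\<close> were resolvents approaching a pole, these would be the positive vectors
  annihilated modulo \<open>J0\<close> by the leading coefficient of the Laurent expansion.\<close>

definition small_cone :: "'a set \<Rightarrow> 'a set \<Rightarrow> (nat \<Rightarrow> 'a \<Rightarrow>\<^sub>L 'a) \<Rightarrow> 'a set" where
  "small_cone J J0 R = {x \<in> J. 0 \<le> x \<and> (\<lambda>k. infdist (blinfun_apply (R k) x) J0 / quot_norm J J0 (R k)) \<longlonglongrightarrow> 0}"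

text \<open>The cone is closed because the operators \<open>R k / qnorm (R k)\<close> are equicontinuous from \<open>J\<close>
  to \<open>J / J0\<close>. Its invariant core is a proper ideal since it does not contain \<open>w\<close>.\<close>

lemma small_core:
  assumes seq: "peripheral_sequence J J0 T t n y w z"
    and J: "invariant_ideal J" and J0: "invariant_ideal J0"
  defines "N \<equiv> invariant_core J (small_cone J J0 (\<lambda>k. neumann_sum T (t k) (n k)))"
  shows "invariant_ideal N" "J0 \<subseteq> N" "N \<subseteq> J" "N \<noteq> J"
proof -
  interpret peripheral_sequence J J0 T t n y w z by (rule seq)
  let ?Q = "small_cone J J0 R"
  let ?f = "\<lambda>x k. infdist (blinfun_apply (R k) x) J0 / qnorm (R k)"
  have g: "0 < qnorm (R k)" for k using norm_ge_1[of k] by simp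
  have f_le: "?f x k \<le> norm x" if "x \<in> J" for x k
    using infdist_le_qnorm_mult_norm[OF that, of "R k"] g[of k] by (simp add: divide_le_eq mult.commute)
  have f_nonneg: "0 \<le> ?f x k" for x k
    using g[of k] infdist_nonneg[of "blinfun_apply (R k) x" J0] by simp
  have f_add: "?f (x + y) k \<le> ?f x k + ?f y k" for x y k
    using infdist_subspace_add[OF sub0, of "blinfun_apply (R k) x" "blinfun_apply (R k) y"] g[of k]
    by (simp add: blinfun.add_right divide_right_mono flip: add_divide_distrib)
  have QD: "x \<in> J" "0 \<le> x" "?f x \<longlonglongrightarrow> 0" if "x \<in> ?Q" for x
    using that by (auto simp: small_cone_def)
  have QI: "x \<in> ?Q" if "x \<in> J" "0 \<le> x" "?f x \<longlonglongrightarrow> 0" for x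
    using that by (auto simp: small_cone_def)
  have inv_core: "invariant_ideal (invariant_core J ?Q)"
  proof (rule invariant_ideal_core[OF J])
    show "0 \<in> ?Q"
      using closed_idealD(6)[OF ideal] closed_idealD(6)[OF ideal0] by (simp add: small_cone_def blinfun.zero_right)
    show "x + y \<in> ?Q" if x: "x \<in> ?Q" and y: "y \<in> ?Q" for x y
    proof (rule QI)
      show "x + y \<in> J" by (rule subspace_add[OF closed_idealD(2)[OF ideal] QD(1)[OF x] QD(1)[OF y]])
      show "0 \<le> x + y" using QD(2)[OF x] QD(2)[OF y] by simp
      show "?f (x + y) \<longlonglongrightarrow> 0"
      proof (rule tendsto_sandwich[OF _ _ tendsto_const])
        show "(\<lambda>k. ?f x k + ?f y k) \<longlonglongrightarrow> 0"
          using tendsto_add[OF QD(3)[OF x] QD(3)[OF y]] by simp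
      qed (use f_add f_nonneg in auto)
    qed
    show "c *\<^sub>R x \<in> ?Q" if x: "x \<in> ?Q" and c: "0 \<le> c" for x c
    proof (rule QI)
      show "c *\<^sub>R x \<in> J" by (rule subspace_scale[OF closed_idealD(2)[OF ideal] QD(1)[OF x]])
      show "0 \<le> c *\<^sub>R x" using QD(2)[OF x] c by (rule scaleR_nonneg_nonneg[rotated])
      show "?f (c *\<^sub>R x) \<longlonglongrightarrow> 0"
        using tendsto_mult_left[OF QD(3)[OF x], of "\<bar>c\<bar>"]
        by (simp add: blinfun.scaleR_right infdist_subspace_scaleR[OF sub0])
    qed
    show "y \<in> ?Q" if x: "x \<in> ?Q" and y: "0 \<le> y" "y \<le> x" for x y
    proof (rule QI)
      show "y \<in> J" by (rule closed_idealD(8)[OF ideal QD(1)[OF x] y])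
      show "?f y \<longlonglongrightarrow> 0"
      proof (rule tendsto_sandwich[OF _ _ tendsto_const QD(3)[OF x]])
        have "?f y k \<le> ?f x k" for k
        proof -
          have "\<bar>blinfun_apply (R k) y\<bar> \<le> \<bar>blinfun_apply (R k) x\<bar>"
            using positive_opD[OF R_pos y(1)] positive_opD[OF R_pos QD(2)[OF x]] positive_op_mono[OF R_pos y(2)]
            by simp
          then show ?thesis
            using infdist_ideal_mono[OF ideal0] g[of k] by (simp add: divide_right_mono)
        qed
        then show "\<forall>\<^sub>F k in sequentially. ?f y k \<le> ?f x k" by simp
      qed (use f_nonneg in auto)
    qed (rule y(1))
    show "closed ?Q"
      unfolding closed_sequential_limits
    proof (intro allI impI)
      fix v l assume "(\<forall>i. v i \<in> ?Q) \<and> v \<longlonglongrightarrow> l"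
      then have v: "\<And>i. v i \<in> ?Q" and lim: "v \<longlonglongrightarrow> l" by auto
      have l: "l \<in> J"
        by (rule closed_sequentially[OF closed_idealD(1)[OF ideal] QD(1)[OF v] lim])
      show "l \<in> ?Q"
      proof (rule QI[OF l])
        show "0 \<le> l" by (rule LIMSEQ_nonneg[OF lim QD(2)[OF v]])
        show "?f l \<longlonglongrightarrow> 0"
        proof (rule LIMSEQ_I)
          fix e :: real assume e: "0 < e"
          obtain i where i: "norm (v i - l) < e / 2"
            using LIMSEQ_D[OF lim, of "e / 2"] e by auto
          obtain m where m: "\<And>k. m \<le> k \<Longrightarrow> norm (?f (v i) k - 0) < e / 2"
            using LIMSEQ_D[OF QD(3)[OF v], of "e / 2" i] e by auto
          have "norm (?f l k - 0) < e" if "m \<le> k" for k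
          proof -
            have "?f l k = ?f (v i + (l - v i)) k" by simp
            also have "\<dots> \<le> ?f (v i) k + ?f (l - v i) k" by (rule f_add)
            also have "?f (l - v i) k \<le> norm (l - v i)"
              by (rule f_le[OF subspace_diff[OF closed_idealD(2)[OF ideal] l QD(1)[OF v]]])
            finally have "?f l k \<le> ?f (v i) k + norm (v i - l)" by (simp add: norm_minus_commute)
            moreover have "?f (v i) k < e / 2"
              using m[OF that] f_nonneg[where x = "v i" and k = k] by (simp only: diff_0_right real_norm_def abs_of_nonneg)
            ultimately have "?f l k < e" using i by linarith
            then show ?thesis
              using f_nonneg[where x = l and k = k] by (simp only: diff_0_right real_norm_def abs_of_nonneg)
          qed
          then show "\<exists>m. \<forall>k\<ge>m. norm (?f l k - 0) < e" by blast
        qed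
      qed
    qed
  qed
  then show "invariant_ideal N" by (simp add: N_def)
  show "J0 \<subseteq> N"
  proof
    fix x assume x: "x \<in> J0"
    have "blinfun_apply C \<bar>x\<bar> \<in> ?Q" if C: "C \<in> S" for C
    proof (rule QI)
      have C0: "blinfun_apply C \<bar>x\<bar> \<in> J0"
        using closed_idealD(4)[OF ideal0 x] invariant_idealD(2)[OF J0 C] by (simp add: leaves_invariant_def)
      then show "blinfun_apply C \<bar>x\<bar> \<in> J" using sub by blast
      show "0 \<le> blinfun_apply C \<bar>x\<bar>" by (rule positive_opD[OF S_pos[OF C] abs_ge_zero])
      have "blinfun_apply (R k) (blinfun_apply C \<bar>x\<bar>) \<in> J0" for k
        using R_inv(2)[of k] C0 by (simp add: leaves_invariant_def)
      then show "?f (blinfun_apply C \<bar>x\<bar>) \<longlonglongrightarrow> 0" by simp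
    qed
    then show "x \<in> N" using x sub by (auto simp: N_def invariant_core_def)
  qed
  show "N \<subseteq> J" by (auto simp: N_def invariant_core_def)
  show "N \<noteq> J"
  proof
    assume "N = J"
    then have "w \<in> N" using w_mem by simp
    then have "blinfun_apply id_blinfun \<bar>w\<bar> \<in> ?Q"
      using id_mem by (auto simp: N_def invariant_core_def)
    then have lim: "?f \<bar>w\<bar> \<longlonglongrightarrow> 0" using QD(3) by simp
    have "?f w \<longlonglongrightarrow> 0"
    proof (rule tendsto_sandwich[OF _ _ tendsto_const lim])
      have "?f w k \<le> ?f \<bar>w\<bar> k" for k
        using infdist_ideal_mono[OF ideal0 order_trans[OF positive_op_abs[OF R_pos] abs_ge_self], of k w] g[of k]
        by (simp add: divide_right_mono)
      then show "\<forall>\<^sub>F k in sequentially. ?f w k \<le> ?f \<bar>w\<bar> k" by simp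
    qed (use f_nonneg in auto)
    then show False using w_not_small by blast
  qed
qed

text \<open>Sandwiched between resolvents the commutator telescopes: if \<open>(t - A) R = 1\<close>, then \<open>R (A M
  - M A) R = R M - M R\<close>. Hence \<open>R \<delta>(M) R\<close> is dominated by \<open>R M\<close> or by \<open>M R\<close>, and its norm grows
  only linearly in the norm of \<open>R\<close>. For the truncated resolvents there is a correction by the
  remainder \<open>1 - (t - A) R\<close>, whose norm is at most \<open>1\<close>.\<close>

lemma resolvent_sandwich:
  assumes seq: "peripheral_sequence J J0 A t n y w z"
    and J: "invariant_ideal J" and J0: "invariant_ideal J0" and M: "M \<in> S"
  shows "infdist (blinfun_apply (neumann_sum A (t k) (n k)) (blinfun_apply (\<delta> M)
      (blinfun_apply (neumann_sum A (t k) (n k)) (y k)))) J0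
    \<le> 2 * norm M * quot_norm J J0 (neumann_sum A (t k) (n k))"
proof -
  interpret peripheral_sequence J J0 A t n y w z by (rule seq)
  let ?R = "blinfun_apply (R k)" and ?M = "blinfun_apply M" and ?y = "y k" and ?g = "qnorm (R k)"
  define E where "E = (1 / t k ^ n k) *\<^sub>R op_power A (n k)"
  let ?E = "blinfun_apply E"
  have E_pos: "positive_op E"
    unfolding E_def using t_pos[of k] by (intro positive_op_scaleR positive_op_power T_pos) auto
  have E_inv: "leaves_invariant E J0" "leaves_invariant E J"
    using leaves_invariant_op_power[OF T_inv(2), of "n k"] leaves_invariant_op_power[OF T_inv(1), of "n k"]
      subspace_scale[OF sub0] subspace_scale[OF closed_idealD(2)[OF ideal]]
    by (auto simp: E_def leaves_invariant_def blinfun.scaleR_left)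
  have E_norm: "qnorm E \<le> 1" unfolding E_def by (rule qnorm_power_term)
  have AR: "blinfun_apply A (?R x) = t k *\<^sub>R ?R x - (x - ?E x)" for x
    using neumann_sum_resolvent[of "t k" A "n k" x] t_pos[of k]
    by (simp add: E_def blinfun.scaleR_left algebra_simps)
  have RA: "?R (blinfun_apply A x) = t k *\<^sub>R ?R x - (x - ?E x)" for x
    by (simp add: neumann_sum_commute_apply AR)
  have eq: "?R (blinfun_apply (\<delta> M) (?R ?y)) = s *\<^sub>R ((?R (?M ?y) - ?M (?R ?y)) + (?E (?M (?R ?y)) - ?R (?M (?E ?y))))"
  proof -
    have "?R (blinfun_apply (\<delta> M) (?R ?y)) = s *\<^sub>R (?R (blinfun_apply A (?M (?R ?y))) - ?R (?M (blinfun_apply A (?R ?y))))"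
      by (simp add: \<delta>_apply blinfun.scaleR_right blinfun.diff_right)
    also have "?R (blinfun_apply A (?M (?R ?y))) = t k *\<^sub>R ?R (?M (?R ?y)) - (?M (?R ?y) - ?E (?M (?R ?y)))"
      by (rule RA)
    also have "?R (?M (blinfun_apply A (?R ?y))) = t k *\<^sub>R ?R (?M (?R ?y)) - (?R (?M ?y) - ?R (?M (?E ?y)))"
      unfolding AR by (simp add: blinfun.diff_right blinfun.scaleR_right)
    finally show ?thesis by (simp add: algebra_simps)
  qed
  note pos = positive_opD[OF R_pos] positive_opD[OF S_pos[OF M]] positive_opD[OF E_pos]
  have M_inv: "leaves_invariant M J" "leaves_invariant M J0"
    using invariant_idealD(2)[OF J M] invariant_idealD(2)[OF J0 M] by auto
  have mem: "?M ?y \<in> J" "?R ?y \<in> J" "?M (?R ?y) \<in> J" "?E ?y \<in> J" "?M (?E ?y) \<in> J"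
    using y_mem[of k] R_inv(1)[of k] M_inv(1) E_inv(2) by (auto simp: leaves_invariant_def)
  have g: "0 \<le> ?g" by (rule qnorm_nonneg)
  have p_y: "infdist ?y J0 \<le> 1"
    using infdist_subspace_le_norm[OF sub0, of ?y] y_norm[of k] by simp
  have p_Ry: "infdist (?R ?y) J0 \<le> ?g" by (rule infdist_le_qnorm[OF y_mem y_norm])
  have p_M: "infdist (?M x) J0 \<le> norm M * infdist x J0" if "x \<in> J" for x
    using infdist_le_qnorm_mult[OF that M_inv(2)] mult_right_mono[OF qnorm_le_norm[of M] infdist_nonneg[of x J0]]
    by simp
  have p_E: "infdist (?E x) J0 \<le> infdist x J0" if "x \<in> J" for x
    using infdist_le_qnorm_mult[OF that E_inv(1)] mult_right_mono[OF E_norm infdist_nonneg[of x J0]] by simp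
  have p_R: "infdist (?R x) J0 \<le> ?g * infdist x J0" if "x \<in> J" for x
    by (rule infdist_le_qnorm_mult[OF that R_inv(2)])
  have p_MR: "infdist (?M (?R ?y)) J0 \<le> norm M * ?g"
    using p_M[OF mem(2)] mult_left_mono[OF p_Ry norm_ge_zero[of M]] by simp
  have p_RM: "infdist (?R (?M x)) J0 \<le> norm M * ?g" if "x \<in> J" "infdist x J0 \<le> 1" for x
  proof -
    have "?M x \<in> J" using that M_inv(1) by (simp add: leaves_invariant_def)
    then have "infdist (?R (?M x)) J0 \<le> ?g * infdist (?M x) J0" by (rule p_R)
    also have "\<dots> \<le> ?g * (norm M * 1)"
      using p_M[OF that(1)] mult_left_mono[OF that(2) norm_ge_zero[of M]] g by (intro mult_left_mono) auto
    finally show ?thesis by (simp add: mult.commute)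
  qed
  have lhs: "0 \<le> ?R (blinfun_apply (\<delta> M) (?R ?y))"
    by (intro pos(1) positive_opD[OF \<delta>_pos[OF M]] y_nonneg)
  from s show ?thesis
  proof
    assume "s = 1"
    then have eq1: "?R (blinfun_apply (\<delta> M) (?R ?y)) = (?R (?M ?y) - ?M (?R ?y)) + (?E (?M (?R ?y)) - ?R (?M (?E ?y)))"
      using eq by simp
    have "?R (blinfun_apply (\<delta> M) (?R ?y)) \<le> ?R (?M ?y) + ?E (?M (?R ?y))"
    proof -
      have "0 \<le> ?M (?R ?y) + ?R (?M (?E ?y))"
        by (intro add_nonneg_nonneg pos y_nonneg)
      then show ?thesis unfolding eq1 by (simp add: algebra_simps)
    qed
    then have "infdist (?R (blinfun_apply (\<delta> M) (?R ?y))) J0 \<le> infdist (?R (?M ?y) + ?E (?M (?R ?y))) J0"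
      using lhs by (intro infdist_ideal_mono[OF ideal0]) simp
    also have "\<dots> \<le> infdist (?R (?M ?y)) J0 + infdist (?E (?M (?R ?y))) J0"
      by (rule infdist_subspace_add[OF sub0])
    also have "\<dots> \<le> norm M * ?g + norm M * ?g"
      using p_RM[OF y_mem p_y] p_E[OF mem(3)] p_MR by simp
    finally show ?thesis by simp
  next
    assume "s = - 1"
    then have eq1: "?R (blinfun_apply (\<delta> M) (?R ?y)) = - ((?R (?M ?y) - ?M (?R ?y)) + (?E (?M (?R ?y)) - ?R (?M (?E ?y))))"
      using eq by simp
    have "?R (blinfun_apply (\<delta> M) (?R ?y)) \<le> ?M (?R ?y) + ?R (?M (?E ?y))"
    proof -
      have "0 \<le> ?R (?M ?y) + ?E (?M (?R ?y))"
        by (intro add_nonneg_nonneg pos y_nonneg)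
      then show ?thesis unfolding eq1 by (simp add: algebra_simps)
    qed
    then have "infdist (?R (blinfun_apply (\<delta> M) (?R ?y))) J0 \<le> infdist (?M (?R ?y) + ?R (?M (?E ?y))) J0"
      using lhs by (intro infdist_ideal_mono[OF ideal0]) simp
    also have "\<dots> \<le> infdist (?M (?R ?y)) J0 + infdist (?R (?M (?E ?y))) J0"
      by (rule infdist_subspace_add[OF sub0])
    also have "\<dots> \<le> norm M * ?g + norm M * ?g"
      using p_RM[OF mem(4) order_trans[OF p_E[OF y_mem] p_y]] p_MR by simp
    finally show ?thesis by simp
  qed
qed

text \<open>Let \<open>z\<close> be the Perron eigenvector of \<open>A\<close> modulo \<open>J0\<close>. As \<open>z\<close> is a limit of the vectors
  \<open>R\<^sub>k (y k)\<close>, normalized, the sandwich estimate shows that the truncated resolvents are small on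
  \<open>C (\<delta> B (C' z))\<close>; so \<open>\<delta> B (C' z)\<close> lies in a proper invariant ideal, which is \<open>J0\<close> by
  irreducibility. But then the set of all \<open>x\<close> for which \<open>\<delta> B (C' \<bar>x\<bar>)\<close> always lies in \<open>J0\<close> is an
  invariant ideal containing \<open>z\<close>, and by irreducibility it is \<open>J\<close>.\<close>

lemma commutator_zero_on_irreducible:
  assumes J: "invariant_ideal J" and J0: "invariant_ideal J0" and sub: "J0 \<subseteq> J"
    and irreducible: "\<And>N. invariant_ideal N \<Longrightarrow> J0 \<subseteq> N \<Longrightarrow> N \<subseteq> J \<Longrightarrow> N = J0 \<or> N = J"
    and pos: "0 < spec_rad J J0 A" and B: "B \<in> S" and x: "x \<in> J"
  shows "blinfun_apply (\<delta> B) x \<in> J0"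
proof -
  interpret quotient J J0
    using invariant_idealD(1)[OF J] invariant_idealD(1)[OF J0] sub by unfold_locales
  obtain t n y w z where seq: "peripheral_sequence J J0 A t n y w z"
      and "blinfun_apply A z - spec_rad J J0 A *\<^sub>R z \<in> J0"
    by (rule peripheral_sequence_exists[OF A_pos A_compact invariant_idealD(2)[OF J A_mem] invariant_idealD(2)[OF J0 A_mem] pos])
  interpret peripheral_sequence J J0 A t n y w z by (rule seq)
  define N where "N = invariant_core J (small_cone J J0 R)"
  have N: "invariant_ideal N" "J0 \<subseteq> N" "N \<subseteq> J" "N \<noteq> J"
    using small_core[OF seq J J0] by (simp_all add: N_def)
  have "N = J0" using irreducible[OF N(1-3)] N(4) by blast
  have g: "1 \<le> qnorm (R k)" for k by (rule norm_ge_1)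
  have in_J0: "blinfun_apply (\<delta> B) (blinfun_apply C' z) \<in> J0" if C': "C' \<in> S" for C'
  proof -
    let ?v = "blinfun_apply (\<delta> B) (blinfun_apply C' z)"
    have v: "?v \<in> J" "0 \<le> ?v"
    proof -
      have "blinfun_apply C' z \<in> J"
        using z_mem invariant_idealD(2)[OF J C'] by (simp add: leaves_invariant_def)
      then show "?v \<in> J"
        using invariant_ideal_\<delta>[OF J B] by (simp add: leaves_invariant_def)
      show "0 \<le> ?v"
        by (rule positive_opD[OF \<delta>_pos[OF B] positive_opD[OF S_pos[OF C'] z_nonneg]])
    qed
    have "blinfun_apply C \<bar>?v\<bar> \<in> small_cone J J0 R" if C: "C \<in> S" for C
    proof -
      define X where "X = C o\<^sub>L \<delta> B o\<^sub>L C'"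
      have X: "leaves_invariant X J" "leaves_invariant X J0" "positive_op X"
        unfolding X_def
        by (rule leaves_invariant_compose leaves_invariant_compose[OF invariant_idealD(2)[OF _ C] invariant_ideal_\<delta>[OF _ B]]
            invariant_idealD(2)[OF _ C'] positive_op_compose positive_op_compose[OF S_pos[OF C] \<delta>_pos[OF B]] S_pos[OF C'] J J0)+
      define M where "M = C o\<^sub>L B o\<^sub>L C'"
      have M: "M \<in> S" unfolding M_def by (intro compose_mem C B C')
      let ?d = "\<lambda>k. infdist (blinfun_apply (R k) (y k)) J0"
      let ?u = "\<lambda>k. (1 / ?d k) *\<^sub>R blinfun_apply (R k) (y k)"
      have d: "0 < ?d k" for k using y_attains[of k] g[of k] by linarith
      have u: "?u k \<in> J" for k
        using R_inv(1)[of k] y_mem[of k] subspace_scale[OF closed_idealD(2)[OF ideal]]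
        by (simp add: leaves_invariant_def)
      have bound: "infdist (blinfun_apply (R k) (blinfun_apply X z)) J0 / qnorm (R k)
          \<le> 4 * norm M * (1 / qnorm (R k)) + qnorm X * infdist (z - ?u k) J0" for k
      proof -
        let ?Ry = "blinfun_apply (R k) (y k)"
        have Ry: "0 \<le> ?Ry" by (rule positive_opD[OF R_pos y_nonneg])
        have "infdist (blinfun_apply (R k) (blinfun_apply X ?Ry)) J0
            \<le> infdist (blinfun_apply (R k) (blinfun_apply (\<delta> M) ?Ry)) J0"
        proof (rule infdist_ideal_mono[OF ideal0])
          have "blinfun_apply X ?Ry \<le> blinfun_apply (\<delta> M) ?Ry"
            using \<delta>_sandwich_le[OF C B C' Ry] by (simp add: X_def M_def)
          then have "blinfun_apply (R k) (blinfun_apply X ?Ry) \<le> blinfun_apply (R k) (blinfun_apply (\<delta> M) ?Ry)"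
            by (rule positive_op_mono[OF R_pos])
          moreover have "0 \<le> blinfun_apply (R k) (blinfun_apply X ?Ry)"
            by (rule positive_opD[OF R_pos positive_opD[OF X(3) Ry]])
          ultimately show "\<bar>blinfun_apply (R k) (blinfun_apply X ?Ry)\<bar> \<le> \<bar>blinfun_apply (R k) (blinfun_apply (\<delta> M) ?Ry)\<bar>"
            using order_trans[OF _ abs_ge_self] by (simp add: abs_of_nonneg)
        qed
        also have "\<dots> \<le> 2 * norm M * qnorm (R k)"
          by (rule resolvent_sandwich[OF seq J J0 M])
        finally have 1: "infdist (blinfun_apply (R k) (blinfun_apply X ?Ry)) J0 \<le> 2 * norm M * qnorm (R k)" .
        have "infdist (blinfun_apply (R k) (blinfun_apply X (?u k))) J0
            = (1 / ?d k) * infdist (blinfun_apply (R k) (blinfun_apply X ?Ry)) J0"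
          using d[of k] by (simp add: blinfun.scaleR_right infdist_subspace_scaleR[OF sub0])
        also have "\<dots> \<le> (1 / ?d k) * (2 * norm M * qnorm (R k))"
          using d[of k] 1 by (intro mult_left_mono) auto
        also have "\<dots> \<le> (1 / ?d k) * (2 * norm M * (2 * ?d k))"
          using d[of k] y_attains[of k] by (intro mult_left_mono) auto
        also have "\<dots> = 4 * norm M" using d[of k] by simp
        finally have 2: "infdist (blinfun_apply (R k) (blinfun_apply X (?u k))) J0 \<le> 4 * norm M" .
        have zu: "z - ?u k \<in> J" by (rule subspace_diff[OF closed_idealD(2)[OF ideal] z_mem u])
        have "blinfun_apply X (z - ?u k) \<in> J" using zu X(1) by (simp add: leaves_invariant_def)
        then have "infdist (blinfun_apply (R k) (blinfun_apply X (z - ?u k))) J0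
            \<le> qnorm (R k) * infdist (blinfun_apply X (z - ?u k)) J0"
          by (rule infdist_le_qnorm_mult[OF _ R_inv(2)])
        also have "\<dots> \<le> qnorm (R k) * (qnorm X * infdist (z - ?u k) J0)"
          by (intro mult_left_mono infdist_le_qnorm_mult zu X(2) qnorm_nonneg)
        finally have 3: "infdist (blinfun_apply (R k) (blinfun_apply X (z - ?u k))) J0
            \<le> qnorm (R k) * (qnorm X * infdist (z - ?u k) J0)" .
        have "blinfun_apply (R k) (blinfun_apply X z)
            = blinfun_apply (R k) (blinfun_apply X (?u k)) + blinfun_apply (R k) (blinfun_apply X (z - ?u k))"
          by (simp add: blinfun.diff_right)
        then have "infdist (blinfun_apply (R k) (blinfun_apply X z)) J0 \<le> 4 * norm M + qnorm (R k) * (qnorm X * infdist (z - ?u k) J0)"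
          using infdist_subspace_add[OF sub0, of "blinfun_apply (R k) (blinfun_apply X (?u k))"
              "blinfun_apply (R k) (blinfun_apply X (z - ?u k))"] 2 3 by simp
        then have "infdist (blinfun_apply (R k) (blinfun_apply X z)) J0 / qnorm (R k)
            \<le> (4 * norm M + qnorm (R k) * (qnorm X * infdist (z - ?u k) J0)) / qnorm (R k)"
          using g[of k] by (intro divide_right_mono) auto
        then show ?thesis using g[of k] by (simp add: add_divide_distrib)
      qed
      have "(\<lambda>k. 4 * norm M * (1 / qnorm (R k)) + qnorm X * infdist (z - ?u k) J0) \<longlonglongrightarrow> 4 * norm M * 0 + qnorm X * 0"
        using tendsto_inverse_0_at_top[OF norm_lim]
        by (intro tendsto_add tendsto_mult tendsto_const z_lim) (simp add: inverse_eq_divide)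
      then have lim0: "(\<lambda>k. 4 * norm M * (1 / qnorm (R k)) + qnorm X * infdist (z - ?u k) J0) \<longlonglongrightarrow> 0" by simp
      have "(\<lambda>k. infdist (blinfun_apply (R k) (blinfun_apply X z)) J0 / qnorm (R k)) \<longlonglongrightarrow> 0"
      proof (rule tendsto_sandwich[OF _ _ tendsto_const lim0])
        show "\<forall>\<^sub>F k in sequentially. 0 \<le> infdist (blinfun_apply (R k) (blinfun_apply X z)) J0 / qnorm (R k)"
          by (intro always_eventually allI divide_nonneg_nonneg infdist_nonneg qnorm_nonneg)
        show "\<forall>\<^sub>F k in sequentially. infdist (blinfun_apply (R k) (blinfun_apply X z)) J0 / qnorm (R k)
            \<le> 4 * norm M * (1 / qnorm (R k)) + qnorm X * infdist (z - ?u k) J0"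
          using bound by (intro always_eventually allI)
      qed
      moreover have "blinfun_apply C \<bar>?v\<bar> = blinfun_apply X z"
        using v(2) by (simp add: X_def)
      moreover have "blinfun_apply X z \<in> J" "0 \<le> blinfun_apply X z"
        using X(1) z_mem positive_opD[OF X(3) z_nonneg] by (auto simp: leaves_invariant_def)
      ultimately show ?thesis by (simp add: small_cone_def)
    qed
    then have "?v \<in> N" using v(1) by (simp add: N_def invariant_core_def)
    then show ?thesis using \<open>N = J0\<close> by simp
  qed
  define Q where "Q = {x. 0 \<le> x \<and> blinfun_apply (\<delta> B) x \<in> J0}"
  define N' where "N' = invariant_core J Q"
  have "invariant_ideal N'"
    unfolding N'_def
  proof (rule invariant_ideal_core[OF J])
    have "closed (blinfun_apply (\<delta> B) -` J0)"
      using closed_idealD(1)[OF ideal0]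
      by (intro closed_vimage blinfun.continuous_on continuous_on_const continuous_on_id)
    moreover have "Q = {x. 0 \<le> x} \<inter> blinfun_apply (\<delta> B) -` J0" by (auto simp: Q_def)
    ultimately show "closed Q" by (simp add: closed_Int closed_nonneg)
    show "0 \<in> Q" using closed_idealD(6)[OF ideal0] by (simp add: Q_def blinfun.zero_right)
    show "x + y \<in> Q" if "x \<in> Q" "y \<in> Q" for x y
      using that subspace_add[OF sub0] by (simp add: Q_def blinfun.add_right)
    show "c *\<^sub>R x \<in> Q" if "x \<in> Q" "0 \<le> c" for x c
      using that subspace_scale[OF sub0] by (simp add: Q_def blinfun.scaleR_right scaleR_nonneg_nonneg)
    show "y \<in> Q" if x: "x \<in> Q" and y: "0 \<le> y" "y \<le> x" for x y
    proof -
      have "blinfun_apply (\<delta> B) y \<in> J0"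
      proof (rule closed_idealD(8)[OF ideal0 _ positive_opD[OF \<delta>_pos[OF B] y(1)] positive_op_mono[OF \<delta>_pos[OF B] y(2)]])
        show "blinfun_apply (\<delta> B) x \<in> J0" using x by (simp add: Q_def)
      qed
      then show ?thesis using y(1) by (simp add: Q_def)
    qed
  qed
  moreover have "J0 \<subseteq> N'"
  proof
    fix x assume x: "x \<in> J0"
    have "blinfun_apply C \<bar>x\<bar> \<in> Q" if C: "C \<in> S" for C
      using closed_idealD(4)[OF ideal0 x] invariant_idealD(2)[OF J0 C] invariant_ideal_\<delta>[OF J0 B]
        positive_opD[OF S_pos[OF C] abs_ge_zero]
      by (simp add: Q_def leaves_invariant_def)
    then show "x \<in> N'" using x sub by (auto simp: N'_def invariant_core_def)
  qed
  moreover have "N' \<subseteq> J" by (auto simp: N'_def invariant_core_def)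
  ultimately have "N' = J0 \<or> N' = J" by (rule irreducible)
  moreover have "z \<in> N'"
    using in_J0 z_mem z_nonneg positive_opD[OF S_pos z_nonneg]
    by (simp add: N'_def invariant_core_def Q_def)
  moreover have "z \<notin> J0" using z_infdist by auto
  ultimately have "x \<in> N'" using x by blast
  then have "blinfun_apply id_blinfun \<bar>x\<bar> \<in> Q"
    unfolding N'_def invariant_core_def using id_mem by blast
  then have "blinfun_apply (\<delta> B) \<bar>x\<bar> \<in> J0"
    by (simp add: Q_def)
  moreover have "\<bar>blinfun_apply (\<delta> B) x\<bar> \<le> \<bar>blinfun_apply (\<delta> B) \<bar>x\<bar>\<bar>"
    by (rule order_trans[OF positive_op_abs[OF \<delta>_pos[OF B]] abs_ge_self])
  ultimately show ?thesis by (rule closed_idealD(3)[OF ideal0])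
qed

lemma \<delta>_le:
  assumes "M \<in> S" "0 \<le> x"
  shows "s = 1 \<Longrightarrow> blinfun_apply M (blinfun_apply A x) \<le> blinfun_apply A (blinfun_apply M x)"
    and "s = - 1 \<Longrightarrow> blinfun_apply A (blinfun_apply M x) \<le> blinfun_apply M (blinfun_apply A x)"
  using positive_opD[OF \<delta>_pos[OF assms(1)] assms(2)] unfolding \<delta>_apply by simp_all

lemma power_mem: "M \<in> S \<Longrightarrow> op_power M n \<in> S"
  by (induction n) (simp_all add: id_mem compose_mem)

text \<open>For \<open>s = 1\<close>, moving \<open>A\<close> to the left past an element of \<open>S\<close> increases a product, and \<open>\<delta> B \<le>
  A B\<close>; hence \<open>(C (\<delta> B))\<^sup>n \<le> (C A B)\<^sup>n \<le> A\<^sup>n (C B)\<^sup>n\<close>. For \<open>s = -1\<close>, \<open>A\<close> moves to the right, and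
  \<open>(C (\<delta> B))\<^sup>n \<le> (C B A)\<^sup>n \<le> (C B)\<^sup>n A\<^sup>n\<close>.\<close>

lemma quot_norm_power_le:
  assumes J: "invariant_ideal J" and J0: "invariant_ideal J0" and sub: "J0 \<subseteq> J"
    and C: "C \<in> S" and B: "B \<in> S"
  shows "quot_norm J J0 (op_power (C o\<^sub>L \<delta> B) n) \<le> quot_norm J J0 (op_power A n) * norm (C o\<^sub>L B) ^ n"
proof -
  interpret quotient J J0
    using invariant_idealD(1)[OF J] invariant_idealD(1)[OF J0] sub by unfold_locales
  define K where "K = C o\<^sub>L \<delta> B"
  define L where "L = C o\<^sub>L B"
  have L: "L \<in> S" unfolding L_def by (rule compose_mem[OF C B])
  have K_pos: "positive_op K"
    unfolding K_def by (rule positive_op_compose[OF S_pos[OF C] \<delta>_pos[OF B]])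
  note pw_inv = leaves_invariant_op_power[OF invariant_idealD(2)[OF J L]] leaves_invariant_op_power[OF invariant_idealD(2)[OF J0 L]]
    leaves_invariant_op_power[OF invariant_idealD(2)[OF J A_mem]] leaves_invariant_op_power[OF invariant_idealD(2)[OF J0 A_mem]]
  have L_norm: "qnorm (op_power L n) \<le> norm L ^ n"
    using qnorm_le_norm norm_op_power_le by (rule order_trans)
  note mono_C = positive_op_mono[OF S_pos[OF C]] and mono_B = positive_op_mono[OF S_pos[OF B]]
    and mono_A = positive_op_mono[OF A_pos]
  have nonneg: "0 \<le> blinfun_apply (op_power M i) x" if "M \<in> S" "0 \<le> x" for M i x
    by (rule positive_opD[OF S_pos[OF power_mem[OF that(1)]] that(2)])
  from s have "qnorm (op_power K n) \<le> qnorm (op_power A n) * norm L ^ n"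
  proof
    assume s1: "s = 1"
    have move: "blinfun_apply M (blinfun_apply (op_power A i) x) \<le> blinfun_apply (op_power A i) (blinfun_apply M x)"
      if M: "M \<in> S" and x: "0 \<le> x" for M i x
    proof (induction i)
      case (Suc i)
      have "blinfun_apply M (blinfun_apply A (blinfun_apply (op_power A i) x))
          \<le> blinfun_apply A (blinfun_apply M (blinfun_apply (op_power A i) x))"
        by (rule \<delta>_le(1)[OF M nonneg[OF A_mem x] s1])
      also have "\<dots> \<le> blinfun_apply A (blinfun_apply (op_power A i) (blinfun_apply M x))"
        by (rule mono_A[OF Suc.IH])
      finally show ?case by simp
    qed simp
    have K_le: "blinfun_apply K x \<le> blinfun_apply C (blinfun_apply A (blinfun_apply B x))" if x: "0 \<le> x" for x
    proof -
      have "blinfun_apply (\<delta> B) x \<le> blinfun_apply A (blinfun_apply B x)"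
        unfolding \<delta>_apply using positive_opD[OF S_pos[OF B] positive_opD[OF A_pos x]] s1 by simp
      then show ?thesis unfolding K_def by (simp add: mono_C)
    qed
    have le: "blinfun_apply (op_power K i) x \<le> blinfun_apply (op_power A i) (blinfun_apply (op_power L i) x)"
      if x: "0 \<le> x" for i x
    proof (induction i)
      case (Suc i)
      let ?v = "blinfun_apply (op_power L i) x"
      have v: "0 \<le> ?v" by (rule nonneg[OF L x])
      have "blinfun_apply (op_power K (Suc i)) x \<le> blinfun_apply K (blinfun_apply (op_power A i) ?v)"
        using positive_op_mono[OF K_pos Suc.IH] by simp
      also have "\<dots> \<le> blinfun_apply C (blinfun_apply A (blinfun_apply B (blinfun_apply (op_power A i) ?v)))"
        by (rule K_le[OF nonneg[OF A_mem v]])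
      also have "\<dots> \<le> blinfun_apply C (blinfun_apply A (blinfun_apply (op_power A i) (blinfun_apply B ?v)))"
        by (intro mono_C mono_A move[OF B v])
      also have "\<dots> = blinfun_apply C (blinfun_apply (op_power A (Suc i)) (blinfun_apply B ?v))" by simp
      also have "\<dots> \<le> blinfun_apply (op_power A (Suc i)) (blinfun_apply C (blinfun_apply B ?v))"
        by (rule move[OF C positive_opD[OF S_pos[OF B] v]])
      finally show ?case by (simp add: L_def)
    qed simp
    have "qnorm (op_power K n) \<le> qnorm (op_power A n o\<^sub>L op_power L n)"
      using le by (intro qnorm_mono positive_op_power K_pos) simp
    also have "\<dots> \<le> qnorm (op_power A n) * qnorm (op_power L n)"
      by (intro qnorm_compose pw_inv)
    also have "\<dots> \<le> qnorm (op_power A n) * norm L ^ n"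
      by (intro mult_left_mono L_norm qnorm_nonneg)
    finally show ?thesis .
  next
    assume s1: "s = - 1"
    have move: "blinfun_apply A (blinfun_apply M x) \<le> blinfun_apply M (blinfun_apply A x)"
      if M: "M \<in> S" and x: "0 \<le> x" for M x
      by (rule \<delta>_le(2)[OF M x s1])
    have K_le: "blinfun_apply K x \<le> blinfun_apply L (blinfun_apply A x)" if x: "0 \<le> x" for x
    proof -
      have "blinfun_apply (\<delta> B) x \<le> blinfun_apply B (blinfun_apply A x)"
        unfolding \<delta>_apply using positive_opD[OF A_pos positive_opD[OF S_pos[OF B] x]] s1 by simp
      then show ?thesis unfolding K_def L_def by (simp add: mono_C)
    qed
    have le: "blinfun_apply (op_power K i) x \<le> blinfun_apply (op_power L i) (blinfun_apply (op_power A i) x)"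
      if x: "0 \<le> x" for i x
    proof (induction i)
      case (Suc i)
      let ?v = "blinfun_apply (op_power A i) x"
      have v: "0 \<le> ?v" by (rule nonneg[OF A_mem x])
      have "blinfun_apply (op_power K (Suc i)) x \<le> blinfun_apply K (blinfun_apply (op_power L i) ?v)"
        using positive_op_mono[OF K_pos Suc.IH] by simp
      also have "\<dots> \<le> blinfun_apply L (blinfun_apply A (blinfun_apply (op_power L i) ?v))"
        by (rule K_le[OF nonneg[OF L v]])
      also have "\<dots> \<le> blinfun_apply L (blinfun_apply (op_power L i) (blinfun_apply A ?v))"
        by (rule positive_op_mono[OF S_pos[OF L] move[OF power_mem[OF L] v]])
      finally show ?case by simp
    qed simp
    have "qnorm (op_power K n) \<le> qnorm (op_power L n o\<^sub>L op_power A n)"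
      using le by (intro qnorm_mono positive_op_power K_pos) simp
    also have "\<dots> \<le> qnorm (op_power L n) * qnorm (op_power A n)"
      by (intro qnorm_compose pw_inv)
    also have "\<dots> \<le> norm L ^ n * qnorm (op_power A n)"
      by (intro mult_right_mono L_norm qnorm_nonneg)
    finally show ?thesis by (simp add: mult.commute)
  qed
  then show ?thesis by (simp add: K_def L_def)
qed

lemma invariant_ideal_UNIV: "invariant_ideal UNIV"
  by (simp add: invariant_ideal_def closed_ideal_UNIV leaves_invariant_def)

lemma invariant_ideal_zero: "invariant_ideal {0}"
  by (simp add: invariant_ideal_def closed_ideal_zero leaves_invariant_def blinfun.zero_right)

lemma eigenvector_exists:
  assumes K: "positive_op K" "compact_op K" and J: "closed_ideal J" "leaves_invariant K J"
    and pos: "0 < spec_rad J {0} K"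
  shows "\<exists>u\<in>J. 0 \<le> u \<and> norm u = 1 \<and> blinfun_apply K u = spec_rad J {0} K *\<^sub>R u"
proof -
  interpret quotient J "{0}"
    using J closed_ideal_zero closed_idealD(6)[OF J(1)] by unfold_locales auto
  have K0: "leaves_invariant K {0}" by (simp add: leaves_invariant_def blinfun.zero_right)
  obtain t n y w z where seq: "peripheral_sequence J {0} K t n y w z"
    and eig: "blinfun_apply K z - spec_rad J {0} K *\<^sub>R z \<in> {0}"
    by (rule peripheral_sequence_exists[OF K J(2) K0 pos])
  interpret peripheral_sequence J "{0}" K t n y w z by (rule seq)
  show ?thesis
    using z_mem z_nonneg z_infdist eig by (intro bexI[of _ z]) auto
qed

text \<open>Compactness makes the set of normalized positive eigenvectors at a fixed nonzero
  eigenvalue compact, so a chain of invariant ideals meeting it has an intersection meeting it.\<close>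

lemma minimal_invariant_ideal:
  assumes K: "compact_op K" and l: "0 < l"
    and u: "0 \<le> u" "norm u = 1" "blinfun_apply K u = l *\<^sub>R u"
  defines "F \<equiv> {u. 0 \<le> u \<and> norm u = 1 \<and> blinfun_apply K u = l *\<^sub>R u}"
  obtains J where "invariant_ideal J" "J \<inter> F \<noteq> {}"
    "\<And>N. invariant_ideal N \<Longrightarrow> N \<inter> F \<noteq> {} \<Longrightarrow> N \<subseteq> J \<Longrightarrow> N = J"
proof -
  have "closed F"
  proof -
     have "closed {u :: 'a. norm u = 1}" "closed {u. blinfun_apply K u = l *\<^sub>R u}"
      by (intro closed_Collect_eq continuous_intros)+
    moreover have "F = {u. 0 \<le> u} \<inter> ({u. norm u = 1} \<inter> {u. blinfun_apply K u = l *\<^sub>R u})"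
      by (auto simp: F_def)
    ultimately show ?thesis by (simp add: closed_nonneg closed_Int)
  qed
  have "compact F"
  proof -
    have "compact ((\<lambda>x. (1 / l) *\<^sub>R x) ` closure (blinfun_apply K ` cball 0 1))"
      using K by (intro compact_scaling) (simp add: compact_op_def)
    moreover have "F \<subseteq> (\<lambda>x. (1 / l) *\<^sub>R x) ` closure (blinfun_apply K ` cball 0 1)"
    proof
      fix v assume v: "v \<in> F"
      then have "v = (1 / l) *\<^sub>R blinfun_apply K v"
        using l by (simp add: F_def)
      moreover have "blinfun_apply K v \<in> closure (blinfun_apply K ` cball 0 1)"
        using v by (intro closure_subset[THEN subsetD] imageI) (simp add: F_def)
      ultimately show "v \<in> (\<lambda>x. (1 / l) *\<^sub>R x) ` closure (blinfun_apply K ` cball 0 1)"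
        by (rule image_eqI)
    qed
    ultimately show ?thesis
      using compact_Int_closed[OF _ \<open>closed F\<close>, of "(\<lambda>x. (1 / l) *\<^sub>R x) ` closure (blinfun_apply K ` cball 0 1)"]
      by (simp add: inf.absorb2)
  qed
  define \<F> where "\<F> = {J. invariant_ideal J \<and> J \<inter> F \<noteq> {}}"
  \<comment> \<open>Passing to complements turns the minimal element into a maximal one.\<close>
  have "\<exists>M\<in>uminus ` \<F>. \<forall>X\<in>uminus ` \<F>. M \<subseteq> X \<longrightarrow> X = M"
  proof (rule subset_Zorn_nonempty)
    have "UNIV \<in> \<F>" using u invariant_ideal_UNIV by (auto simp: \<F>_def F_def)
    then show "uminus ` \<F> \<noteq> {}" by blast
    fix \<C> assume ne: "\<C> \<noteq> {}" and chain: "subset.chain (uminus ` \<F>) \<C>"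
    define \<D> where "\<D> = uminus ` \<C>"
    have \<D>: "\<D> \<subseteq> \<F>" "\<Union>\<C> = - \<Inter>\<D>"
    proof -
      have "\<C> \<subseteq> uminus ` \<F>" using chain by (simp add: subset_chain_def)
      then have "\<D> \<subseteq> uminus ` uminus ` \<F>" unfolding \<D>_def by (rule image_mono)
      then show "\<D> \<subseteq> \<F>" by (simp add: image_image)
      show "\<Union>\<C> = - \<Inter>\<D>" unfolding \<D>_def by blast
    qed
    have "invariant_ideal (\<Inter>\<D>)"
      unfolding invariant_ideal_def
    proof (intro conjI ballI)
      have \<D>_inv: "invariant_ideal N" if "N \<in> \<D>" for N using that \<D>(1) by (auto simp: \<F>_def)
      show "closed_ideal (\<Inter>\<D>)"
        by (rule closed_ideal_Inter) (rule invariant_idealD(1)[OF \<D>_inv])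
      show "leaves_invariant M (\<Inter>\<D>)" if "M \<in> S" for M
        using invariant_idealD(2)[OF \<D>_inv that] by (simp add: leaves_invariant_def)
    qed
    moreover have "F \<inter> \<Inter>\<D> \<noteq> {}"
    proof (rule compact_imp_fip[OF \<open>compact F\<close>])
      show "closed T" if "T \<in> \<D>" for T
      proof -
        have "invariant_ideal T" using that \<D>(1) by (auto simp: \<F>_def)
        then show ?thesis by (rule closed_idealD(1)[OF invariant_idealD(1)])
      qed
      fix \<E> assume \<E>: "finite \<E>" "\<E> \<subseteq> \<D>"
      show "F \<inter> \<Inter>\<E> \<noteq> {}"
      proof (cases "\<E> = {}")
        case True
        then show ?thesis using u by (auto simp: F_def)
      next
        case False
        have "\<Inter>\<E> \<in> \<E>"
        proof (rule Inter_in_chain[OF \<E>(1) False])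
          show "subset.chain \<D> \<E>"
            unfolding subset_chain_def
          proof (intro conjI ballI)
            fix X Y assume "X \<in> \<E>" "Y \<in> \<E>"
            then have "- X \<in> \<C>" "- Y \<in> \<C>"
              using \<E>(2) by (auto simp: \<D>_def)
            then have "- X \<subseteq> - Y \<or> - Y \<subseteq> - X"
              using chain[unfolded subset_chain_def, THEN conjunct2] by (metis (no_types))
            then show "X \<subseteq> Y \<or> Y \<subseteq> X" by blast
          qed (rule \<E>(2))
        qed
        then show ?thesis using \<E>(2) \<D>(1) by (auto simp: \<F>_def)
      qed
    qed
    ultimately show "\<Union>\<C> \<in> uminus ` \<F>"
      unfolding \<D>(2) by (intro imageI) (simp add: \<F>_def Int_commute)
  qed
  then obtain J where J: "J \<in> \<F>" "\<forall>X\<in>uminus ` \<F>. - J \<subseteq> X \<longrightarrow> X = - J"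
    by (rule bexE) (erule imageE, simp)
  show ?thesis
  proof (rule that[of J])
    show "invariant_ideal J" "J \<inter> F \<noteq> {}" using J(1) by (auto simp: \<F>_def)
    show "N = J" if "invariant_ideal N" "N \<inter> F \<noteq> {}" "N \<subseteq> J" for N
      using J(2)[rule_format, of "- N"] that by (simp add: \<F>_def)
  qed
qed

text \<open>Suppose that the spectral radius \<open>\<lambda>\<close> of \<open>K = C (\<delta> B)\<close> is positive. In a minimal invariant
  ideal \<open>J\<close> carrying an eigenvector \<open>u\<close> at \<open>\<lambda>\<close>, the vectors on which the resolvents of \<open>K\<close> near
  \<open>\<lambda>\<close> are of smaller order than on \<open>J\<close> form a largest proper invariant ideal \<open>J0\<close>: on a smaller
  invariant ideal \<open>\<lambda>\<close> is no eigenvalue, so the resolvents remain bounded there. Thus \<open>J / J0\<close> is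
  irreducible, and \<open>u\<close> is not in \<open>J0\<close>. By the estimate of the powers of \<open>K\<close>, \<open>A\<close> has positive
  spectral radius on \<open>J / J0\<close>; hence \<open>\<delta> B\<close> vanishes there, contrary to \<open>K u = \<lambda> u\<close>.\<close>

lemma spec_rad_commutator_zero:
  assumes C: "C \<in> S" and B: "B \<in> S"
  shows "spec_rad UNIV {0} (C o\<^sub>L \<delta> B) = 0"
proof (rule ccontr)
  define K where "K = C o\<^sub>L \<delta> B"
  define l where "l = spec_rad UNIV {0} K"
  interpret U: quotient UNIV "{0} :: 'a set"
    by unfold_locales (auto simp: closed_ideal_UNIV closed_ideal_zero)
  assume "spec_rad UNIV {0} (C o\<^sub>L \<delta> B) \<noteq> 0"
  then have l: "0 < l" using U.spec_rad_nonneg[of K] by (simp add: l_def K_def)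
  have K: "positive_op K" "compact_op K"
    unfolding K_def by (rule positive_op_compose[OF S_pos[OF C] \<delta>_pos[OF B]], rule compact_op_compose_left[OF \<delta>_compact])
  have K_inv: "leaves_invariant K J" if "invariant_ideal J" for J
    unfolding K_def by (rule leaves_invariant_compose[OF invariant_idealD(2)[OF that C] invariant_ideal_\<delta>[OF that B]])
  define F where "F = {u. 0 \<le> u \<and> norm u = 1 \<and> blinfun_apply K u = l *\<^sub>R u}"
  obtain u0 where u0: "0 \<le> u0" "norm u0 = 1" "blinfun_apply K u0 = l *\<^sub>R u0"
    using eigenvector_exists[OF K closed_ideal_UNIV K_inv[OF invariant_ideal_UNIV]] l by (auto simp: l_def)
  obtain J where J: "invariant_ideal J" and JF: "J \<inter> F \<noteq> {}"
    and minimal: "\<And>N. invariant_ideal N \<Longrightarrow> N \<inter> F \<noteq> {} \<Longrightarrow> N \<subseteq> J \<Longrightarrow> N = J"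
    using minimal_invariant_ideal[OF K(2) l u0, folded F_def] by metis
  obtain u where u: "u \<in> J" "u \<in> F" using JF by blast
  have u': "norm u = 1" "blinfun_apply K u = l *\<^sub>R u" using u(2) by (auto simp: F_def)
  have pow_u: "blinfun_apply (op_power K n) u = l ^ n *\<^sub>R u" for n
    by (induction n) (simp_all add: blinfun.scaleR_right u'(2) mult.commute)
  have zero_sub: "{0} \<subseteq> N" if "invariant_ideal N" for N
    using closed_idealD(6)[OF invariant_idealD(1)[OF that]] by simp
  interpret q0: quotient J "{0}"
    using invariant_idealD(1)[OF J] closed_ideal_zero zero_sub[OF J] by unfold_locales
  \<comment> \<open>The resolvents of \<open>K\<close> on \<open>J\<close> are taken near the same \<open>l\<close> as on the whole space.\<close>
  have rad_J: "spec_rad J {0} K = l"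
  proof (rule antisym)
    show "spec_rad J {0} K \<le> l"
      unfolding l_def by (rule spec_rad_mono[OF closed_ideal_UNIV invariant_idealD(1)[OF J] subset_UNIV closed_ideal_zero zero_sub[OF J]])
    show "l \<le> spec_rad J {0} K"
    proof (rule q0.le_spec_radI)
      fix n :: nat
      have "l ^ n = infdist (blinfun_apply (op_power K n) u) {0}"
        using l u'(1) by (simp add: pow_u)
      also have "\<dots> \<le> quot_norm J {0} (op_power K n)"
        using u(1) u'(1) by (intro q0.infdist_le_qnorm) auto
      finally show "l ^ n \<le> quot_norm J {0} (op_power K n)" .
    qed (use l in simp)
  qed
  have zero_inv: "leaves_invariant K {0}" by (rule K_inv[OF invariant_ideal_zero])
  have rad_J_pos: "0 < spec_rad J {0} K" using l rad_J by simp
  obtain t n y w z where seq: "peripheral_sequence J {0} K t n y w z"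
    and "blinfun_apply K z - spec_rad J {0} K *\<^sub>R z \<in> {0}"
    by (rule q0.peripheral_sequence_exists[OF K K_inv[OF J] zero_inv rad_J_pos])
  interpret ps: peripheral_sequence J "{0}" K t n y w z by (rule seq)
  define J0 where "J0 = invariant_core J (small_cone J {0} ps.R)"
  have J0: "invariant_ideal J0" "J0 \<subseteq> J" "J0 \<noteq> J"
    using small_core[OF seq J invariant_ideal_zero] by (simp_all add: J0_def)
  have not_F: "u \<notin> J0"
    using minimal[OF J0(1) _ J0(2)] J0(3) u(2) by blast
  have irreducible: "N = J0 \<or> N = J" if N: "invariant_ideal N" "J0 \<subseteq> N" "N \<subseteq> J" for N
  proof (cases "N \<inter> F = {}")
    case False
    then show ?thesis using minimal N by blast
  next
    case True
    interpret qN: quotient N "{0}"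
      using invariant_idealD(1)[OF N(1)] closed_ideal_zero zero_sub[OF N(1)] by unfold_locales
    have le: "spec_rad N {0} K \<le> l"
      using spec_rad_mono[OF invariant_idealD(1)[OF J] invariant_idealD(1)[OF N(1)] N(3) closed_ideal_zero zero_sub[OF N(1)], of K]
      by (simp add: rad_J)
    have "spec_rad N {0} K \<noteq> l"
    proof
      assume eq: "spec_rad N {0} K = l"
      then have "\<exists>v\<in>N. 0 \<le> v \<and> norm v = 1 \<and> blinfun_apply K v = l *\<^sub>R v"
        using eigenvector_exists[OF K invariant_idealD(1)[OF N(1)] K_inv[OF N(1)]] l by simp
      then show False using True by (auto simp: F_def)
    qed
    then have "spec_rad N {0} K < l" using le by simp
    then obtain c where c: "\<And>t n. l \<le> t \<Longrightarrow> quot_norm N {0} (neumann_sum K t n) \<le> c"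
      using qN.neumann_sum_bounded[OF K(1) K_inv[OF N(1)] zero_inv] by blast
    have "N \<subseteq> J0"
    proof
      fix x assume x: "x \<in> N"
      have "blinfun_apply M \<bar>x\<bar> \<in> small_cone J {0} ps.R" if M: "M \<in> S" for M
      proof -
        let ?v = "blinfun_apply M \<bar>x\<bar>"
        have v: "?v \<in> N"
          using closed_idealD(4)[OF invariant_idealD(1)[OF N(1)] x] invariant_idealD(2)[OF N(1) M]
          by (simp add: leaves_invariant_def)
        have le: "infdist (blinfun_apply (ps.R k) ?v) {0} / quot_norm J {0} (ps.R k)
            \<le> (c * norm ?v) * (1 / quot_norm J {0} (ps.R k))" for k
        proof -
          have "infdist (blinfun_apply (ps.R k) ?v) {0} \<le> quot_norm N {0} (ps.R k) * norm ?v"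
            by (rule qN.infdist_le_qnorm_mult_norm[OF v])
          also have "\<dots> \<le> c * norm ?v"
            using ps.t_gt[of k] rad_J by (intro mult_right_mono c) auto
          finally show ?thesis
            using ps.norm_ge_1[of k] by (simp add: divide_right_mono)
        qed
        have "(\<lambda>k. (c * norm ?v) * (1 / quot_norm J {0} (ps.R k))) \<longlonglongrightarrow> (c * norm ?v) * 0"
          using tendsto_inverse_0_at_top[OF ps.norm_lim]
          by (intro tendsto_mult tendsto_const) (simp add: inverse_eq_divide)
        then have lim: "(\<lambda>k. (c * norm ?v) * (1 / quot_norm J {0} (ps.R k))) \<longlonglongrightarrow> 0" by simp
        have "(\<lambda>k. infdist (blinfun_apply (ps.R k) ?v) {0} / quot_norm J {0} (ps.R k)) \<longlonglongrightarrow> 0"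
        proof (rule tendsto_sandwich[OF _ _ tendsto_const lim])
          show "\<forall>\<^sub>F k in sequentially. 0 \<le> infdist (blinfun_apply (ps.R k) ?v) {0} / quot_norm J {0} (ps.R k)"
            by (intro always_eventually allI divide_nonneg_nonneg infdist_nonneg q0.qnorm_nonneg)
          show "\<forall>\<^sub>F k in sequentially. infdist (blinfun_apply (ps.R k) ?v) {0} / quot_norm J {0} (ps.R k)
              \<le> (c * norm ?v) * (1 / quot_norm J {0} (ps.R k))"
            using le by (intro always_eventually allI)
        qed
        then show ?thesis
          using v N(3) positive_opD[OF S_pos[OF M] abs_ge_zero[of x]] by (auto simp: small_cone_def)
      qed
      then show "x \<in> J0"
        using x N(3) by (auto simp: J0_def invariant_core_def)
    qed
    then show ?thesis using N(2) by blast
  qed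
  interpret q: quotient J J0
    using invariant_idealD(1)[OF J] invariant_idealD(1)[OF J0(1)] J0(2) by unfold_locales
  define a where "a = norm (C o\<^sub>L B)"
  have p_u: "0 < infdist u J0"
    using not_F closed_idealD[OF invariant_idealD(1)[OF J0(1)]] infdist_pos_not_in_closed by blast
  have pow: "l ^ n \<le> quot_norm J J0 (op_power A n) * a ^ n" for n
  proof -
    have "l ^ n * infdist u J0 = infdist (blinfun_apply (op_power K n) u) J0"
      using l by (simp add: pow_u infdist_subspace_scaleR[OF q.sub0])
    also have "\<dots> \<le> quot_norm J J0 (op_power K n) * infdist u J0"
      by (rule q.infdist_le_qnorm_mult[OF u(1) leaves_invariant_op_power[OF K_inv[OF J0(1)]]])
    finally have "l ^ n \<le> quot_norm J J0 (op_power K n)" using p_u by simp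
    also have "\<dots> \<le> quot_norm J J0 (op_power A n) * a ^ n"
      unfolding K_def a_def by (rule quot_norm_power_le[OF J J0(1) J0(2) C B])
    finally show ?thesis .
  qed
  have a: "0 < a"
  proof (rule ccontr)
    assume "\<not> 0 < a"
    then have "a = 0" by (simp add: a_def)
    then show False using pow[of 1] l by simp
  qed
  have "l / a \<le> spec_rad J J0 A"
  proof (rule q.le_spec_radI)
    fix n :: nat
    show "(l / a) ^ n \<le> quot_norm J J0 (op_power A n)"
      using pow[of n] a by (simp add: power_divide pos_divide_le_eq)
  qed (use l a in simp)
  moreover have "0 < l / a" using l a by simp
  ultimately have pos: "0 < spec_rad J J0 A" by linarith
  have "blinfun_apply (\<delta> B) u \<in> J0"
    by (rule commutator_zero_on_irreducible[OF J J0(1) J0(2) _ pos B u(1)]) (rule irreducible)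
  then have "blinfun_apply K u \<in> J0"
    using invariant_idealD(2)[OF J0(1) C] by (simp add: K_def leaves_invariant_def)
  then have "(1 / l) *\<^sub>R blinfun_apply K u \<in> J0"
    by (rule subspace_scale[OF q.sub0])
  then have "u \<in> J0" using u'(2) l by simp
  then show False using not_F by simp
qed

lemma commutator_power_small:
  assumes C: "C \<in> S" and B: "B \<in> S" and e: "0 < e"
  obtains n where "norm (op_power (C o\<^sub>L \<delta> B) n) < e"
proof -
  interpret U: quotient UNIV "{0} :: 'a set"
    by unfold_locales (auto simp: closed_ideal_UNIV closed_ideal_zero)
  define r where "r = min e 1"
  have r: "0 < r" "r \<le> 1" "r \<le> e" using e by (auto simp: r_def)
  have "spec_rad UNIV {0} (C o\<^sub>L \<delta> B) < r" using spec_rad_commutator_zero[OF C B] r by simp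
  then obtain n where n: "0 < n" "quot_norm UNIV {0} (op_power (C o\<^sub>L \<delta> B) n) < r ^ n"
    by (rule U.spec_rad_lessD)
  have "norm (op_power (C o\<^sub>L \<delta> B) n) \<le> quot_norm UNIV {0} (op_power (C o\<^sub>L \<delta> B) n)"
    using U.infdist_le_qnorm_mult_norm[of _ "op_power (C o\<^sub>L \<delta> B) n"]
    by (intro norm_blinfun_bound U.qnorm_nonneg) simp
  also have "\<dots> < r ^ n" by (rule n(2))
  also have "r ^ n \<le> r" using n(1) r power_decreasing[of 1 n r] by simp
  finally show ?thesis using r(3) by (intro that[of n]) simp
qed

end

section \<open>Maximal left ideals of closed operator algebras\<close>

lemma subspace_closure:
  fixes V :: "'a::real_normed_vector set"
  assumes "subspace V" shows "subspace (closure V)"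
proof (rule subspaceI)
  show "0 \<in> closure V" using subspace_0[OF assms] closure_subset by blast
  show "x + y \<in> closure V" if "x \<in> closure V" "y \<in> closure V" for x y
  proof -
    obtain f g where fg: "\<And>n. f n \<in> V" "f \<longlonglongrightarrow> x" "\<And>n. g n \<in> V" "g \<longlonglongrightarrow> y"
      using \<open>x \<in> closure V\<close> \<open>y \<in> closure V\<close> unfolding closure_sequential by metis
    have "(\<lambda>n. f n + g n) \<longlonglongrightarrow> x + y" by (intro tendsto_add fg)
    moreover have "f n + g n \<in> V" for n by (rule subspace_add[OF assms fg(1) fg(3)])
    ultimately show ?thesis unfolding closure_sequential by (intro exI[of _ "\<lambda>n. f n + g n"]) simp
  qed
  show "c *\<^sub>R x \<in> closure V" if "x \<in> closure V" for c x
  proof -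
    obtain f where f: "\<And>n. f n \<in> V" "f \<longlonglongrightarrow> x"
      using \<open>x \<in> closure V\<close> unfolding closure_sequential by metis
    have "(\<lambda>n. c *\<^sub>R f n) \<longlonglongrightarrow> c *\<^sub>R x" by (intro tendsto_scaleR tendsto_const f)
    moreover have "c *\<^sub>R f n \<in> V" for n by (rule subspace_scale[OF assms f(1)])
    ultimately show ?thesis unfolding closure_sequential by (intro exI[of _ "\<lambda>n. c *\<^sub>R f n"]) simp
  qed
qed

lemma compose_mem_closure:
  fixes V :: "('b::real_normed_vector \<Rightarrow>\<^sub>L 'c::real_normed_vector) set"
    and W :: "('a::real_normed_vector \<Rightarrow>\<^sub>L 'b) set"
  assumes V: "\<And>X Y. X \<in> V \<Longrightarrow> Y \<in> W \<Longrightarrow> X o\<^sub>L Y \<in> U" and X: "X \<in> closure V" and Y: "Y \<in> closure W"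
  shows "X o\<^sub>L Y \<in> closure U"
proof -
  obtain f g where fg: "\<And>n. f n \<in> V" "f \<longlonglongrightarrow> X" "\<And>n. g n \<in> W" "g \<longlonglongrightarrow> Y"
    using X Y unfolding closure_sequential by metis
  have "(\<lambda>n. f n o\<^sub>L g n) \<longlonglongrightarrow> (X o\<^sub>L Y)"
    by (intro bounded_bilinear.tendsto[OF bounded_bilinear_blinfun_compose] fg)
  moreover have "f n o\<^sub>L g n \<in> U" for n by (rule V[OF fg(1) fg(3)])
  ultimately show ?thesis unfolding closure_sequential by (intro exI[of _ "\<lambda>n. f n o\<^sub>L g n"]) simp
qed

lemma operator_algebra_closure:
  assumes "operator_algebra \<A>" shows "operator_algebra (closure \<A>)"
  using assms subspace_closure[of \<A>] compose_mem_closure[of \<A> \<A> \<A>]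
  unfolding operator_algebra_def by simp

lemma operator_algebra_hull:
  fixes S :: "('a::real_normed_vector \<Rightarrow>\<^sub>L 'a) set"
  shows "operator_algebra (operator_algebra hull S)"
proof (rule hull_in)
  fix T :: "('a \<Rightarrow>\<^sub>L 'a) set set" assume "Ball T operator_algebra"
  then show "operator_algebra (\<Inter> T)"
    unfolding operator_algebra_def by (auto intro!: subspace_Inter)
qed

locale maximal_left_ideal =
  fixes \<A> J :: "('a::banach \<Rightarrow>\<^sub>L 'a) set"
  assumes algebra: "operator_algebra \<A>" and closed: "closed \<A>" and id_mem: "id_blinfun \<in> \<A>"
    and left_ideal: "left_ideal_of \<A> J" and proper: "J \<noteq> \<A>"
    and maximal: "\<And>K. left_ideal_of \<A> K \<Longrightarrow> J \<subseteq> K \<Longrightarrow> K = J \<or> K = \<A>"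
begin

lemma subspace_algebra: "subspace \<A>" and compose_algebra: "X \<in> \<A> \<Longrightarrow> Y \<in> \<A> \<Longrightarrow> X o\<^sub>L Y \<in> \<A>"
  using algebra by (auto simp: operator_algebra_def)

lemma ideal_subset: "J \<subseteq> \<A>" and subspace_ideal: "subspace J"
  and compose_ideal: "X \<in> \<A> \<Longrightarrow> Y \<in> J \<Longrightarrow> X o\<^sub>L Y \<in> J"
  using left_ideal by (auto simp: left_ideal_of_def)

lemma id_notin: "id_blinfun \<notin> J"
proof
  assume id: "id_blinfun \<in> J"
  have "X \<in> J" if "X \<in> \<A>" for X
  proof -
    have "X o\<^sub>L id_blinfun = X" by (rule blinfun_eqI) simp
    then show ?thesis using compose_ideal[OF that id] by simp
  qed
  then show False using proper ideal_subset by blast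
qed

text \<open>Otherwise the series of the powers of \<open>1 - j\<close>, which converges in the closed algebra,
  would be a left inverse of \<open>j\<close>, and \<open>1\<close> would be in \<open>J\<close>.\<close>

lemma norm_id_minus_ge_1:
  assumes j: "j \<in> J" shows "1 \<le> norm (id_blinfun - j)"
proof (rule ccontr)
  define e where "e = id_blinfun - j"
  assume "\<not> 1 \<le> norm (id_blinfun - j)"
  then have e1: "norm e < 1" by (simp add: e_def)
  have e: "e \<in> \<A>" unfolding e_def using j ideal_subset by (intro subspace_diff subspace_algebra id_mem) auto
  have pow: "op_power e n \<in> \<A>" for n
    by (induction n) (simp_all add: id_mem compose_algebra e)
  have summable: "summable (op_power e)"
  proof (rule summable_comparison_test')
    show "summable (\<lambda>n. norm e ^ n)" using e1 by (simp add: summable_geometric)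
    show "norm (op_power e n) \<le> norm e ^ n" if "0 \<le> n" for n by (rule norm_op_power_le)
  qed
  define Y where "Y = suminf (op_power e)"
  have "Y \<in> \<A>"
  proof (rule closed_sequentially[OF closed])
    show "(\<lambda>n. \<Sum>i<n. op_power e i) \<longlonglongrightarrow> Y"
      unfolding Y_def by (rule summable_LIMSEQ[OF summable])
    show "(\<Sum>i<n. op_power e i) \<in> \<A>" for n
      by (intro subspace_sum subspace_algebra pow)
  qed
  have "Y o\<^sub>L e = (\<Sum>n. op_power e n o\<^sub>L e)"
    unfolding Y_def
    by (rule bounded_linear.suminf[OF bounded_bilinear.bounded_linear_left[OF bounded_bilinear_blinfun_compose] summable])
  also have "(\<lambda>n. op_power e n o\<^sub>L e) = (\<lambda>n. op_power e (Suc n))"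
    by (rule ext, rule blinfun_eqI) (simp add: op_power_commute_apply)
  also have "(\<Sum>n. op_power e (Suc n)) = Y - op_power e 0"
    unfolding Y_def by (rule suminf_split_head[OF summable])
  finally have Ye: "Y o\<^sub>L e = Y - id_blinfun" by simp
  have "Y o\<^sub>L j = id_blinfun"
  proof (rule blinfun_eqI)
    fix x
    have "blinfun_apply Y (blinfun_apply e x) = blinfun_apply Y x - x"
      using arg_cong[OF Ye, of "\<lambda>F. blinfun_apply F x"] by (simp add: blinfun.diff_left)
    then show "blinfun_apply (Y o\<^sub>L j) x = blinfun_apply id_blinfun x"
      by (simp add: e_def blinfun.diff_left blinfun.diff_right)
  qed
  then have "id_blinfun \<in> J" using compose_ideal[OF \<open>Y \<in> \<A>\<close> j] by simp
  then show False using id_notin by simp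
qed

lemma ideal_closed: "closed J"
proof -
  have sub: "closure J \<subseteq> \<A>" by (rule closure_minimal[OF ideal_subset closed])
  have "left_ideal_of \<A> (closure J)"
    unfolding left_ideal_of_def
  proof (intro conjI ballI)
    show "X o\<^sub>L Y \<in> closure J" if "X \<in> \<A>" "Y \<in> closure J" for X Y
      by (rule compose_mem_closure[OF compose_ideal closure_subset[THEN subsetD, OF that(1)] that(2)])
  qed (rule sub subspace_closure[OF subspace_ideal])+
  then have "closure J = J \<or> closure J = \<A>"
    using closure_subset by (rule maximal)
  moreover have "closure J \<noteq> \<A>"
  proof
    assume "closure J = \<A>"
    then have "id_blinfun \<in> closure J" using id_mem by simp
    then obtain j where j: "j \<in> J" "dist j id_blinfun < 1"
      unfolding closure_approachable using zero_less_one by blast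
    then show False using norm_id_minus_ge_1[OF j(1)] by (simp add: dist_norm norm_minus_commute)
  qed
  ultimately show ?thesis using closed_closure[of J] by simp
qed

lemma generates:
  assumes y: "y \<in> \<A>" "y \<notin> J"
  obtains j X where "j \<in> J" "X \<in> \<A>" "id_blinfun = j + (X o\<^sub>L y)"
proof -
  define K where "K = {j + (X o\<^sub>L y) | j X. j \<in> J \<and> X \<in> \<A>}"
  have KI: "j + (X o\<^sub>L y) \<in> K" if "j \<in> J" "X \<in> \<A>" for j X
    using that by (auto simp: K_def)
  have KE: "\<exists>j\<in>J. \<exists>X\<in>\<A>. k = j + (X o\<^sub>L y)" if "k \<in> K" for k
    using that by (auto simp: K_def)
  have zero: "0 \<in> \<A>" by (rule subspace_0[OF subspace_algebra])
  have "left_ideal_of \<A> K"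
    unfolding left_ideal_of_def
  proof (intro conjI ballI)
    show "K \<subseteq> \<A>"
    proof
      fix k assume "k \<in> K"
      then obtain j X where jX: "j \<in> J" "X \<in> \<A>" "k = j + (X o\<^sub>L y)" using KE by blast
      show "k \<in> \<A>"
        unfolding jX(3) using jX(1) ideal_subset
        by (intro subspace_add[OF subspace_algebra] compose_algebra jX(2) y(1)) auto
    qed
    show "subspace K"
    proof (rule subspaceI)
      show "0 \<in> K" using KI[OF subspace_0[OF subspace_ideal] zero] by simp
      fix a assume "a \<in> K"
      then obtain j X where jX: "j \<in> J" "X \<in> \<A>" "a = j + (X o\<^sub>L y)" using KE by blast
      have "c *\<^sub>R a = c *\<^sub>R j + ((c *\<^sub>R X) o\<^sub>L y)" for c
        unfolding jX(3) by (rule blinfun_eqI) (simp add: blinfun.add_left blinfun.scaleR_left scaleR_add_right)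
      then show "c *\<^sub>R a \<in> K" for c
        using KI[OF subspace_scale[OF subspace_ideal jX(1)] subspace_scale[OF subspace_algebra jX(2)]] by metis
      fix b assume "b \<in> K"
      then obtain j' X' where jX': "j' \<in> J" "X' \<in> \<A>" "b = j' + (X' o\<^sub>L y)" using KE by blast
      have "a + b = (j + j') + ((X + X') o\<^sub>L y)"
        unfolding jX(3) jX'(3) by (rule blinfun_eqI) (simp add: blinfun.add_left)
      then show "a + b \<in> K"
        using KI[OF subspace_add[OF subspace_ideal jX(1) jX'(1)] subspace_add[OF subspace_algebra jX(2) jX'(2)]] by metis
    qed
    fix Z k assume Z: "Z \<in> \<A>" and "k \<in> K"
    then obtain j X where jX: "j \<in> J" "X \<in> \<A>" "k = j + (X o\<^sub>L y)" using KE by blast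
    have "Z o\<^sub>L k = (Z o\<^sub>L j) + ((Z o\<^sub>L X) o\<^sub>L y)"
      unfolding jX(3) by (rule blinfun_eqI) (simp add: blinfun.add_left blinfun.add_right)
    then show "Z o\<^sub>L k \<in> K"
      using KI[OF compose_ideal[OF Z jX(1)] compose_algebra[OF Z jX(2)]] by metis
  qed
  moreover have "J \<subseteq> K"
  proof
    fix j assume "j \<in> J"
    then show "j \<in> K" using KI[OF _ zero, of j] by simp
  qed
  ultimately have "K = J \<or> K = \<A>" by (rule maximal)
  moreover have "y \<in> K"
  proof -
    have "id_blinfun o\<^sub>L y = y" by (rule blinfun_eqI) simp
    then show ?thesis using KI[OF subspace_0[OF subspace_ideal] id_mem] by simp
  qed
  ultimately have "id_blinfun \<in> K" using y(2) id_mem by blast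
  then show ?thesis using KE that by blast
qed

end

lemma compact_closure_totally_bounded:
  fixes X :: "'a::banach set"
  assumes "\<And>e. 0 < e \<Longrightarrow> \<exists>k. finite k \<and> X \<subseteq> (\<Union>x\<in>k. ball x e)"
  shows "compact (closure X)"
  unfolding compact_eq_totally_bounded
proof (intro conjI allI impI)
  show "complete (closure X)" by (simp add: complete_eq_closed)
  fix e :: real assume e: "0 < e"
  then obtain k where k: "finite k" "X \<subseteq> (\<Union>x\<in>k. ball x (e / 2))"
    using assms[of "e / 2"] by auto
  have "X \<subseteq> (\<Union>x\<in>k. cball x (e / 2))" 
    by (rule order_trans[OF k(2)]) (intro UN_mono order_refl ball_subset_cball)
  then have "closure X \<subseteq> (\<Union>x\<in>k. cball x (e / 2))"
    by (rule closure_minimal) (intro closed_UN k(1) ballI closed_cball)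
  also have "\<dots> \<subseteq> (\<Union>x\<in>k. ball x e)"
    using e by (intro UN_mono order_refl) (simp add: subset_iff)
  finally show "\<exists>k. finite k \<and> closure X \<subseteq> (\<Union>x\<in>k. ball x e)" using k(1) by blast
qed

text \<open>Vala's theorem. Up to a small error \<open>D Y T\<close> is determined by the values of \<open>D Y\<close> on a
  finite net of the image of the unit ball under \<open>T\<close>, and these values range over a relatively
  compact set.\<close>

lemma compact_sandwich:
  fixes D :: "'b::banach \<Rightarrow>\<^sub>L 'c::banach" and T :: "'a::banach \<Rightarrow>\<^sub>L 'd::banach"
  assumes D: "compact_op D" and T: "compact_op T"
  shows "compact (closure ((\<lambda>Y. D o\<^sub>L Y o\<^sub>L T) ` {Y. norm Y \<le> c}))"
proof (rule compact_closure_totally_bounded)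
  fix e :: real assume e: "0 < e"
  define b where "b = 2 * \<bar>c\<bar> * norm D + 2"
  define h where "h = e / (2 * b)"
  have b: "0 < b" unfolding b_def by (intro add_nonneg_pos mult_nonneg_nonneg) auto
  have h: "0 < h" "b * h < e" using e b by (auto simp: h_def)
  have "compact (closure (blinfun_apply T ` cball 0 1))" using T by (simp add: compact_op_def)
  then obtain N where N: "finite N" "closure (blinfun_apply T ` cball 0 1) \<subseteq> (\<Union>x\<in>N. ball x h)"
    using h(1) unfolding compact_eq_totally_bounded by blast
  define r where "r = \<bar>c\<bar> * (\<Sum>x\<in>N. norm x)"
  have "compact (closure (blinfun_apply D ` cball 0 r))" using D by (simp add: compact_op_def)
  then obtain H where H: "finite H" "closure (blinfun_apply D ` cball 0 r) \<subseteq> (\<Union>x\<in>H. ball x h)"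
    using h(1) unfolding compact_eq_totally_bounded by blast
  have "\<exists>v\<in>H. dist v (blinfun_apply D (blinfun_apply Y x)) < h" if Y: "norm Y \<le> c" and x: "x \<in> N" for Y x
  proof -
    have "norm (blinfun_apply Y x) \<le> norm Y * norm x" by (rule norm_blinfun)
    also have "\<dots> \<le> r"
      unfolding r_def using Y x N(1) by (intro mult_mono member_le_sum[of x N norm]) auto
    finally have "blinfun_apply D (blinfun_apply Y x) \<in> closure (blinfun_apply D ` cball 0 r)"
      by (intro closure_subset[THEN subsetD] imageI) simp
    then show ?thesis using H(2) by (auto simp: subset_iff)
  qed
  then obtain \<phi> where \<phi>: "\<And>Y x. norm Y \<le> c \<Longrightarrow> x \<in> N \<Longrightarrow> \<phi> Y x \<in> H"
      "\<And>Y x. norm Y \<le> c \<Longrightarrow> x \<in> N \<Longrightarrow> dist (\<phi> Y x) (blinfun_apply D (blinfun_apply Y x)) < h"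
    by metis
  \<comment> \<open>The finitely many codes \<open>\<psi> Y\<close> determine \<open>D Y T\<close> up to \<open>b h < e\<close>.\<close>
  define \<psi> where "\<psi> = (\<lambda>Y. restrict (\<phi> Y) N)"
  define V where "V = {Y :: 'd \<Rightarrow>\<^sub>L 'b. norm Y \<le> c}"
  have fin: "finite (\<psi> ` V)"
  proof (rule finite_subset)
    show "\<psi> ` V \<subseteq> (N \<rightarrow>\<^sub>E H)" using \<phi>(1) by (auto simp: \<psi>_def V_def)
    show "finite (N \<rightarrow>\<^sub>E H)" by (rule finite_PiE[OF N(1)]) (rule H(1))
  qed
  have close: "dist (D o\<^sub>L Y o\<^sub>L T) (D o\<^sub>L Y' o\<^sub>L T) < e" if Y: "Y \<in> V" "Y' \<in> V" and eq: "\<psi> Y = \<psi> Y'" for Y Y'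
  proof -
    have c: "norm Y \<le> c" "norm Y' \<le> c" using Y by (auto simp: V_def)
    have "norm ((D o\<^sub>L Y o\<^sub>L T) - (D o\<^sub>L Y' o\<^sub>L T)) \<le> b * h"
    proof (rule norm_blinfun_bound)
      show "0 \<le> b * h" using b h by simp
      have unit: "norm (blinfun_apply ((D o\<^sub>L Y o\<^sub>L T) - (D o\<^sub>L Y' o\<^sub>L T)) v) \<le> b * h" if v: "norm v \<le> 1" for v
      proof -
        have "blinfun_apply T v \<in> closure (blinfun_apply T ` cball 0 1)"
          using v by (intro closure_subset[THEN subsetD] imageI) simp
        then obtain x where x: "x \<in> N" "dist x (blinfun_apply T v) < h" using N(2) by (auto simp: subset_iff)
        have "\<phi> Y x = \<phi> Y' x" using eq x(1) by (auto simp: \<psi>_def fun_eq_iff restrict_def split: if_splits)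
        then have 1: "dist (blinfun_apply D (blinfun_apply Y x)) (blinfun_apply D (blinfun_apply Y' x)) < 2 * h"
          using \<phi>(2)[OF c(1) x(1)] \<phi>(2)[OF c(2) x(1)]
            dist_triangle3[of "blinfun_apply D (blinfun_apply Y x)" "blinfun_apply D (blinfun_apply Y' x)" "\<phi> Y x"] by simp
        have "blinfun_apply ((D o\<^sub>L Y o\<^sub>L T) - (D o\<^sub>L Y' o\<^sub>L T)) v
            = blinfun_apply (D o\<^sub>L (Y - Y')) (blinfun_apply T v - x)
              + (blinfun_apply D (blinfun_apply Y x) - blinfun_apply D (blinfun_apply Y' x))"
          by (simp add: blinfun.diff_left blinfun.diff_right)
        also have "norm \<dots> \<le> norm (blinfun_apply (D o\<^sub>L (Y - Y')) (blinfun_apply T v - x)) + 2 * h"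
          using 1 by (intro norm_triangle_le) (simp add: dist_norm)
        also have "norm (blinfun_apply (D o\<^sub>L (Y - Y')) (blinfun_apply T v - x)) \<le> (norm D * (2 * \<bar>c\<bar>)) * h"
        proof -
          have "norm (D o\<^sub>L (Y - Y')) \<le> norm D * norm (Y - Y')" by (rule norm_blinfun_compose)
          also have "\<dots> \<le> norm D * (2 * \<bar>c\<bar>)"
            using norm_triangle_ineq4[of Y Y'] c by (intro mult_left_mono) auto
          finally have "norm (D o\<^sub>L (Y - Y')) * norm (blinfun_apply T v - x) \<le> (norm D * (2 * \<bar>c\<bar>)) * h"
            using x(2) by (intro mult_mono) (auto simp: dist_norm norm_minus_commute)
          then show ?thesis by (rule order_trans[OF norm_blinfun])
        qed
        finally show ?thesis by (simp add: b_def algebra_simps)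
      qed
      fix v
      show "norm (blinfun_apply ((D o\<^sub>L Y o\<^sub>L T) - (D o\<^sub>L Y' o\<^sub>L T)) v) \<le> b * h * norm v"
      proof (cases "v = 0")
        case False
        have "norm (blinfun_apply ((D o\<^sub>L Y o\<^sub>L T) - (D o\<^sub>L Y' o\<^sub>L T)) ((1 / norm v) *\<^sub>R v)) \<le> b * h"
          using False by (intro unit) simp
        then show ?thesis using False unfolding blinfun.scaleR_right norm_scaleR by (simp add: divide_le_eq)
      qed (simp add: blinfun.zero_right)
    qed
    then show ?thesis using h(2) by (simp add: dist_norm)
  qed
  define g where "g = (\<lambda>q. D o\<^sub>L (SOME Y. Y \<in> V \<and> \<psi> Y = q) o\<^sub>L T)"
  have "(\<lambda>Y. D o\<^sub>L Y o\<^sub>L T) ` V \<subseteq> (\<Union>x\<in>g ` \<psi> ` V. ball x e)"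
  proof
    fix F assume "F \<in> (\<lambda>Y. D o\<^sub>L Y o\<^sub>L T) ` V"
    then obtain Y where Y: "Y \<in> V" "F = D o\<^sub>L Y o\<^sub>L T" by blast
    let ?Y = "SOME Y'. Y' \<in> V \<and> \<psi> Y' = \<psi> Y"
    have "?Y \<in> V \<and> \<psi> ?Y = \<psi> Y" using Y(1) by (intro someI[of "\<lambda>Y'. Y' \<in> V \<and> \<psi> Y' = \<psi> Y" Y]) simp
    then have "F \<in> ball (g (\<psi> Y)) e"
      using close[of ?Y Y] Y by (simp add: g_def)
    then show "F \<in> (\<Union>x\<in>g ` \<psi> ` V. ball x e)" using Y(1) by blast
  qed
  then show "\<exists>k. finite k \<and> (\<lambda>Y. D o\<^sub>L Y o\<^sub>L T) ` {Y. norm Y \<le> c} \<subseteq> (\<Union>x\<in>k. ball x e)"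
    unfolding V_def[symmetric] using fin by (intro exI[of _ "g ` \<psi> ` V"]) simp
qed

section \<open>The commutators lie in the radical\<close>

context super_commutant
begin

abbreviation hull_S :: "('a \<Rightarrow>\<^sub>L 'a) set" where
  "hull_S \<equiv> operator_algebra hull S"

lemma hull_subset_differences: "hull_S \<subseteq> {M - N | M N. M \<in> S \<and> N \<in> S}"
proof (rule hull_minimal)
  let ?D = "{M - N | M N. M \<in> S \<and> N \<in> S}"
  have I: "M - N \<in> ?D" if "M \<in> S" "N \<in> S" for M N using that by blast
  have zero: "0 \<in> S" using scale_mem[OF id_mem, of 0] by simp
  show "S \<subseteq> ?D"
  proof
    fix M assume "M \<in> S"
    then show "M \<in> ?D" using I[OF _ zero, of M] by simp
  qed
  show "operator_algebra ?D"
    unfolding operator_algebra_def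
  proof (intro conjI ballI)
    show "subspace ?D"
    proof (rule subspaceI)
      show "0 \<in> ?D" using I[OF zero zero] by simp
      fix X assume "X \<in> ?D"
      then obtain M N where MN: "M \<in> S" "N \<in> S" "X = M - N" by blast
      show "c *\<^sub>R X \<in> ?D" for c
      proof (cases "0 \<le> c")
        case True
        then show ?thesis
          using I[OF scale_mem[OF MN(1)] scale_mem[OF MN(2)], of c c] MN(3) by (simp add: scaleR_diff_right)
      next
        case False
        then have "0 \<le> - c" by simp
        moreover have "c *\<^sub>R X = (- c) *\<^sub>R N - (- c) *\<^sub>R M"
          unfolding MN(3) by (simp add: scaleR_diff_right)
        ultimately show ?thesis
          using I[OF scale_mem[OF MN(2)] scale_mem[OF MN(1)], of "- c" "- c"] by metis
      qed
      fix Y assume "Y \<in> ?D"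
      then obtain P Q where PQ: "P \<in> S" "Q \<in> S" "Y = P - Q" by blast
      have "X + Y = (M + P) - (N + Q)" unfolding MN(3) PQ(3) by simp
      then show "X + Y \<in> ?D" using I[OF add_mem[OF MN(1) PQ(1)] add_mem[OF MN(2) PQ(2)]] by metis
    qed
    fix X Y assume "X \<in> ?D" "Y \<in> ?D"
    then obtain M N P Q where MN: "M \<in> S" "N \<in> S" "X = M - N" and PQ: "P \<in> S" "Q \<in> S" "Y = P - Q" by blast
    have "X o\<^sub>L Y = ((M o\<^sub>L P) + (N o\<^sub>L Q)) - ((M o\<^sub>L Q) + (N o\<^sub>L P))"
      unfolding MN(3) PQ(3)
      by (rule blinfun_eqI) (simp add: blinfun.diff_left blinfun.add_left blinfun.diff_right)
    then show "X o\<^sub>L Y \<in> ?D"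
      using I[OF add_mem[OF compose_mem[OF MN(1) PQ(1)] compose_mem[OF MN(2) PQ(2)]]
          add_mem[OF compose_mem[OF MN(1) PQ(2)] compose_mem[OF MN(2) PQ(1)]]] by metis
  qed
qed

text \<open>Domination is available on the dense subalgebra only: for a norm limit \<open>X\<close> of its elements the
  dominating operators may be unbounded.\<close>

lemma hull_dominated:
  assumes "X \<in> hull_S"
  obtains W where "W \<in> S" "\<And>x. \<bar>blinfun_apply X x\<bar> \<le> blinfun_apply W \<bar>x\<bar>"
proof -
  obtain M N where MN: "M \<in> S" "N \<in> S" "X = M - N" using assms hull_subset_differences by blast
  show ?thesis
  proof (rule that[of "M + N"])
    show "M + N \<in> S" by (rule add_mem[OF MN(1,2)])
    show "\<bar>blinfun_apply X x\<bar> \<le> blinfun_apply (M + N) \<bar>x\<bar>" for x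
    proof -
      have "\<bar>blinfun_apply X x\<bar> \<le> \<bar>blinfun_apply M x\<bar> + \<bar>blinfun_apply N x\<bar>"
        unfolding MN(3) blinfun.diff_left by (rule abs_triangle_ineq4)
      also have "\<dots> \<le> blinfun_apply (M + N) \<bar>x\<bar>"
        unfolding blinfun.add_left by (intro add_mono positive_op_abs S_pos MN)
      finally show ?thesis .
    qed
  qed
qed

lemma finite_dominated:
  assumes "finite \<Z>" "\<Z> \<subseteq> hull_S"
  shows "\<exists>W\<in>S. \<forall>Z\<in>\<Z>. \<forall>x. \<bar>blinfun_apply Z x\<bar> \<le> blinfun_apply W \<bar>x\<bar>"
  using assms
proof (induction \<Z> rule: finite_induct)
    case empty
    then show ?case using id_mem by blast
  next
    case (insert X \<Z>)
    then obtain W where W: "W \<in> S" "\<And>Z x. Z \<in> \<Z> \<Longrightarrow> \<bar>blinfun_apply Z x\<bar> \<le> blinfun_apply W \<bar>x\<bar>"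
      by auto
    obtain V where V: "V \<in> S" "\<And>x. \<bar>blinfun_apply X x\<bar> \<le> blinfun_apply V \<bar>x\<bar>"
      using hull_dominated insert.prems by (metis insert_subset)
    have nonneg: "0 \<le> blinfun_apply V \<bar>x\<bar>" "0 \<le> blinfun_apply W \<bar>x\<bar>" for x
      by (rule positive_opD[OF S_pos[OF V(1)] abs_ge_zero], rule positive_opD[OF S_pos[OF W(1)] abs_ge_zero])
    have "\<bar>blinfun_apply Z x\<bar> \<le> blinfun_apply (V + W) \<bar>x\<bar>" if "Z \<in> insert X \<Z>" for Z x
    proof (cases "Z = X")
      case True
      then show ?thesis
        using add_mono[OF V(2)[of x] nonneg(2)[of x]] by (simp add: blinfun.add_left)
    next
      case False
      then have "Z \<in> \<Z>" using that by simp
      then show ?thesis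
        using add_mono[OF nonneg(1)[of x] W(2)[of Z x]] by (simp add: blinfun.add_left)
    qed
    then show ?case using add_mem[OF V(1) W(1)] by blast
qed

lemma \<delta>_mem_algebra:
  assumes "operator_algebra \<A>" "S \<subseteq> \<A>" "M \<in> \<A>"
  shows "\<delta> M \<in> \<A>"
  using assms A_mem unfolding \<delta>_def operator_algebra_def
  by (intro subspace_scale subspace_diff) auto

text \<open>The argument is Hilden's proof of Lomonosov's theorem, carried out in the simple left
  module \<open>\<A> / J\<close>. Suppose that \<open>D = \<delta> B\<close> is not in \<open>J\<close>. Then \<open>1 = j + X D\<close> with \<open>j\<close> in \<open>J\<close>.
  Right multiplication by \<open>T = X D\<close> is the identity modulo \<open>J\<close>, so left multiplication by \<open>D\<close> on
  \<open>\<A> / J\<close> is induced by \<open>Y \<mapsto> D Y T\<close>, a compact map. Let \<open>U\<close> be a small ball around \<open>1\<close>. No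
  element of the closure of \<open>D U T\<close> is in \<open>J\<close>, so each is mapped back into \<open>U + J\<close> by an element
  of the dense subalgebra, and finitely many \<open>Z\<close> suffice for all of them. Hence arbitrarily long
  products \<open>Z\<^sub>n D \<dots> Z\<^sub>1 D\<close> lie in \<open>U + J\<close>. But they are dominated by \<open>(W D)\<^sup>n\<close> with a single \<open>W\<close>
  in \<open>S\<close>, some power of which is small in norm, and \<open>0\<close> is at a positive distance from \<open>U + J\<close>.\<close>

lemma commutator_in_maximal_left_ideal:
  assumes max: "maximal_left_ideal (closure hull_S) J" and B: "B \<in> S"
  shows "\<delta> B \<in> J"
proof (rule ccontr)
  interpret maximal_left_ideal "closure hull_S" J by (rule max)
  let ?\<A> = "closure hull_S"
  define D where "D = \<delta> B"
  assume "\<delta> B \<notin> J"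
  then have D_notin: "D \<notin> J" by (simp add: D_def)
  have S_sub: "S \<subseteq> ?\<A>" using hull_subset[of S operator_algebra] closure_subset by blast
  have D_mem: "D \<in> ?\<A>"
    unfolding D_def using B S_sub by (intro \<delta>_mem_algebra algebra) auto
  have J_ne: "J \<noteq> {}" using subspace_0[OF subspace_ideal] by blast
  obtain j X where jX: "j \<in> J" "X \<in> ?\<A>" "id_blinfun = j + (X o\<^sub>L D)"
    by (rule generates[OF D_mem D_notin])
  define T where "T = X o\<^sub>L D"
  have T_mem: "T \<in> ?\<A>" unfolding T_def by (rule compose_algebra[OF jX(2) D_mem])
  have T_eq: "T = id_blinfun - j" unfolding jX(3) T_def by simp
  have T_compact: "compact_op T"
    unfolding T_def D_def by (rule compact_op_compose_left[OF \<delta>_compact])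
  have right_T: "Y - (Y o\<^sub>L T) \<in> J" if "Y \<in> ?\<A>" for Y
  proof -
    have "Y - (Y o\<^sub>L T) = Y o\<^sub>L j"
      unfolding T_eq by (rule blinfun_eqI) (simp add: blinfun.diff_left blinfun.diff_right)
    then show ?thesis using compose_ideal[OF that jX(1)] by simp
  qed
  define a where "a = infdist D J"
  have a: "0 < a"
    unfolding a_def by (rule infdist_pos_not_in_closed[OF ideal_closed J_ne D_notin])
  have DT: "infdist (D o\<^sub>L T) J = a"
    using infdist_subspace_add_mem[OF subspace_ideal right_T[OF D_mem], of "D o\<^sub>L T"] by (simp add: a_def)
  \<comment> \<open>The radius \<open>d\<close> of \<open>U\<close> is small enough that \<open>D Y T\<close> stays at distance \<open>a / 2\<close> from \<open>J\<close> for \<open>Y\<close> in \<open>U\<close>;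
    the bound \<open>1 / 2\<close> keeps \<open>U\<close> away from \<open>J\<close>, which is at distance \<open>1\<close> from the identity.\<close>
  define m where "m = norm D * norm T"
  define d where "d = min (1 / 2) (a / (2 * (m + 1)))"
  have m: "0 \<le> m" by (simp add: m_def)
  have d: "0 < d" "d \<le> 1 / 2" "m * d \<le> a / 2"
  proof -
    show "0 < d" using a m by (simp add: d_def)
    show "d \<le> 1 / 2" unfolding d_def by (rule min.cobounded1)
    have "m * d \<le> (m + 1) * (a / (2 * (m + 1)))"
      using m a by (intro mult_mono) (auto simp: d_def)
    also have "\<dots> = a / 2" using m by (simp add: field_simps)
    finally show "m * d \<le> a / 2" .
  qed
  define U where "U = {Y \<in> ?\<A>. norm (Y - id_blinfun) \<le> d}"
  define \<K> where "\<K> = closure ((\<lambda>Y. D o\<^sub>L Y o\<^sub>L T) ` U)"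
  have \<K>_compact: "compact \<K>"
  proof -
    have "U \<subseteq> {Y. norm Y \<le> 2}"
    proof
      fix Y assume "Y \<in> U"
      then have "norm (Y - id_blinfun) \<le> 1" using d(2) by (simp add: U_def)
      then have "norm Y \<le> 2"
        using norm_triangle_ineq[of "Y - id_blinfun" id_blinfun] norm_blinfun_id_le[where 'a = 'a] by simp
      then show "Y \<in> {Y. norm Y \<le> 2}" by simp
    qed
    then have "\<K> \<subseteq> closure ((\<lambda>Y. D o\<^sub>L Y o\<^sub>L T) ` {Y. norm Y \<le> 2})"
      unfolding \<K>_def by (intro closure_mono image_mono)
    moreover have "compact (closure ((\<lambda>Y. D o\<^sub>L Y o\<^sub>L T) ` {Y. norm Y \<le> 2}))"
      unfolding D_def by (rule compact_sandwich[OF \<delta>_compact T_compact])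
    ultimately show ?thesis
      using compact_Int_closed[of "closure ((\<lambda>Y. D o\<^sub>L Y o\<^sub>L T) ` {Y. norm Y \<le> 2})" \<K>]
      by (simp add: inf.absorb2 \<K>_def)
  qed
  have \<K>_mem: "\<K> \<subseteq> ?\<A>"
    unfolding \<K>_def
    by (rule closure_minimal[OF _ closed_closure]) (auto simp: U_def intro!: compose_algebra D_mem T_mem)
  have \<K>_notin: "y \<notin> J" if "y \<in> \<K>" for y
  proof -
    have "(\<lambda>Y. D o\<^sub>L Y o\<^sub>L T) ` U \<subseteq> {y. a / 2 \<le> infdist y J}"
    proof
      fix y assume "y \<in> (\<lambda>Y. D o\<^sub>L Y o\<^sub>L T) ` U"
      then obtain Y where Y: "norm (Y - id_blinfun) \<le> d" "y = D o\<^sub>L Y o\<^sub>L T" by (auto simp: U_def)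
      have "(D o\<^sub>L T) - y = D o\<^sub>L (id_blinfun - Y) o\<^sub>L T"
        unfolding Y(2) by (rule blinfun_eqI) (simp add: blinfun.diff_left blinfun.diff_right)
      then have "norm ((D o\<^sub>L T) - y) \<le> norm (D o\<^sub>L (id_blinfun - Y)) * norm T"
        by (simp add: norm_blinfun_compose)
      also have "\<dots> \<le> (norm D * norm (id_blinfun - Y)) * norm T"
        by (intro mult_right_mono norm_blinfun_compose) simp
      also have "\<dots> = m * norm (Y - id_blinfun)" by (simp add: m_def norm_minus_commute)
      also have "\<dots> \<le> m * d" using Y(1) m by (rule mult_left_mono)
      finally have "norm ((D o\<^sub>L T) - y) \<le> a / 2" using d(3) by simp
      moreover have "infdist (D o\<^sub>L T) J \<le> infdist y J + dist (D o\<^sub>L T) y" by (rule infdist_triangle)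
      ultimately show "y \<in> {y. a / 2 \<le> infdist y J}" using DT by (simp add: dist_norm)
    qed
    moreover have "closed {y. a / 2 \<le> infdist y J}"
      by (intro closed_Collect_le continuous_intros)
    ultimately have "\<K> \<subseteq> {y. a / 2 \<le> infdist y J}" unfolding \<K>_def by (rule closure_minimal)
    then have "0 < infdist y J" using that a by auto
    then show ?thesis by auto
  qed
  define O' where "O' = (\<lambda>Z :: 'a \<Rightarrow>\<^sub>L 'a. \<Union>i\<in>J. {y. norm ((Z o\<^sub>L y) + i - id_blinfun) < d})"
  have O'_open: "open (O' Z)" for Z
    unfolding O'_def
    by (intro open_UN ballI open_Collect_less continuous_intros
        bounded_linear.continuous_on[OF bounded_bilinear.bounded_linear_right[OF bounded_bilinear_blinfun_compose]])
  have cover: "\<K> \<subseteq> (\<Union>Z\<in>hull_S. O' Z)"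
  proof
    fix y assume y: "y \<in> \<K>"
    have y_mem: "y \<in> ?\<A>" using y \<K>_mem by blast
    obtain i Z0 where iZ: "i \<in> J" "Z0 \<in> ?\<A>" "id_blinfun = i + (Z0 o\<^sub>L y)"
      by (rule generates[OF y_mem \<K>_notin[OF y]])
    have "0 < d / (norm y + 1)" using d(1) by (intro divide_pos_pos add_nonneg_pos) auto
    then obtain Z where Z: "Z \<in> hull_S" "dist Z Z0 < d / (norm y + 1)"
      using iZ(2) unfolding closure_approachable by blast
    have "(Z o\<^sub>L y) + i - id_blinfun = (Z - Z0) o\<^sub>L y"
      unfolding iZ(3) by (rule blinfun_eqI) (simp add: blinfun.diff_left blinfun.add_left)
    then have "norm ((Z o\<^sub>L y) + i - id_blinfun) \<le> norm (Z - Z0) * norm y"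
      by (simp add: norm_blinfun_compose)
    also have "\<dots> \<le> (d / (norm y + 1)) * norm y"
      using Z(2) by (intro mult_right_mono) (auto simp: dist_norm)
    also have "\<dots> = d * (norm y / (norm y + 1))" by simp
    also have "\<dots> < d * 1"
    proof (rule mult_strict_left_mono[OF _ d(1)])
      have "0 < norm y + 1" by (intro add_nonneg_pos) auto
      then show "norm y / (norm y + 1) < 1" by (simp add: divide_less_eq)
    qed
    finally have "y \<in> O' Z" using iZ(1) by (auto simp: O'_def)
    then show "y \<in> (\<Union>Z\<in>hull_S. O' Z)" using Z(1) by blast
  qed
  obtain \<Z> where \<Z>: "\<Z> \<subseteq> hull_S" "finite \<Z>" "\<K> \<subseteq> (\<Union>Z\<in>\<Z>. O' Z)"
    by (rule compactE_image[OF \<K>_compact O'_open cover])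
  obtain W where W: "W \<in> S" "\<forall>Z\<in>\<Z>. \<forall>x. \<bar>blinfun_apply Z x\<bar> \<le> blinfun_apply W \<bar>x\<bar>"
    using finite_dominated[OF \<Z>(2,1)] by (rule bexE)
  define V where "V = W o\<^sub>L \<delta> B"
  have D_pos: "positive_op D" unfolding D_def by (rule \<delta>_pos[OF B])
  have products: "\<exists>P\<in>?\<A>. \<exists>Y\<in>U. P - Y \<in> J \<and> (\<forall>x. \<bar>blinfun_apply P x\<bar> \<le> blinfun_apply (op_power V n) \<bar>x\<bar>)" for n
  proof (induction n)
    case 0
    have "id_blinfun \<in> U" using d(1) id_mem by (simp add: U_def)
    moreover have "id_blinfun - id_blinfun \<in> J" using subspace_0[OF subspace_ideal] by simp
    moreover have "\<forall>x. \<bar>blinfun_apply id_blinfun x\<bar> \<le> blinfun_apply (op_power V 0) \<bar>x\<bar>" by simp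
    ultimately show ?case using id_mem by blast
  next
    case (Suc n)
    then obtain P Y where P: "P \<in> ?\<A>" and Y: "Y \<in> U" and PY: "P - Y \<in> J"
      and dom: "\<And>x. \<bar>blinfun_apply P x\<bar> \<le> blinfun_apply (op_power V n) \<bar>x\<bar>" by blast
    have Y_mem: "Y \<in> ?\<A>" using Y by (simp add: U_def)
    have "D o\<^sub>L Y o\<^sub>L T \<in> \<K>" unfolding \<K>_def by (rule closure_subset[THEN subsetD, OF imageI[OF Y]])
    then obtain Z where Z: "Z \<in> \<Z>" "D o\<^sub>L Y o\<^sub>L T \<in> O' Z" using \<Z>(3) by blast
    then obtain i where i: "i \<in> J" "norm ((Z o\<^sub>L (D o\<^sub>L Y o\<^sub>L T)) + i - id_blinfun) < d"
      by (auto simp: O'_def)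
    have Z_mem: "Z \<in> ?\<A>" using Z(1) \<Z>(1) by (intro closure_subset[THEN subsetD]) auto
    have ZD: "Z o\<^sub>L D \<in> ?\<A>" by (rule compose_algebra[OF Z_mem D_mem])
    define Y' where "Y' = (Z o\<^sub>L (D o\<^sub>L Y o\<^sub>L T)) + i"
    define P' where "P' = (Z o\<^sub>L D) o\<^sub>L P"
    have "Y' \<in> U"
    proof -
      have "Y' \<in> ?\<A>"
        unfolding Y'_def
        by (intro subspace_add[OF subspace_algebra] compose_algebra Z_mem D_mem Y_mem T_mem
            subsetD[OF ideal_subset i(1)])
      then show ?thesis using i(2) by (simp add: U_def Y'_def)
    qed
    moreover have "P' - Y' \<in> J"
    proof -
      have "P' - Y' = ((Z o\<^sub>L D) o\<^sub>L (P - Y)) + ((Z o\<^sub>L D) o\<^sub>L (Y - (Y o\<^sub>L T))) - i"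
        unfolding P'_def Y'_def
        by (rule blinfun_eqI) (simp add: blinfun.diff_left blinfun.add_left blinfun.diff_right)
      moreover have "\<dots> \<in> J"
        by (rule subspace_diff[OF subspace_ideal subspace_add[OF subspace_ideal compose_ideal[OF ZD PY]
              compose_ideal[OF ZD right_T[OF Y_mem]]] i(1)])
      ultimately show ?thesis by simp
    qed
    moreover have "\<bar>blinfun_apply P' x\<bar> \<le> blinfun_apply (op_power V (Suc n)) \<bar>x\<bar>" for x
    proof -
      have "\<bar>blinfun_apply P' x\<bar> \<le> blinfun_apply W \<bar>blinfun_apply D (blinfun_apply P x)\<bar>"
        using W(2)[rule_format, OF Z(1), of "blinfun_apply D (blinfun_apply P x)"] by (simp add: P'_def)
      also have "\<dots> \<le> blinfun_apply W (blinfun_apply D \<bar>blinfun_apply P x\<bar>)"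
        by (rule positive_op_mono[OF S_pos[OF W(1)] positive_op_abs[OF D_pos]])
      also have "\<dots> \<le> blinfun_apply W (blinfun_apply D (blinfun_apply (op_power V n) \<bar>x\<bar>))"
        by (rule positive_op_mono[OF S_pos[OF W(1)] positive_op_mono[OF D_pos dom]])
      finally show ?thesis by (simp add: V_def D_def)
    qed
    moreover have "P' \<in> ?\<A>" unfolding P'_def by (rule compose_algebra[OF ZD P])
    ultimately show ?case by blast
  qed
  obtain n where n: "norm (op_power V n) < 1 / 4"
    unfolding V_def by (rule commutator_power_small[OF W(1) B, of "1 / 4"]) auto
  obtain P Y where Y: "Y \<in> U" and PY: "P - Y \<in> J"
    and dom: "\<And>x. \<bar>blinfun_apply P x\<bar> \<le> blinfun_apply (op_power V n) \<bar>x\<bar>"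
    using products[of n] by blast
  have "norm P \<le> norm (op_power V n)"
  proof (rule norm_blinfun_bound)
    fix x
    have "norm (blinfun_apply P x) \<le> norm (blinfun_apply (op_power V n) \<bar>x\<bar>)"
      by (rule norm_mono_abs[OF order_trans[OF dom abs_ge_self]])
    also have "\<dots> \<le> norm (op_power V n) * norm \<bar>x\<bar>" by (rule norm_blinfun)
    finally show "norm (blinfun_apply P x) \<le> norm (op_power V n) * norm x" by simp
  qed simp
  then have P_small: "norm P < 1 / 4" using n by simp
  have "- (P - Y) \<in> J" by (rule subspace_neg[OF subspace_ideal PY])
  then have "1 \<le> norm (id_blinfun - (- (P - Y)))" by (rule norm_id_minus_ge_1)
  also have "id_blinfun - (- (P - Y)) = P - (Y - id_blinfun)" by simp
  also have "norm \<dots> \<le> norm P + norm (Y - id_blinfun)" by (rule norm_triangle_ineq4)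
  also have "\<dots> < 1 / 4 + 1 / 2"
    using P_small Y d(2) by (intro add_less_le_mono) (auto simp: U_def)
  finally show False by simp
qed

lemma commutator_in_radical:
  assumes B: "B \<in> banach_algebra_generated S"
  shows "(A o\<^sub>L B) - (B o\<^sub>L A) \<in> operator_radical (banach_algebra_generated S)"
proof -
  let ?\<A> = "closure hull_S"
  have alg: "operator_algebra ?\<A>" by (intro operator_algebra_closure operator_algebra_hull)
  have S_hull: "S \<subseteq> hull_S" by (rule hull_subset)
  then have S_sub: "S \<subseteq> ?\<A>" using closure_subset by blast
  have B': "B \<in> ?\<A>" using B by (simp add: banach_algebra_generated_def)
  have "\<delta> B \<in> J" if J: "maximal_modular_left_ideal_of ?\<A> J" for J
  proof -
    have max: "maximal_left_ideal ?\<A> J"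
    proof unfold_locales
      show "id_blinfun \<in> ?\<A>" using id_mem S_sub by blast
      show "left_ideal_of ?\<A> J" "J \<noteq> ?\<A>"
        using J by (auto simp: maximal_modular_left_ideal_of_def modular_left_ideal_of_def)
      show "K = J \<or> K = ?\<A>" if "left_ideal_of ?\<A> K" "J \<subseteq> K" for K
        using J that by (simp add: maximal_modular_left_ideal_of_def)
    qed (rule alg, rule closed_closure)
    interpret maximal_left_ideal ?\<A> J by (rule max)
    have diff: "\<delta> (M - N) = \<delta> M - \<delta> N" for M N
      unfolding \<delta>_def by (rule blinfun_eqI)
        (simp add: blinfun.diff_left blinfun.diff_right blinfun.scaleR_left scaleR_diff_right)
    have hull: "\<delta> M \<in> J" if "M \<in> hull_S" for M
    proof -
      obtain P Q where PQ: "P \<in> S" "Q \<in> S" "M = P - Q" using \<open>M \<in> hull_S\<close> hull_subset_differences by blast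
      show ?thesis
        unfolding PQ(3) diff
        by (rule subspace_diff[OF subspace_ideal commutator_in_maximal_left_ideal[OF max PQ(1)]
              commutator_in_maximal_left_ideal[OF max PQ(2)]])
    qed
    have "closed {M. \<delta> M \<in> J}"
      unfolding closed_sequential_limits
    proof (intro allI impI)
      fix f M assume "(\<forall>n. f n \<in> {M. \<delta> M \<in> J}) \<and> f \<longlonglongrightarrow> M"
      then have f: "\<And>n. \<delta> (f n) \<in> J" and lim: "f \<longlonglongrightarrow> M" by auto
      have "(\<lambda>n. \<delta> (f n)) \<longlonglongrightarrow> \<delta> M"
        unfolding \<delta>_def
        by (intro tendsto_scaleR tendsto_diff tendsto_const lim
            bounded_bilinear.tendsto[OF bounded_bilinear_blinfun_compose])
      then have "\<delta> M \<in> J" by (rule closed_sequentially[OF ideal_closed f])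
      then show "M \<in> {M. \<delta> M \<in> J}" by simp
    qed
    then have "?\<A> \<subseteq> {M. \<delta> M \<in> J}" using hull by (intro closure_minimal) auto
    then show ?thesis using B' by blast
  qed
  moreover have "\<delta> B \<in> ?\<A>" by (rule \<delta>_mem_algebra[OF alg S_sub B'])
  moreover have "(A o\<^sub>L B) - (B o\<^sub>L A) = s *\<^sub>R \<delta> B"
    using s unfolding \<delta>_def by auto
  moreover have "s *\<^sub>R X \<in> V" if "X \<in> V" "subspace V" for X and V :: "('a \<Rightarrow>\<^sub>L 'a) set"
    by (rule subspace_scale[OF that(2,1)])
  ultimately show ?thesis
    using alg unfolding operator_radical_def banach_algebra_generated_def
    by (auto simp: maximal_modular_left_ideal_of_def modular_left_ideal_of_def left_ideal_of_def operator_algebra_def)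
qed

end

lemma super_left_commutant_locale:
  assumes "positive_op A" "compact_op A"
  shows "super_commutant A (super_left_commutant A) 1"
proof -
  have mem: "M \<in> super_left_commutant A \<longleftrightarrow> positive_op M \<and>
      (\<forall>x\<ge>0. blinfun_apply M (blinfun_apply A x) \<le> blinfun_apply A (blinfun_apply M x))" for M
    by (simp add: super_left_commutant_def op_ge_def positive_op_def blinfun.diff_left)
  show ?thesis
  proof unfold_locales
    show "A \<in> super_left_commutant A" "id_blinfun \<in> super_left_commutant A"
      using assms by (auto simp: mem positive_op_id)
    fix M N assume M: "M \<in> super_left_commutant A"
    then show "positive_op M" by (simp add: mem)
    show "positive_op (1 *\<^sub>R ((A o\<^sub>L M) - (M o\<^sub>L A)))"
      using M by (simp add: super_left_commutant_def op_ge_def)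
    show "c *\<^sub>R M \<in> super_left_commutant A" if "0 \<le> c" for c
      using M that by (simp add: mem positive_op_scaleR blinfun.scaleR_left blinfun.scaleR_right scaleR_left_mono)
    assume N: "N \<in> super_left_commutant A"
    show "M + N \<in> super_left_commutant A"
      using M N by (simp add: mem positive_op_add blinfun.add_left blinfun.add_right add_mono)
    show "M o\<^sub>L N \<in> super_left_commutant A"
      unfolding mem
    proof (intro conjI allI impI)
      show "positive_op (M o\<^sub>L N)" using M N by (simp add: mem positive_op_compose)
      fix x :: 'a assume x: "0 \<le> x"
      have "blinfun_apply M (blinfun_apply N (blinfun_apply A x)) \<le> blinfun_apply M (blinfun_apply A (blinfun_apply N x))"
        using M N x by (intro positive_op_mono) (simp_all add: mem)
      also have "\<dots> \<le> blinfun_apply A (blinfun_apply M (blinfun_apply N x))"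
        using M N x by (simp add: mem positive_opD)
      finally show "blinfun_apply (M o\<^sub>L N) (blinfun_apply A x) \<le> blinfun_apply A (blinfun_apply (M o\<^sub>L N) x)"
        by simp
    qed
  qed (use assms in auto)
qed

lemma super_right_commutant_locale:
  assumes "positive_op A" "compact_op A"
  shows "super_commutant A (super_right_commutant A) (- 1)"
proof -
  have mem: "M \<in> super_right_commutant A \<longleftrightarrow> positive_op M \<and>
      (\<forall>x\<ge>0. blinfun_apply A (blinfun_apply M x) \<le> blinfun_apply M (blinfun_apply A x))" for M
    by (simp add: super_right_commutant_def op_ge_def positive_op_def blinfun.diff_left)
  show ?thesis
  proof unfold_locales
    show "A \<in> super_right_commutant A" "id_blinfun \<in> super_right_commutant A"
      using assms by (auto simp: mem positive_op_id)
    fix M N assume M: "M \<in> super_right_commutant A"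
    then show "positive_op M" by (simp add: mem)
    show "positive_op ((- 1) *\<^sub>R ((A o\<^sub>L M) - (M o\<^sub>L A)))"
      using M by (simp add: super_right_commutant_def op_ge_def)
    show "c *\<^sub>R M \<in> super_right_commutant A" if "0 \<le> c" for c
      using M that by (simp add: mem positive_op_scaleR blinfun.scaleR_left blinfun.scaleR_right scaleR_left_mono)
    assume N: "N \<in> super_right_commutant A"
    show "M + N \<in> super_right_commutant A"
      using M N by (simp add: mem positive_op_add blinfun.add_left blinfun.add_right add_mono)
    show "M o\<^sub>L N \<in> super_right_commutant A"
      unfolding mem
    proof (intro conjI allI impI)
      show "positive_op (M o\<^sub>L N)" using M N by (simp add: mem positive_op_compose)
      fix x :: 'a assume x: "0 \<le> x"
      have "blinfun_apply A (blinfun_apply M (blinfun_apply N x)) \<le> blinfun_apply M (blinfun_apply A (blinfun_apply N x))"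
        using M N x by (simp add: mem positive_opD)
      also have "\<dots> \<le> blinfun_apply M (blinfun_apply N (blinfun_apply A x))"
        using M N x by (intro positive_op_mono) (simp_all add: mem)
      finally show "blinfun_apply A (blinfun_apply (M o\<^sub>L N) x) \<le> blinfun_apply (M o\<^sub>L N) (blinfun_apply A x)"
        by simp
    qed
  qed (use assms in auto)
qed

theorem theorem4p5:
  fixes A :: "'a::banach_lattice \<Rightarrow>\<^sub>L 'a"
    and \<A>\<^sub>1 \<A>\<^sub>2 :: "('a \<Rightarrow>\<^sub>L 'a) set"
  assumes "positive_op A" and "compact_op A"
    and "\<A>\<^sub>1 = banach_algebra_generated (super_left_commutant A)"
    and "\<A>\<^sub>2 = banach_algebra_generated (super_right_commutant A)"
  shows "(\<forall>B\<in>\<A>\<^sub>1. (A o\<^sub>L B) - (B o\<^sub>L A) \<in> operator_radical \<A>\<^sub>1) \<and>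
    (\<forall>B\<in>\<A>\<^sub>2. (A o\<^sub>L B) - (B o\<^sub>L A) \<in> operator_radical \<A>\<^sub>2)"
  unfolding assms(3,4)
  using super_commutant.commutator_in_radical[OF super_left_commutant_locale[OF assms(1,2)]]
    super_commutant.commutator_in_radical[OF super_right_commutant_locale[OF assms(1,2)]]
  by blast

end
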